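(* Let $(\mathbf{T},\otimes)$ be a monoidal category and $\mathscr{B}$ a closed bicategory equipped with two shadows $\mathrm{Sh}_1$ and $\mathrm{Sh}_2$ and a coshadow $\mathrm{Csh}$, all with target $\mathbf{T}$. Suppose also that there is a pairing $\rho_{X,Y}:\mathrm{Csh}(X)\otimes \mathrm{Sh}_2(Y)\to \mathrm{Sh}_1(X\odot Y)$. Let $F:R\to S$ and $G:S\to T$ be right dualizable 1-cells in $\mathscr{B}$, let $Q,N\in\mathscr{B}(R,R)$, $P,M\in\mathscr{B}(S,S)$, $Z\in\mathscr{B}(T,T)$, and let $$\xi: Q\odot F\to F\odot P,\qquad \gamma: F\triangleright M\to N\triangleleft F,$$ $$\zeta: N\odot Q\odot F\odot G\to F\odot G\odot Z,\qquad \delta: M\odot P\odot G\to G\odot Z$$ be 2-cells such that the following two composites $F\odot(F\triangleright M)\odot Q\odot F\odot G\to F\odot G\odot Z$ are equal: $$F\odot(F\triangleright M)\odot Q\odot F\odot G\xrightarrow{1\odot\gamma\odot 1^3}F\odot(N\triangleleft F)\odot Q\odot F\odot G\xrightarrow{\mathrm{ev}\odot 1^3}N\odot Q\odot F\odot G\xrightarrow{\zeta}F\odot G\odot Z$$ and $$F\odot(F\triangleright M)\odot Q\odot F\odot G\xrightarrow{1^2\odot\xi\odot 1}F\odot(F\triangleright M)\odot F\odot P\odot G\xrightarrow{1\odot\mathrm{ev}\odot 1^2}F\odot M\odot P\odot G\xrightarrow{1\odot\delta}F\odot G\odot Z.$$ Then the following two composites $\mathrm{Csh}(M)\otimes\mathrm{Sh}_2(Q)\to\mathrm{Sh}_1(Z)$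 are equal: $$\mathrm{Csh}(M)\otimes\mathrm{Sh}_2(Q)\xrightarrow{\mathrm{cotr}_F(\gamma)\otimes 1}\mathrm{Csh}(N)\otimes\mathrm{Sh}_2(Q)\xrightarrow{\rho}\mathrm{Sh}_1(N\odot Q)\xrightarrow{\mathrm{tr}_{F\odot G}(\zeta)}\mathrm{Sh}_1(Z)$$ and $$\mathrm{Csh}(M)\otimes\mathrm{Sh}_2(Q)\xrightarrow{1\otimes\mathrm{tr}_F(\xi)}\mathrm{Csh}(M)\otimes\mathrm{Sh}_2(P)\xrightarrow{\rho}\mathrm{Sh}_1(M\odot P)\xrightarrow{\mathrm{tr}_G(\delta)}\mathrm{Sh}_1(Z).$$ Here $\mathrm{tr}_F(\xi)$ is the trace with respect to the shadow $\mathrm{Sh}_2$, and $\mathrm{tr}_{F\odot G}(\zeta)$, $\mathrm{tr}_G(\delta)$ are traces with respect to $\mathrm{Sh}_1$.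
   Context: **Bicategories.** $\mathscr{B}(R,S)$ is the category of 1-cells $M:R\to S$ and 2-cells between them. Composition of 1-cells $\odot:\mathscr{B}(R,S)\times\mathscr{B}(S,T)\to\mathscr{B}(R,T)$ is written in diagrammatic order; $U_R$ is the identity 1-cell; $l:U_R\odot M\to M$ and $r:M\odot U_S\to M$ are the unitors for $M:R\to S$. Associators for $\odot$ (and unitors where obvious) are suppressed. **Closed bicategory.** A bicategory with functors $-\triangleleft-:\mathscr{B}(R,T)\times\mathscr{B}(R,S)^{\mathrm{op}}\to\mathscr{B}(S,T)$ and $-\triangleright-:\mathscr{B}(S,T)^{\mathrm{op}}\times\mathscr{B}(R,T)\to\mathscr{B}(R,S)$ and natural isomorphisms $\mathscr{B}(S,T)(N,P\triangleleft M)\cong\mathscr{B}(R,T)(M\odot N,P)\cong\mathscr{B}(R,S)(M,N\triangleright P)$ for $M:R\to S$, $N:S\to T$, $P:R\to T$. Corresponding 2-cells are called transposes of each other. The evaluations $\mathrm{ev}:(N\triangleright P)\odot N\to P$ and $\mathrm{ev}:M\odot(P\triangleleft M)\to P$ are the transposes of identities. For a 2-cell $h$, $h_*$ (resp. $h^*$) is the map induced on hom-objects by covariance in the target (resp. contravariance in the source). **Canonical isomorphisms.** $t:(M\odot N)\triangleright P\to M\triangleright(N\triangleright P)$ is the transpose of the transpose of $\mathrm{ev}:((M\odot N)\triangleright P)\odot M\odot N\to P$; similarly $t:P\triangleleft(M\odot N)\to(P\triangleleft M)\triangleleft N$. The isomorphism $a:(N\triangleright P)\triangleleft M\to N\triangleright(P\triangleleft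 M)$ is the map whose transpose with respect to both $N$ and $M$ is $M\odot((N\triangleright P)\triangleleft M)\odot N\xrightarrow{\mathrm{ev}\odot1}(N\triangleright P)\odot N\xrightarrow{\mathrm{ev}}P$. For $M:R\to S$, $\overline{l}:M\to M\triangleleft U_R$ is the transpose of $l$ and $\overline{r}:M\to U_S\triangleright M$ is the transpose of $r$; both are isomorphisms. **Duality.** $M\in\mathscr{B}(R,S)$ is right dualizable if there are $M^*\in\mathscr{B}(S,R)$ and 2-cells $\eta:U_R\to M\odot M^*$, $\varepsilon:M^*\odot M\to U_S$ with $(1_M\odot\varepsilon)(\eta\odot 1_M)=1_M$ and $(\varepsilon\odot1_{M^*})(1_{M^*}\odot\eta)=1_{M^*}$; $(M,M^* )$ is then a dual pair. If $F,G$ are composable and right dualizable, so is $F\odot G$, with right dual $G^*\odot F^*$. **Shadow.** A shadow on $\mathscr{B}$ with target $\mathbf{T}$: functors $\mathrm{Sh}:\mathscr{B}(R,R)\to\mathbf{T}$ for each $R$ and natural isomorphisms $\theta_{M,N}:\mathrm{Sh}(M\odot N)\to\mathrm{Sh}(N\odot M)$ for $M:R\to S$, $N:S\to R$, such that (suppressing associators) $\theta_{P\odot M,N}\circ\theta_{M\odot N,P}=\theta_{M,N\odot P}$ as maps $\mathrm{Sh}(M\odot N\odot P)\to\mathrm{Sh}(N\odot P\odot M)$, and $\mathrm{Sh}(l)\circ\theta_{M,U_R}=\mathrm{Sh}(r)$, $\mathrm{Sh}(r)\circ\theta_{U_R,M}=\mathrm{Sh}(l)$, whenever these make sense. **Trace.**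 For $M:R\to S$ right dualizable and $f:Q\odot M\to M\odot P$ with $Q:R\to R$, $P:S\to S$, $\mathrm{tr}_M(f)$ is $$\mathrm{Sh}(Q)\xrightarrow{\mathrm{Sh}(1\odot\eta)}\mathrm{Sh}(Q\odot M\odot M^* )\xrightarrow{\mathrm{Sh}(f\odot1)}\mathrm{Sh}(M\odot P\odot M^* )\xrightarrow{\theta}\mathrm{Sh}(M^*\odot M\odot P)\xrightarrow{\mathrm{Sh}(\varepsilon\odot1)}\mathrm{Sh}(P).$$ **Coshadow.** A coshadow on a closed bicategory with target $\mathbf{T}$: functors $\mathrm{Csh}:\mathscr{B}(R,R)\to\mathbf{T}$ for each $R$ and natural isomorphisms $\theta:\mathrm{Csh}(M\triangleright N)\to\mathrm{Csh}(N\triangleleft M)$ for $M,N\in\mathscr{B}(R,S)$ (inverses are also denoted $\theta$), such that for $M:R\to S$, $N:S\to T$, $P:R\to T$ the composites $\mathrm{Csh}((M\odot N)\triangleright P)\xrightarrow{\theta}\mathrm{Csh}(P\triangleleft(M\odot N))\xrightarrow{\mathrm{Csh}(t)}\mathrm{Csh}((P\triangleleft M)\triangleleft N)\xrightarrow{\theta}\mathrm{Csh}(N\triangleright(P\triangleleft M))$ and $\mathrm{Csh}((M\odot N)\triangleright P)\xrightarrow{\mathrm{Csh}(t)}\mathrm{Csh}(M\triangleright(N\triangleright P))\xrightarrow{\theta}\mathrm{Csh}((N\triangleright P)\triangleleft M)\xrightarrow{\mathrm{Csh}(a)}\mathrm{Csh}(N\triangleright(P\triangleleft M))$ agree, and for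 $M\in\mathscr{B}(R,R)$, $\mathrm{Csh}(\overline{l}^{-1})\circ\theta=\mathrm{Csh}(\overline{r}^{-1}):\mathrm{Csh}(U_R\triangleright M)\to\mathrm{Csh}(M)$. **Cotrace.** For a dual pair $(M,M^* )$ with $M:R\to S$ and $f:M\triangleright Q\to P\triangleleft M$ with $Q:S\to S$, $P:R\to R$, $\mathrm{cotr}_M(f):\mathrm{Csh}(Q)\to\mathrm{Csh}(P)$ is the composite of $\mathrm{Csh}$ of the evident maps (and $\theta$): $$Q\xrightarrow{\overline{r}}U_S\triangleright Q\xrightarrow{\varepsilon^*}(M^*\odot M)\triangleright Q\xrightarrow{t}M^*\triangleright(M\triangleright Q)\xrightarrow{f_*}M^*\triangleright(P\triangleleft M),$$ $$\theta:\mathrm{Csh}(M^*\triangleright(P\triangleleft M))\to\mathrm{Csh}((P\triangleleft M)\triangleleft M^* ),$$ $$(P\triangleleft M)\triangleleft M^*\xrightarrow{t^{-1}}P\triangleleft(M\odot M^* )\xrightarrow{\eta^*}P\triangleleft U_R\xrightarrow{\overline{l}^{-1}}P.$$ **Pairing.** A pairing between a coshadow $\mathrm{Csh}$, a shadow $\mathrm{Sh}_2$ and another shadow $\mathrm{Sh}_1$, all with values in the same monoidal category, is a family of maps $\rho_{M,N}:\mathrm{Csh}(M)\otimes\mathrm{Sh}_2(N)\to\mathrm{Sh}_1(M\odot N)$, natural in $M,N\in\mathscr{B}(R,R)$, such that for all $X,Z:R\to S$ and $Y:S\to R$ the two composites $$\mathrm{Csh}(Z\triangleleft X)\otimes\mathrm{Sh}_2(Y\odot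 X)\xrightarrow{\theta\otimes\theta}\mathrm{Csh}(X\triangleright Z)\otimes\mathrm{Sh}_2(X\odot Y)\xrightarrow{\rho}\mathrm{Sh}_1((X\triangleright Z)\odot X\odot Y)\xrightarrow{\mathrm{Sh}_1(\mathrm{ev}\odot1)}\mathrm{Sh}_1(Z\odot Y)$$ $$\mathrm{Csh}(Z\triangleleft X)\otimes\mathrm{Sh}_2(Y\odot X)\xrightarrow{\rho}\mathrm{Sh}_1((Z\triangleleft X)\odot Y\odot X)\xrightarrow{\theta}\mathrm{Sh}_1(X\odot(Z\triangleleft X)\odot Y)\xrightarrow{\mathrm{Sh}_1(\mathrm{ev}\odot1)}\mathrm{Sh}_1(Z\odot Y)$$ are equal. *)

theory Defs
  imports Main
begin

section \<open>Categories, functors and natural transformations\<close>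

text \<open>Composition is written in diagrammatic order: \<open>f ;; g\<close> is first \<open>f\<close>, then \<open>g\<close>.\<close>

record ('x, 'f) category =
  Obj :: "'x set"
  Arr :: "'f set"
  Dom :: "'f \<Rightarrow> 'x"
  Cod :: "'f \<Rightarrow> 'x"
  Idn :: "'x \<Rightarrow> 'f"  ("\<one>\<index>")
  Comp :: "'f \<Rightarrow> 'f \<Rightarrow> 'f"  (infixl ";;\<index>" 55)

definition hom :: "('x, 'f, 'z) category_scheme \<Rightarrow> 'x \<Rightarrow> 'x \<Rightarrow> 'f set"
  where "hom C x y = {f \<in> Arr C. Dom C f = x \<and> Cod C f = y}"

locale category =
  fixes C :: "('x, 'f, 'z) category_scheme" (structure)
  assumes Dom_closed: "f \<in> Arr C \<Longrightarrow> Dom C f \<in> Obj C"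
    and Cod_closed: "f \<in> Arr C \<Longrightarrow> Cod C f \<in> Obj C"
    and Idn_closed: "x \<in> Obj C \<Longrightarrow> \<one> x \<in> hom C x x"
    and Comp_closed: "\<lbrakk>f \<in> hom C x y; g \<in> hom C y z\<rbrakk> \<Longrightarrow> f ;; g \<in> hom C x z"
    and Idn_left: "f \<in> hom C x y \<Longrightarrow> \<one> x ;; f = f"
    and Idn_right: "f \<in> hom C x y \<Longrightarrow> f ;; \<one> y = f"
    and Comp_assoc:
      "\<lbrakk>f \<in> hom C w x; g \<in> hom C x y; h \<in> hom C y z\<rbrakk> \<Longrightarrow> (f ;; g) ;; h = f ;; (g ;; h)"

definition inverse_pair :: "('x, 'f, 'z) category_scheme \<Rightarrow> 'f \<Rightarrow> 'f \<Rightarrow> bool"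
  where "inverse_pair C f g \<longleftrightarrow>
    f \<in> Arr C \<and> g \<in> hom C (Cod C f) (Dom C f) \<and>
    f ;;\<^bsub>C\<^esub> g = \<one>\<^bsub>C\<^esub> (Dom C f) \<and> g ;;\<^bsub>C\<^esub> f = \<one>\<^bsub>C\<^esub> (Cod C f)"

definition iso :: "('x, 'f, 'z) category_scheme \<Rightarrow> 'f \<Rightarrow> bool"
  where "iso C f \<longleftrightarrow> (\<exists>g. inverse_pair C f g)"

definition inv_arr :: "('x, 'f, 'z) category_scheme \<Rightarrow> 'f \<Rightarrow> 'f"  ("(_\<^sup>-\<^sup>1\<index>)" [1000] 999)
  where "inv_arr C f = (THE g. inverse_pair C f g)"

definition op_cat :: "('x, 'f, 'z) category_scheme \<Rightarrow> ('x, 'f) category"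
  where "op_cat C =
    \<lparr>Obj = Obj C, Arr = Arr C, Dom = Cod C, Cod = Dom C, Idn = Idn C,
     Comp = (\<lambda>f g. g ;;\<^bsub>C\<^esub> f)\<rparr>"

definition prod_cat ::
  "('x, 'f, 'z) category_scheme \<Rightarrow> ('y, 'g, 'w) category_scheme \<Rightarrow> ('x \<times> 'y, 'f \<times> 'g) category"
  where "prod_cat C D =
    \<lparr>Obj = Obj C \<times> Obj D, Arr = Arr C \<times> Arr D,
     Dom = (\<lambda>(f, g). (Dom C f, Dom D g)), Cod = (\<lambda>(f, g). (Cod C f, Cod D g)),
     Idn = (\<lambda>(x, y). (\<one>\<^bsub>C\<^esub> x, \<one>\<^bsub>D\<^esub> y)),
     Comp = (\<lambda>(f, g) (f', g'). (f ;;\<^bsub>C\<^esub> f', g ;;\<^bsub>D\<^esub> g'))\<rparr>"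

definition is_functor ::
  "('x, 'f, 'z) category_scheme \<Rightarrow> ('y, 'g, 'w) category_scheme \<Rightarrow> ('x \<Rightarrow> 'y) \<Rightarrow> ('f \<Rightarrow> 'g) \<Rightarrow> bool"
  where "is_functor C D Fo Fa \<longleftrightarrow>
    category C \<and> category D \<and>
    (\<forall>x \<in> Obj C. Fo x \<in> Obj D) \<and>
    (\<forall>f \<in> Arr C. Fa f \<in> hom D (Fo (Dom C f)) (Fo (Cod C f))) \<and>
    (\<forall>x \<in> Obj C. Fa (\<one>\<^bsub>C\<^esub> x) = \<one>\<^bsub>D\<^esub> (Fo x)) \<and>
    (\<forall>f \<in> Arr C. \<forall>g \<in> Arr C. Cod C f = Dom C g \<longrightarrow> Fa (f ;;\<^bsub>C\<^esub> g) = Fa f ;;\<^bsub>D\<^esub> Fa g)"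

text \<open>The transformation \<open>\<tau>\<close> goes from \<open>(Fo, Fa)\<close> to \<open>(Go, Ga)\<close>.\<close>

definition nat_trans ::
  "('x, 'f, 'z) category_scheme \<Rightarrow> ('y, 'g, 'w) category_scheme \<Rightarrow>
   ('x \<Rightarrow> 'y) \<Rightarrow> ('f \<Rightarrow> 'g) \<Rightarrow> ('x \<Rightarrow> 'y) \<Rightarrow> ('f \<Rightarrow> 'g) \<Rightarrow> ('x \<Rightarrow> 'g) \<Rightarrow> bool"
  where "nat_trans C D Fo Fa Go Ga \<tau> \<longleftrightarrow>
    is_functor C D Fo Fa \<and> is_functor C D Go Ga \<and>
    (\<forall>x \<in> Obj C. \<tau> x \<in> hom D (Fo x) (Go x)) \<and>
    (\<forall>f \<in> Arr C. Fa f ;;\<^bsub>D\<^esub> \<tau> (Cod C f) = \<tau> (Dom C f) ;;\<^bsub>D\<^esub> Ga f)"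

definition nat_iso ::
  "('x, 'f, 'z) category_scheme \<Rightarrow> ('y, 'g, 'w) category_scheme \<Rightarrow>
   ('x \<Rightarrow> 'y) \<Rightarrow> ('f \<Rightarrow> 'g) \<Rightarrow> ('x \<Rightarrow> 'y) \<Rightarrow> ('f \<Rightarrow> 'g) \<Rightarrow> ('x \<Rightarrow> 'g) \<Rightarrow> bool"
  where "nat_iso C D Fo Fa Go Ga \<tau> \<longleftrightarrow>
    nat_trans C D Fo Fa Go Ga \<tau> \<and> (\<forall>x \<in> Obj C. iso D (\<tau> x))"


section \<open>Monoidal categories\<close>

record ('x, 'f) monoidal_category = "('x, 'f) category" +
  Tens :: "'x \<Rightarrow> 'x \<Rightarrow> 'x"  (infixl "\<otimes>\<index>" 70)
  Tens2 :: "'f \<Rightarrow> 'f \<Rightarrow> 'f"  (infixl "\<otimes>\<^sub>2\<index>" 70)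
  TUnit :: "'x"
  TAssoc :: "'x \<Rightarrow> 'x \<Rightarrow> 'x \<Rightarrow> 'f"
  TLunit :: "'x \<Rightarrow> 'f"
  TRunit :: "'x \<Rightarrow> 'f"

locale monoidal_category = category T
  for T :: "('x, 'f, 'z) monoidal_category_scheme" (structure) +
  assumes Tens_functor:
      "is_functor (prod_cat T T) T (\<lambda>(x, y). x \<otimes> y) (\<lambda>(f, g). f \<otimes>\<^sub>2 g)"
    and TUnit_closed: "TUnit T \<in> Obj T"
    and TAssoc_nat_iso:
      "nat_iso (prod_cat T (prod_cat T T)) T
        (\<lambda>(x, y, z). (x \<otimes> y) \<otimes> z) (\<lambda>(f, g, h). (f \<otimes>\<^sub>2 g) \<otimes>\<^sub>2 h)
        (\<lambda>(x, y, z). x \<otimes> (y \<otimes> z)) (\<lambda>(f, g, h). f \<otimes>\<^sub>2 (g \<otimes>\<^sub>2 h))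
        (\<lambda>(x, y, z). TAssoc T x y z)"
    and TLunit_nat_iso:
      "nat_iso T T (\<lambda>x. TUnit T \<otimes> x) (\<lambda>f. \<one> (TUnit T) \<otimes>\<^sub>2 f) (\<lambda>x. x) (\<lambda>f. f) (TLunit T)"
    and TRunit_nat_iso:
      "nat_iso T T (\<lambda>x. x \<otimes> TUnit T) (\<lambda>f. f \<otimes>\<^sub>2 \<one> (TUnit T)) (\<lambda>x. x) (\<lambda>f. f) (TRunit T)"
    and TPentagon:
      "\<lbrakk>w \<in> Obj T; x \<in> Obj T; y \<in> Obj T; z \<in> Obj T\<rbrakk> \<Longrightarrow>
        (TAssoc T w x y \<otimes>\<^sub>2 \<one> z) ;; TAssoc T w (x \<otimes> y) z ;; (\<one> w \<otimes>\<^sub>2 TAssoc T x y z)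
        = TAssoc T (w \<otimes> x) y z ;; TAssoc T w x (y \<otimes> z)"
    and TTriangle:
      "\<lbrakk>x \<in> Obj T; y \<in> Obj T\<rbrakk> \<Longrightarrow>
        TAssoc T x (TUnit T) y ;; (\<one> x \<otimes>\<^sub>2 TLunit T y) = TRunit T x \<otimes>\<^sub>2 \<one> y"


section \<open>Bicategories\<close>

text \<open>
  The underlying category of a bicategory record has all 1-cells as objects and all 2-cells as
  arrows, with vertical composition. It is the disjoint union of the categories \<open>B(R, S)\<close>, which
  are recovered by \<open>hcat\<close> from the source and target of a 1-cell. Horizontal composition is in
  diagrammatic order and is not assumed to be strictly associative or unital:
  \<open>\<aa> M N P : (M \<odot> N) \<odot> P \<rightarrow> M \<odot> (N \<odot> P)\<close>, \<open>\<ll> M : U \<odot> M \<rightarrow> M\<close> and \<open>\<rr> M : M \<odot> U \<rightarrow> M\<close> are the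
  associator and the unitors.
\<close>

record ('o, 'c, 'd) bicategory = "('c, 'd) category" +
  Zero :: "'o set"
  src :: "'c \<Rightarrow> 'o"
  trg :: "'c \<Rightarrow> 'o"
  Unit :: "'o \<Rightarrow> 'c"
  HComp :: "'c \<Rightarrow> 'c \<Rightarrow> 'c"  (infixl "\<odot>\<index>" 70)
  HComp2 :: "'d \<Rightarrow> 'd \<Rightarrow> 'd"  (infixl "\<odot>\<^sub>2\<index>" 70)
  Assoc :: "'c \<Rightarrow> 'c \<Rightarrow> 'c \<Rightarrow> 'd"  ("\<aa>\<index>")
  Lunit :: "'c \<Rightarrow> 'd"  ("\<ll>\<index>")
  Runit :: "'c \<Rightarrow> 'd"  ("\<rr>\<index>")

definition cells :: "('o, 'c, 'd, 'z) bicategory_scheme \<Rightarrow> 'o \<Rightarrow> 'o \<Rightarrow> 'c set"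
  where "cells B R S = {M \<in> Obj B. src B M = R \<and> trg B M = S}"

definition hcat :: "('o, 'c, 'd, 'z) bicategory_scheme \<Rightarrow> 'o \<Rightarrow> 'o \<Rightarrow> ('c, 'd) category"
  where "hcat B R S =
    \<lparr>Obj = cells B R S,
     Arr = {f \<in> Arr B. Dom B f \<in> cells B R S \<and> Cod B f \<in> cells B R S},
     Dom = Dom B, Cod = Cod B, Idn = Idn B, Comp = Comp B\<rparr>"

locale bicategory = category B
  for B :: "('o, 'c, 'd, 'z) bicategory_scheme" (structure) +
  assumes src_closed: "M \<in> Obj B \<Longrightarrow> src B M \<in> Zero B"
    and trg_closed: "M \<in> Obj B \<Longrightarrow> trg B M \<in> Zero B"
    and parallel:
      "f \<in> Arr B \<Longrightarrow> src B (Dom B f) = src B (Cod B f) \<and> trg B (Dom B f) = trg B (Cod B f)"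
    and Unit_closed: "R \<in> Zero B \<Longrightarrow> Unit B R \<in> cells B R R"
    and HComp_functor:
      "\<lbrakk>R \<in> Zero B; S \<in> Zero B; T \<in> Zero B\<rbrakk> \<Longrightarrow>
        is_functor (prod_cat (hcat B R S) (hcat B S T)) (hcat B R T)
          (\<lambda>(M, N). M \<odot> N) (\<lambda>(f, g). f \<odot>\<^sub>2 g)"
    and Assoc_nat_iso:
      "\<lbrakk>R \<in> Zero B; S \<in> Zero B; T \<in> Zero B; V \<in> Zero B\<rbrakk> \<Longrightarrow>
        nat_iso (prod_cat (hcat B R S) (prod_cat (hcat B S T) (hcat B T V))) (hcat B R V)
          (\<lambda>(M, N, P). (M \<odot> N) \<odot> P) (\<lambda>(f, g, h). (f \<odot>\<^sub>2 g) \<odot>\<^sub>2 h)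
          (\<lambda>(M, N, P). M \<odot> (N \<odot> P)) (\<lambda>(f, g, h). f \<odot>\<^sub>2 (g \<odot>\<^sub>2 h))
          (\<lambda>(M, N, P). \<aa> M N P)"
    and Lunit_nat_iso:
      "\<lbrakk>R \<in> Zero B; S \<in> Zero B\<rbrakk> \<Longrightarrow>
        nat_iso (hcat B R S) (hcat B R S)
          (\<lambda>M. Unit B R \<odot> M) (\<lambda>f. \<one> (Unit B R) \<odot>\<^sub>2 f) (\<lambda>M. M) (\<lambda>f. f) (\<lambda>M. \<ll> M)"
    and Runit_nat_iso:
      "\<lbrakk>R \<in> Zero B; S \<in> Zero B\<rbrakk> \<Longrightarrow>
        nat_iso (hcat B R S) (hcat B R S)
          (\<lambda>M. M \<odot> Unit B S) (\<lambda>f. f \<odot>\<^sub>2 \<one> (Unit B S)) (\<lambda>M. M) (\<lambda>f. f) (\<lambda>M. \<rr> M)"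
    and Pentagon:
      "\<lbrakk>M \<in> cells B R S; N \<in> cells B S T; P \<in> cells B T V; Q \<in> cells B V W\<rbrakk> \<Longrightarrow>
        (\<aa> M N P \<odot>\<^sub>2 \<one> Q) ;; \<aa> M (N \<odot> P) Q ;; (\<one> M \<odot>\<^sub>2 \<aa> N P Q)
        = \<aa> (M \<odot> N) P Q ;; \<aa> M N (P \<odot> Q)"
    and Triangle:
      "\<lbrakk>M \<in> cells B R S; N \<in> cells B S T\<rbrakk> \<Longrightarrow>
        \<aa> M (Unit B S) N ;; (\<one> M \<odot>\<^sub>2 \<ll> N) = \<rr> M \<odot>\<^sub>2 \<one> N"


section \<open>Closed bicategories\<close>

text \<open>
  \<open>transpL M N P : B(R,T)(M \<odot> N, P) \<rightarrow> B(S,T)(N, P \<triangleleft> M)\<close> and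
  \<open>transpR M N P : B(R,T)(M \<odot> N, P) \<rightarrow> B(R,S)(M, N \<triangleright> P)\<close> are the two hom-set bijections, natural
  in all three variables.
\<close>

record ('o, 'c, 'd) closed_bicategory = "('o, 'c, 'd) bicategory" +
  LHom :: "'c \<Rightarrow> 'c \<Rightarrow> 'c"  (infix "\<triangleleft>\<index>" 75)
  LHom2 :: "'d \<Rightarrow> 'd \<Rightarrow> 'd"  (infix "\<triangleleft>\<^sub>2\<index>" 75)
  RHom :: "'c \<Rightarrow> 'c \<Rightarrow> 'c"  (infix "\<triangleright>\<index>" 75)
  RHom2 :: "'d \<Rightarrow> 'd \<Rightarrow> 'd"  (infix "\<triangleright>\<^sub>2\<index>" 75)
  transpL :: "'c \<Rightarrow> 'c \<Rightarrow> 'c \<Rightarrow> 'd \<Rightarrow> 'd"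
  transpR :: "'c \<Rightarrow> 'c \<Rightarrow> 'c \<Rightarrow> 'd \<Rightarrow> 'd"

locale closed_bicategory = bicategory B
  for B :: "('o, 'c, 'd, 'z) closed_bicategory_scheme" (structure) +
  assumes LHom_functor:
      "\<lbrakk>R \<in> Zero B; S \<in> Zero B; T \<in> Zero B\<rbrakk> \<Longrightarrow>
        is_functor (prod_cat (hcat B R T) (op_cat (hcat B R S))) (hcat B S T)
          (\<lambda>(P, M). P \<triangleleft> M) (\<lambda>(h, f). h \<triangleleft>\<^sub>2 f)"
    and RHom_functor:
      "\<lbrakk>R \<in> Zero B; S \<in> Zero B; T \<in> Zero B\<rbrakk> \<Longrightarrow>
        is_functor (prod_cat (op_cat (hcat B S T)) (hcat B R T)) (hcat B R S)
          (\<lambda>(N, P). N \<triangleright> P) (\<lambda>(g, h). g \<triangleright>\<^sub>2 h)"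
    and transpL_bij:
      "\<lbrakk>M \<in> cells B R S; N \<in> cells B S T; P \<in> cells B R T\<rbrakk> \<Longrightarrow>
        bij_betw (transpL B M N P) (hom B (M \<odot> N) P) (hom B N (P \<triangleleft> M))"
    and transpR_bij:
      "\<lbrakk>M \<in> cells B R S; N \<in> cells B S T; P \<in> cells B R T\<rbrakk> \<Longrightarrow>
        bij_betw (transpR B M N P) (hom B (M \<odot> N) P) (hom B M (N \<triangleright> P))"
    and transpL_natural:
      "\<lbrakk>M \<in> cells B R S; N \<in> cells B S T; P \<in> cells B R T;
        f \<in> hom B M' M; g \<in> hom B N' N; h \<in> hom B P P'; k \<in> hom B (M \<odot> N) P\<rbrakk> \<Longrightarrow>
        transpL B M' N' P' ((f \<odot>\<^sub>2 g) ;; k ;; h) = g ;; transpL B M N P k ;; (h \<triangleleft>\<^sub>2 f)"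
    and transpR_natural:
      "\<lbrakk>M \<in> cells B R S; N \<in> cells B S T; P \<in> cells B R T;
        f \<in> hom B M' M; g \<in> hom B N' N; h \<in> hom B P P'; k \<in> hom B (M \<odot> N) P\<rbrakk> \<Longrightarrow>
        transpR B M' N' P' ((f \<odot>\<^sub>2 g) ;; k ;; h) = f ;; transpR B M N P k ;; (g \<triangleright>\<^sub>2 h)"

text \<open>\<open>evL M P : M \<odot> (P \<triangleleft> M) \<rightarrow> P\<close> and \<open>evR N P : (N \<triangleright> P) \<odot> N \<rightarrow> P\<close>.\<close>

definition evL :: "('o, 'c, 'd, 'z) closed_bicategory_scheme \<Rightarrow> 'c \<Rightarrow> 'c \<Rightarrow> 'd"
  where "evL B M P =
    inv_into (hom B (M \<odot>\<^bsub>B\<^esub> (P \<triangleleft>\<^bsub>B\<^esub> M)) P) (transpL B M (P \<triangleleft>\<^bsub>B\<^esub> M) P) (\<one>\<^bsub>B\<^esub> (P \<triangleleft>\<^bsub>B\<^esub> M))"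

definition evR :: "('o, 'c, 'd, 'z) closed_bicategory_scheme \<Rightarrow> 'c \<Rightarrow> 'c \<Rightarrow> 'd"
  where "evR B N P =
    inv_into (hom B ((N \<triangleright>\<^bsub>B\<^esub> P) \<odot>\<^bsub>B\<^esub> N) P) (transpR B (N \<triangleright>\<^bsub>B\<^esub> P) N P) (\<one>\<^bsub>B\<^esub> (N \<triangleright>\<^bsub>B\<^esub> P))"

text \<open>
  \<open>tR M N P : (M \<odot> N) \<triangleright> P \<rightarrow> M \<triangleright> (N \<triangleright> P)\<close>, \<open>tL M N P : P \<triangleleft> (M \<odot> N) \<rightarrow> (P \<triangleleft> M) \<triangleleft> N\<close> and
  \<open>aLR M N P : (N \<triangleright> P) \<triangleleft> M \<rightarrow> N \<triangleright> (P \<triangleleft> M)\<close>.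
\<close>

definition tR :: "('o, 'c, 'd, 'z) closed_bicategory_scheme \<Rightarrow> 'c \<Rightarrow> 'c \<Rightarrow> 'c \<Rightarrow> 'd"
  where "tR B M N P =
    (let X = (M \<odot>\<^bsub>B\<^esub> N) \<triangleright>\<^bsub>B\<^esub> P in
      transpR B X M (N \<triangleright>\<^bsub>B\<^esub> P)
        (transpR B (X \<odot>\<^bsub>B\<^esub> M) N P (\<aa>\<^bsub>B\<^esub> X M N ;;\<^bsub>B\<^esub> evR B (M \<odot>\<^bsub>B\<^esub> N) P)))"

definition tL :: "('o, 'c, 'd, 'z) closed_bicategory_scheme \<Rightarrow> 'c \<Rightarrow> 'c \<Rightarrow> 'c \<Rightarrow> 'd"
  where "tL B M N P =
    (let Y = P \<triangleleft>\<^bsub>B\<^esub> (M \<odot>\<^bsub>B\<^esub> N) in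
      transpL B N Y (P \<triangleleft>\<^bsub>B\<^esub> M)
        (transpL B M (N \<odot>\<^bsub>B\<^esub> Y) P ((\<aa>\<^bsub>B\<^esub> M N Y)\<^sup>-\<^sup>1\<^bsub>B\<^esub> ;;\<^bsub>B\<^esub> evL B (M \<odot>\<^bsub>B\<^esub> N) P)))"

definition aLR :: "('o, 'c, 'd, 'z) closed_bicategory_scheme \<Rightarrow> 'c \<Rightarrow> 'c \<Rightarrow> 'c \<Rightarrow> 'd"
  where "aLR B M N P =
    (let K = (N \<triangleright>\<^bsub>B\<^esub> P) \<triangleleft>\<^bsub>B\<^esub> M in
      transpR B K N (P \<triangleleft>\<^bsub>B\<^esub> M)
        (transpL B M (K \<odot>\<^bsub>B\<^esub> N) P
          ((\<aa>\<^bsub>B\<^esub> M K N)\<^sup>-\<^sup>1\<^bsub>B\<^esub> ;;\<^bsub>B\<^esub> (evL B M (N \<triangleright>\<^bsub>B\<^esub> P) \<odot>\<^sub>2\<^bsub>B\<^esub> \<one>\<^bsub>B\<^esub> N) ;;\<^bsub>B\<^esub> evR B N P)))"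

text \<open>\<open>lbar M : M \<rightarrow> M \<triangleleft> U\<close> and \<open>rbar M : M \<rightarrow> U \<triangleright> M\<close>.\<close>

definition lbar :: "('o, 'c, 'd, 'z) closed_bicategory_scheme \<Rightarrow> 'c \<Rightarrow> 'd"
  where "lbar B M = transpL B (Unit B (src B M)) M M (\<ll>\<^bsub>B\<^esub> M)"

definition rbar :: "('o, 'c, 'd, 'z) closed_bicategory_scheme \<Rightarrow> 'c \<Rightarrow> 'd"
  where "rbar B M = transpR B M (Unit B (trg B M)) M (\<rr>\<^bsub>B\<^esub> M)"


section \<open>Duality\<close>

locale dual_pair = bicategory B
  for B :: "('o, 'c, 'd, 'z) bicategory_scheme" (structure)
    and M Md :: 'c and \<eta> \<epsilon> :: 'd +
  assumes M_closed: "M \<in> Obj B"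
    and Md_closed: "Md \<in> cells B (trg B M) (src B M)"
    and unit_closed: "\<eta> \<in> hom B (Unit B (src B M)) (M \<odot> Md)"
    and counit_closed: "\<epsilon> \<in> hom B (Md \<odot> M) (Unit B (trg B M))"
    and triangle_M:
      "(\<ll> M)\<^sup>-\<^sup>1 ;; (\<eta> \<odot>\<^sub>2 \<one> M) ;; \<aa> M Md M ;; (\<one> M \<odot>\<^sub>2 \<epsilon>) ;; \<rr> M = \<one> M"
    and triangle_Md:
      "(\<rr> Md)\<^sup>-\<^sup>1 ;; (\<one> Md \<odot>\<^sub>2 \<eta>) ;; (\<aa> Md M Md)\<^sup>-\<^sup>1 ;; (\<epsilon> \<odot>\<^sub>2 \<one> Md) ;; \<ll> Md = \<one> Md"

text \<open>
  Unit and counit exhibiting \<open>Gd \<odot> Fd\<close> as right dual of \<open>F \<odot> G\<close>, given dual pairs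
  \<open>(F, Fd, \<eta>F, \<epsilon>F)\<close> and \<open>(G, Gd, \<eta>G, \<epsilon>G)\<close>.
\<close>

definition comp_unit ::
  "('o, 'c, 'd, 'z) bicategory_scheme \<Rightarrow> 'c \<Rightarrow> 'c \<Rightarrow> 'd \<Rightarrow> 'c \<Rightarrow> 'c \<Rightarrow> 'd \<Rightarrow> 'd"
  where "comp_unit B F Fd \<eta>F G Gd \<eta>G =
    \<eta>F ;;\<^bsub>B\<^esub> (\<one>\<^bsub>B\<^esub> F \<odot>\<^sub>2\<^bsub>B\<^esub> ((\<ll>\<^bsub>B\<^esub> Fd)\<^sup>-\<^sup>1\<^bsub>B\<^esub> ;;\<^bsub>B\<^esub> (\<eta>G \<odot>\<^sub>2\<^bsub>B\<^esub> \<one>\<^bsub>B\<^esub> Fd) ;;\<^bsub>B\<^esub> \<aa>\<^bsub>B\<^esub> G Gd Fd))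
      ;;\<^bsub>B\<^esub> (\<aa>\<^bsub>B\<^esub> F G (Gd \<odot>\<^bsub>B\<^esub> Fd))\<^sup>-\<^sup>1\<^bsub>B\<^esub>"

definition comp_counit ::
  "('o, 'c, 'd, 'z) bicategory_scheme \<Rightarrow> 'c \<Rightarrow> 'c \<Rightarrow> 'd \<Rightarrow> 'c \<Rightarrow> 'c \<Rightarrow> 'd \<Rightarrow> 'd"
  where "comp_counit B F Fd \<epsilon>F G Gd \<epsilon>G =
    \<aa>\<^bsub>B\<^esub> Gd Fd (F \<odot>\<^bsub>B\<^esub> G)
      ;;\<^bsub>B\<^esub> (\<one>\<^bsub>B\<^esub> Gd \<odot>\<^sub>2\<^bsub>B\<^esub> ((\<aa>\<^bsub>B\<^esub> Fd F G)\<^sup>-\<^sup>1\<^bsub>B\<^esub> ;;\<^bsub>B\<^esub> (\<epsilon>F \<odot>\<^sub>2\<^bsub>B\<^esub> \<one>\<^bsub>B\<^esub> G) ;;\<^bsub>B\<^esub> \<ll>\<^bsub>B\<^esub> G)) ;;\<^bsub>B\<^esub> \<epsilon>G"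


section \<open>Shadows and traces\<close>

text \<open>
  Since a 1-cell determines its source and target, the functors \<open>Sh : B(R, R) \<rightarrow> T\<close> for the
  various \<open>R\<close> are combined into one pair of maps.
\<close>

record ('c, 'd, 't, 'u) shadow =
  Sh :: "'c \<Rightarrow> 't"
  Sh2 :: "'d \<Rightarrow> 'u"
  Sh\<theta> :: "'c \<Rightarrow> 'c \<Rightarrow> 'u"

locale shadow = bicategory B + T: category T
  for B :: "('o, 'c, 'd, 'z) bicategory_scheme" (structure)
    and T :: "('t, 'u, 'w) category_scheme" (structure)
    and \<Sigma> :: "('c, 'd, 't, 'u) shadow" +
  assumes Sh_functor: "R \<in> Zero B \<Longrightarrow> is_functor (hcat B R R) T (Sh \<Sigma>) (Sh2 \<Sigma>)"
    and Sh\<theta>_nat_iso: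
      "\<lbrakk>R \<in> Zero B; S \<in> Zero B\<rbrakk> \<Longrightarrow>
        nat_iso (prod_cat (hcat B R S) (hcat B S R)) T
          (\<lambda>(M, N). Sh \<Sigma> (M \<odot> N)) (\<lambda>(f, g). Sh2 \<Sigma> (f \<odot>\<^sub>2 g))
          (\<lambda>(M, N). Sh \<Sigma> (N \<odot> M)) (\<lambda>(f, g). Sh2 \<Sigma> (g \<odot>\<^sub>2 f))
          (\<lambda>(M, N). Sh\<theta> \<Sigma> M N)"
    and Sh\<theta>_hexagon:
      "\<lbrakk>M \<in> cells B R S; N \<in> cells B S V; P \<in> cells B V R\<rbrakk> \<Longrightarrow>
        Sh\<theta> \<Sigma> (M \<odot> N) P ;;\<^bsub>T\<^esub> Sh2 \<Sigma> ((\<aa> P M N)\<^sup>-\<^sup>1) ;;\<^bsub>T\<^esub> Sh\<theta> \<Sigma> (P \<odot> M) N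
        = Sh2 \<Sigma> (\<aa> M N P) ;;\<^bsub>T\<^esub> Sh\<theta> \<Sigma> M (N \<odot> P) ;;\<^bsub>T\<^esub> Sh2 \<Sigma> (\<aa> N P M)"
    and Sh\<theta>_unit_right:
      "M \<in> cells B R R \<Longrightarrow> Sh\<theta> \<Sigma> M (Unit B R) ;;\<^bsub>T\<^esub> Sh2 \<Sigma> (\<ll> M) = Sh2 \<Sigma> (\<rr> M)"
    and Sh\<theta>_unit_left:
      "M \<in> cells B R R \<Longrightarrow> Sh\<theta> \<Sigma> (Unit B R) M ;;\<^bsub>T\<^esub> Sh2 \<Sigma> (\<rr> M) = Sh2 \<Sigma> (\<ll> M)"

text \<open>Trace of \<open>f : Q \<odot> M \<rightarrow> M \<odot> P\<close> with respect to the dual pair \<open>(M, Md, \<eta>, \<epsilon>)\<close>.\<close>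

definition trace ::
  "('o, 'c, 'd, 'z) bicategory_scheme \<Rightarrow> ('t, 'u, 'w) category_scheme \<Rightarrow>
   ('c, 'd, 't, 'u) shadow \<Rightarrow> 'c \<Rightarrow> 'c \<Rightarrow> 'd \<Rightarrow> 'd \<Rightarrow> 'c \<Rightarrow> 'c \<Rightarrow> 'd \<Rightarrow> 'u"
  where "trace B T \<Sigma> M Md \<eta> \<epsilon> Q P f =
    Sh2 \<Sigma> ((\<rr>\<^bsub>B\<^esub> Q)\<^sup>-\<^sup>1\<^bsub>B\<^esub> ;;\<^bsub>B\<^esub> (\<one>\<^bsub>B\<^esub> Q \<odot>\<^sub>2\<^bsub>B\<^esub> \<eta>) ;;\<^bsub>B\<^esub> (\<aa>\<^bsub>B\<^esub> Q M Md)\<^sup>-\<^sup>1\<^bsub>B\<^esub>)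
    ;;\<^bsub>T\<^esub> Sh2 \<Sigma> (f \<odot>\<^sub>2\<^bsub>B\<^esub> \<one>\<^bsub>B\<^esub> Md)
    ;;\<^bsub>T\<^esub> Sh\<theta> \<Sigma> (M \<odot>\<^bsub>B\<^esub> P) Md
    ;;\<^bsub>T\<^esub> Sh2 \<Sigma> ((\<aa>\<^bsub>B\<^esub> Md M P)\<^sup>-\<^sup>1\<^bsub>B\<^esub> ;;\<^bsub>B\<^esub> (\<epsilon> \<odot>\<^sub>2\<^bsub>B\<^esub> \<one>\<^bsub>B\<^esub> P) ;;\<^bsub>B\<^esub> \<ll>\<^bsub>B\<^esub> P)"


section \<open>Coshadows and cotraces\<close>

record ('c, 'd, 't, 'u) coshadow =
  Csh :: "'c \<Rightarrow> 't"
  Csh2 :: "'d \<Rightarrow> 'u"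
  Csh\<theta> :: "'c \<Rightarrow> 'c \<Rightarrow> 'u"

locale coshadow = closed_bicategory B + T: category T
  for B :: "('o, 'c, 'd, 'z) closed_bicategory_scheme" (structure)
    and T :: "('t, 'u, 'w) category_scheme" (structure)
    and \<Gamma> :: "('c, 'd, 't, 'u) coshadow" +
  assumes Csh_functor: "R \<in> Zero B \<Longrightarrow> is_functor (hcat B R R) T (Csh \<Gamma>) (Csh2 \<Gamma>)"
    and Csh\<theta>_nat_iso:
      "\<lbrakk>R \<in> Zero B; S \<in> Zero B\<rbrakk> \<Longrightarrow>
        nat_iso (prod_cat (op_cat (hcat B R S)) (hcat B R S)) T
          (\<lambda>(M, N). Csh \<Gamma> (M \<triangleright> N)) (\<lambda>(f, g). Csh2 \<Gamma> (f \<triangleright>\<^sub>2 g))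
          (\<lambda>(M, N). Csh \<Gamma> (N \<triangleleft> M)) (\<lambda>(f, g). Csh2 \<Gamma> (g \<triangleleft>\<^sub>2 f))
          (\<lambda>(M, N). Csh\<theta> \<Gamma> M N)"
    and Csh\<theta>_hexagon:
      "\<lbrakk>M \<in> cells B R S; N \<in> cells B S V; P \<in> cells B R V\<rbrakk> \<Longrightarrow>
        Csh\<theta> \<Gamma> (M \<odot> N) P ;;\<^bsub>T\<^esub> Csh2 \<Gamma> (tL B M N P) ;;\<^bsub>T\<^esub> (Csh\<theta> \<Gamma> N (P \<triangleleft> M))\<^sup>-\<^sup>1\<^bsub>T\<^esub>
        = Csh2 \<Gamma> (tR B M N P) ;;\<^bsub>T\<^esub> Csh\<theta> \<Gamma> M (N \<triangleright> P) ;;\<^bsub>T\<^esub> Csh2 \<Gamma> (aLR B M N P)"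
    and Csh\<theta>_unit:
      "M \<in> cells B R R \<Longrightarrow>
        Csh\<theta> \<Gamma> (Unit B R) M ;;\<^bsub>T\<^esub> Csh2 \<Gamma> ((lbar B M)\<^sup>-\<^sup>1) = Csh2 \<Gamma> ((rbar B M)\<^sup>-\<^sup>1)"

text \<open>Cotrace of \<open>f : M \<triangleright> Q \<rightarrow> P \<triangleleft> M\<close> with respect to the dual pair \<open>(M, Md, \<eta>, \<epsilon>)\<close>.\<close>

definition cotrace ::
  "('o, 'c, 'd, 'z) closed_bicategory_scheme \<Rightarrow> ('t, 'u, 'w) category_scheme \<Rightarrow>
   ('c, 'd, 't, 'u) coshadow \<Rightarrow> 'c \<Rightarrow> 'c \<Rightarrow> 'd \<Rightarrow> 'd \<Rightarrow> 'c \<Rightarrow> 'c \<Rightarrow> 'd \<Rightarrow> 'u"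
  where "cotrace B T \<Gamma> M Md \<eta> \<epsilon> Q P f =
    Csh2 \<Gamma> (rbar B Q ;;\<^bsub>B\<^esub> (\<epsilon> \<triangleright>\<^sub>2\<^bsub>B\<^esub> \<one>\<^bsub>B\<^esub> Q) ;;\<^bsub>B\<^esub> tR B Md M Q ;;\<^bsub>B\<^esub> (\<one>\<^bsub>B\<^esub> Md \<triangleright>\<^sub>2\<^bsub>B\<^esub> f))
    ;;\<^bsub>T\<^esub> Csh\<theta> \<Gamma> Md (P \<triangleleft>\<^bsub>B\<^esub> M)
    ;;\<^bsub>T\<^esub> Csh2 \<Gamma> ((tL B M Md P)\<^sup>-\<^sup>1\<^bsub>B\<^esub> ;;\<^bsub>B\<^esub> (\<one>\<^bsub>B\<^esub> P \<triangleleft>\<^sub>2\<^bsub>B\<^esub> \<eta>) ;;\<^bsub>B\<^esub> (lbar B P)\<^sup>-\<^sup>1\<^bsub>B\<^esub>)"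


section \<open>Pairings\<close>

locale pairing =
  closed_bicategory B + T: monoidal_category T +
  Csh: coshadow B T \<Gamma> + Sh2: shadow B T \<Sigma>2 + Sh1: shadow B T \<Sigma>1
  for B :: "('o, 'c, 'd, 'z) closed_bicategory_scheme" (structure)
    and T :: "('t, 'u, 'w) monoidal_category_scheme" (structure)
    and \<Gamma> :: "('c, 'd, 't, 'u) coshadow"
    and \<Sigma>2 \<Sigma>1 :: "('c, 'd, 't, 'u) shadow"
    and \<rho> :: "'c \<Rightarrow> 'c \<Rightarrow> 'u" +
  assumes pairing_natural:
      "R \<in> Zero B \<Longrightarrow>
        nat_trans (prod_cat (hcat B R R) (hcat B R R)) T
          (\<lambda>(M, N). Csh \<Gamma> M \<otimes>\<^bsub>T\<^esub> Sh \<Sigma>2 N) (\<lambda>(f, g). Csh2 \<Gamma> f \<otimes>\<^sub>2\<^bsub>T\<^esub> Sh2 \<Sigma>2 g)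
          (\<lambda>(M, N). Sh \<Sigma>1 (M \<odot> N)) (\<lambda>(f, g). Sh2 \<Sigma>1 (f \<odot>\<^sub>2 g))
          (\<lambda>(M, N). \<rho> M N)"
    and pairing_cyclic:
      "\<lbrakk>X \<in> cells B R S; Z \<in> cells B R S; Y \<in> cells B S R\<rbrakk> \<Longrightarrow>
        ((Csh\<theta> \<Gamma> X Z)\<^sup>-\<^sup>1\<^bsub>T\<^esub> \<otimes>\<^sub>2\<^bsub>T\<^esub> Sh\<theta> \<Sigma>2 Y X)
          ;;\<^bsub>T\<^esub> \<rho> (X \<triangleright> Z) (X \<odot> Y)
          ;;\<^bsub>T\<^esub> Sh2 \<Sigma>1 ((\<aa> (X \<triangleright> Z) X Y)\<^sup>-\<^sup>1 ;; (evR B X Z \<odot>\<^sub>2 \<one> Y))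
        = \<rho> (Z \<triangleleft> X) (Y \<odot> X)
          ;;\<^bsub>T\<^esub> Sh2 \<Sigma>1 ((\<aa> (Z \<triangleleft> X) Y X)\<^sup>-\<^sup>1)
          ;;\<^bsub>T\<^esub> Sh\<theta> \<Sigma>1 ((Z \<triangleleft> X) \<odot> Y) X
          ;;\<^bsub>T\<^esub> Sh2 \<Sigma>1 ((\<aa> X (Z \<triangleleft> X) Y)\<^sup>-\<^sup>1 ;; (evL B X Z \<odot>\<^sub>2 \<one> Y))"

end

theory Submission
  imports Defs
begin

text \<open>
  Put \<open>L = N \<triangleleft> F\<close>. The cotrace of \<open>\<gamma>\<close> is a map \<open>Csh M \<rightarrow> Csh (Fd \<triangleright> L)\<close>, induced by a 2-cell made of \<open>\<epsilon>F\<close>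
  and \<open>\<gamma>\<close>, followed by \<open>\<theta> : Csh (Fd \<triangleright> L) \<rightarrow> Csh (L \<triangleleft> Fd)\<close> and by a map \<open>Csh (L \<triangleleft> Fd) \<rightarrow> Csh N\<close> induced by a
  2-cell made of \<open>\<eta>F\<close> and two left evaluations (\<open>cotrace_entry\<close>, \<open>cotrace_exit\<close>). By naturality of the
  pairing the last of these maps can be applied after \<open>\<rho>\<close>, in the shadow \<open>\<Sigma>1\<close>. There the
  coevaluation can be rotated to the other side of \<open>Q\<close> (\<open>whiskered_unit_rotation\<close>), so that it acts on \<open>Q\<close>
  alone and can be moved back to the shadow \<open>\<Sigma>2\<close>, as at the beginning of the trace of \<open>\<xi>\<close>. Now the pairing axiom for \<open>Fd\<close> applies. It trades
  a left evaluation for a right one, cancels the rotation of the cotrace and produces the rotation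
  of the trace of \<open>\<xi>\<close>. This is \<open>cotrace_pairing\<close>.

  What remains is an equation between maps in \<open>\<Sigma>1\<close> alone (\<open>trace_exchange\<close>). Its left side contains \<open>\<gamma>\<close>, the
  left evaluation at \<open>F\<close> and \<open>\<zeta>\<close>, composed as in the compatibility hypothesis. After the hypothesis has been
  applied, the 2-cell traced over \<open>F \<odot> G\<close> is \<open>F \<odot> \<kappa>\<close> followed by \<open>F \<odot> \<delta>'\<close>, where \<open>\<kappa>\<close> comes from \<open>\<xi>\<close>, and \<open>\<delta>'\<close>
  from the right evaluation and \<open>\<delta>\<close>. A trace over \<open>F \<odot> G\<close> of such a 2-cell is a trace over \<open>F\<close> followed
  by a trace over \<open>G\<close> (\<open>trace_comp\<close>). A trace over \<open>F\<close> of a 2-cell \<open>F \<odot> \<kappa>\<close>, preceded by a rotation, is the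
  shadow of \<open>\<kappa>\<close> (\<open>trace_cyclic\<close>), by the hexagon and the triangle identity. Finally \<open>\<epsilon>F\<close> from the beginning
  of the cotrace and the right evaluation combine to the contraction of \<open>Fd\<close> against \<open>F\<close> that ends
  the trace of \<open>\<xi>\<close> (\<open>dcounit_via_transpose\<close>).

  Associators and unitors are explicit throughout. Chains of arrows are associated to the right,
  naturality moves associators to the front of a chain, and the pentagon is used in
  the shapes needed there. The conditions that make composites well-typed are expressed by the maps
  \<open>Dom\<close>, \<open>Cod\<close>, \<open>src\<close> and \<open>trg\<close>, whose values the simplifier computes.
\<close>

section \<open>Calculating with arrows of a category\<close>

context category
begin

lemma hom_iff: "f \<in> hom C x y \<longleftrightarrow> f \<in> Arr C \<and> Dom C f = x \<and> Cod C f = y"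
  by (auto simp: hom_def)

lemma Dom_Obj [simp]: "f \<in> Arr C \<Longrightarrow> Dom C f \<in> Obj C"
  and Cod_Obj [simp]: "f \<in> Arr C \<Longrightarrow> Cod C f \<in> Obj C"
  by (rule Dom_closed Cod_closed; assumption)+

lemma Idn_simps [simp]:
  assumes "x \<in> Obj C"
  shows "\<one> x \<in> Arr C" "Dom C (\<one> x) = x" "Cod C (\<one> x) = x"
  using Idn_closed[OF assms] by (auto simp: hom_iff)

lemma comp_simps [simp]:
  assumes "f \<in> Arr C" "g \<in> Arr C" "Cod C f = Dom C g"
  shows "f ;; g \<in> Arr C" "Dom C (f ;; g) = Dom C f" "Cod C (f ;; g) = Cod C g"
  using Comp_closed[of f "Dom C f" "Cod C f" g "Cod C g"] assms by (auto simp: hom_iff)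

lemma comp_Idn_left [simp]: "f \<in> Arr C \<Longrightarrow> Dom C f = x \<Longrightarrow> \<one> x ;; f = f"
  using Idn_left by (auto simp: hom_iff)

lemma comp_Idn_right [simp]: "f \<in> Arr C \<Longrightarrow> Cod C f = x \<Longrightarrow> f ;; \<one> x = f"
  using Idn_right by (auto simp: hom_iff)

lemma comp_assoc:
  assumes "f \<in> Arr C" "g \<in> Arr C" "h \<in> Arr C" "Cod C f = Dom C g" "Cod C g = Dom C h"
  shows "(f ;; g) ;; h = f ;; (g ;; h)"
  using Comp_assoc[of f "Dom C f" "Cod C f" g "Cod C g" h "Cod C h"] assms by (auto simp: hom_iff)

text \<open>
  Chains of arrows are kept associated to the right. This turns an equation between two
  composites into a rewrite rule for such chains.
\<close>

lemma comp_extend: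
  assumes "f ;; g = f' ;; g'"
    and "f \<in> Arr C" "g \<in> Arr C" "Cod C f = Dom C g"
    and "f' \<in> Arr C" "g' \<in> Arr C" "Cod C f' = Dom C g'"
    and "k \<in> Arr C" "Cod C g = Dom C k"
  shows "f ;; (g ;; k) = f' ;; (g' ;; k)"
  using assms by (metis comp_assoc comp_simps(3))

lemma inverse_pair_unique:
  assumes "inverse_pair C f g" "inverse_pair C f g'"
  shows "g = g'"
proof -
  have "g = g ;; (f ;; g')"
    using assms by (simp add: inverse_pair_def hom_iff)
  also have "\<dots> = (g ;; f) ;; g'"
    using assms by (intro comp_assoc[symmetric]) (auto simp: inverse_pair_def hom_iff)
  also have "\<dots> = g'"
    using assms by (auto simp: inverse_pair_def hom_iff)
  finally show ?thesis .
qed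

lemma inv_arr_eqI:
  assumes "inverse_pair C f g"
  shows "f\<^sup>-\<^sup>1 = g"
  unfolding inv_arr_def using assms by (blast intro: the_equality inverse_pair_unique)

lemma inverse_pair_inv_arr: "iso C f \<Longrightarrow> inverse_pair C f (f\<^sup>-\<^sup>1)"
  using inv_arr_eqI by (auto simp: iso_def)

lemma iso_Arr: "iso C f \<Longrightarrow> f \<in> Arr C"
  using inverse_pair_inv_arr by (simp add: inverse_pair_def)

lemma iso_simps [simp]:
  assumes "iso C f"
  shows "f\<^sup>-\<^sup>1 \<in> Arr C" "Dom C (f\<^sup>-\<^sup>1) = Cod C f" "Cod C (f\<^sup>-\<^sup>1) = Dom C f"
    "f ;; f\<^sup>-\<^sup>1 = \<one> (Dom C f)" "f\<^sup>-\<^sup>1 ;; f = \<one> (Cod C f)"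
  using inverse_pair_inv_arr[OF assms] by (auto simp: inverse_pair_def hom_iff)

lemma iso_cancel [simp]:
  assumes "iso C f" "k \<in> Arr C"
  shows "Dom C k = Dom C f \<Longrightarrow> f ;; (f\<^sup>-\<^sup>1 ;; k) = k"
    and "Dom C k = Cod C f \<Longrightarrow> f\<^sup>-\<^sup>1 ;; (f ;; k) = k"
  using assms iso_Arr[OF assms(1)] by (simp_all add: comp_assoc[symmetric])

lemma iso_epi:
  assumes "iso C f" "g \<in> Arr C" "h \<in> Arr C" "Dom C g = Cod C f" "Dom C h = Cod C f"
    and "f ;; g = f ;; h"
  shows "g = h"
  using assms by (metis iso_cancel(2))

lemma iso_mono:
  assumes "iso C f" "g \<in> Arr C" "h \<in> Arr C" "Cod C g = Dom C f" "Cod C h = Dom C f"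
    and "g ;; f = h ;; f"
  shows "g = h"
proof -
  have "g = (g ;; f) ;; f\<^sup>-\<^sup>1" "h = (h ;; f) ;; f\<^sup>-\<^sup>1"
    using assms(1-5) by (simp_all add: comp_assoc iso_Arr)
  then show ?thesis using assms(6) by simp
qed

text \<open>This is how naturality passes from an isomorphism to its inverse.\<close>

lemma iso_square:
  assumes "iso C a" "iso C b" "f \<in> Arr C" "g \<in> Arr C"
    and "Cod C f = Dom C b" "Cod C a = Dom C g" "Dom C f = Dom C a" "Cod C g = Cod C b"
    and "f ;; b = a ;; g"
  shows "g ;; b\<^sup>-\<^sup>1 = a\<^sup>-\<^sup>1 ;; f"
proof (rule iso_epi[OF assms(1)])
  have "a ;; (g ;; b\<^sup>-\<^sup>1) = (a ;; g) ;; b\<^sup>-\<^sup>1"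
    using assms(1-8) iso_Arr[OF assms(1)] iso_Arr[OF assms(2)] by (simp add: comp_assoc)
  also have "\<dots> = f"
    unfolding assms(9)[symmetric] using assms(1-8) iso_Arr[OF assms(1)] iso_Arr[OF assms(2)] by (simp add: comp_assoc)
  finally show "a ;; (g ;; b\<^sup>-\<^sup>1) = a ;; (a\<^sup>-\<^sup>1 ;; f)" using assms(1-8) iso_Arr[OF assms(1)] iso_Arr[OF assms(2)] by simp
qed (use assms iso_Arr[OF assms(1)] in simp_all)

lemma iso_Idn [simp]: "x \<in> Obj C \<Longrightarrow> iso C (\<one> x)"
  unfolding iso_def inverse_pair_def by (rule exI[of _ "\<one> x"]) (simp add: hom_iff)

lemma inverse_pair_comp:
  assumes "iso C f" "iso C g" "Cod C f = Dom C g"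
  shows "inverse_pair C (f ;; g) (g\<^sup>-\<^sup>1 ;; f\<^sup>-\<^sup>1)"
  using assms by (simp add: inverse_pair_def hom_iff comp_assoc iso_Arr)

lemma iso_comp [simp]:
  assumes "iso C f" "iso C g" "Cod C f = Dom C g"
  shows "iso C (f ;; g)" "(f ;; g)\<^sup>-\<^sup>1 = g\<^sup>-\<^sup>1 ;; f\<^sup>-\<^sup>1"
  using inverse_pair_comp[OF assms] inv_arr_eqI by (auto simp: iso_def)

lemma iso_inv [simp]:
  assumes "iso C f"
  shows "iso C (f\<^sup>-\<^sup>1)" "(f\<^sup>-\<^sup>1)\<^sup>-\<^sup>1 = f"
proof -
  have *: "inverse_pair C (f\<^sup>-\<^sup>1) f"
    using assms iso_Arr[OF assms] by (simp add: inverse_pair_def hom_iff)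
  then show "iso C (f\<^sup>-\<^sup>1)" unfolding iso_def by blast
  from * show "(f\<^sup>-\<^sup>1)\<^sup>-\<^sup>1 = f" by (rule inv_arr_eqI)
qed

lemma inv_Idn [simp]: "x \<in> Obj C \<Longrightarrow> (\<one> x)\<^sup>-\<^sup>1 = \<one> x"
  by (rule inv_arr_eqI) (simp add: inverse_pair_def hom_iff)

end

section \<open>Calculating with 2-cells of a bicategory\<close>

context bicategory
begin

lemma cells_simps:
  assumes "M \<in> cells B R S"
  shows "M \<in> Obj B" "src B M = R" "trg B M = S"
  using assms by (auto simp: cells_def)

lemma Zero_simps [simp]:
  assumes "M \<in> Obj B"
  shows "src B M \<in> Zero B" "trg B M \<in> Zero B"
  using assms src_closed trg_closed by auto

lemma Unit_simps [simp]:
  assumes "R \<in> Zero B"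
  shows "Unit B R \<in> Obj B" "src B (Unit B R) = R" "trg B (Unit B R) = R"
  using Unit_closed[OF assms] by (auto simp: cells_def)

lemma hcat_simps:
  "Obj (hcat B R S) = cells B R S"
  "f \<in> Arr (hcat B R S) \<longleftrightarrow> f \<in> Arr B \<and> src B (Dom B f) = R \<and> trg B (Dom B f) = S"
  "Dom (hcat B R S) = Dom B" "Cod (hcat B R S) = Cod B"
  "Idn (hcat B R S) = Idn B" "Comp (hcat B R S) = Comp B"
  using parallel[of f] by (auto simp: hcat_def cells_def)

lemma hom_hcat:
  "f \<in> hom (hcat B R S) M N \<longleftrightarrow> f \<in> hom B M N \<and> M \<in> cells B R S \<and> N \<in> cells B R S"
  by (auto simp: hom_def hcat_def)

lemma iso_hcat:
  assumes "iso (hcat B R S) f"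
  shows "iso B f"
proof -
  obtain g where g: "inverse_pair (hcat B R S) f g"
    using assms unfolding iso_def by blast
  then have "inverse_pair B f g"
    unfolding inverse_pair_def hom_hcat unfolding hcat_simps by blast
  then show ?thesis unfolding iso_def by blast
qed

lemma HComp_simps [simp]:
  assumes "M \<in> Obj B" "N \<in> Obj B" "trg B M = src B N"
  shows "M \<odot> N \<in> Obj B" "src B (M \<odot> N) = src B M" "trg B (M \<odot> N) = trg B N"
proof -
  have "M \<odot> N \<in> cells B (src B M) (trg B N)"
    using HComp_functor[of "src B M" "src B N" "trg B N"] assms
    by (auto simp: is_functor_def prod_cat_def hcat_simps cells_def)
  then show "M \<odot> N \<in> Obj B" "src B (M \<odot> N) = src B M" "trg B (M \<odot> N) = trg B N"
    by (auto simp: cells_def)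
qed

lemma HComp2_simps [simp]:
  assumes "f \<in> Arr B" "g \<in> Arr B" "trg B (Dom B f) = src B (Dom B g)"
  shows "f \<odot>\<^sub>2 g \<in> Arr B" "Dom B (f \<odot>\<^sub>2 g) = Dom B f \<odot> Dom B g"
    "Cod B (f \<odot>\<^sub>2 g) = Cod B f \<odot> Cod B g"
proof -
  let ?R = "src B (Dom B f)" and ?S = "trg B (Dom B f)" and ?T = "trg B (Dom B g)"
  have "f \<odot>\<^sub>2 g \<in> hom (hcat B ?R ?T) (Dom B f \<odot> Dom B g) (Cod B f \<odot> Cod B g)"
    using HComp_functor[of ?R ?S ?T] assms
    by (auto simp: is_functor_def prod_cat_def hcat_simps)
  then show "f \<odot>\<^sub>2 g \<in> Arr B" "Dom B (f \<odot>\<^sub>2 g) = Dom B f \<odot> Dom B g"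
    "Cod B (f \<odot>\<^sub>2 g) = Cod B f \<odot> Cod B g"
    by (auto simp: hom_hcat hom_iff)
qed

lemma HComp2_Idn [simp]:
  assumes "M \<in> Obj B" "N \<in> Obj B" "trg B M = src B N"
  shows "\<one> M \<odot>\<^sub>2 \<one> N = \<one> (M \<odot> N)"
  using HComp_functor[of "src B M" "src B N" "trg B N"] assms
  by (auto simp: is_functor_def prod_cat_def hcat_simps cells_def)

lemma interchange:
  assumes "f \<in> Arr B" "g \<in> Arr B" "f' \<in> Arr B" "g' \<in> Arr B"
    and "Cod B f = Dom B f'" "Cod B g = Dom B g'" "trg B (Dom B f) = src B (Dom B g)"
  shows "(f \<odot>\<^sub>2 g) ;; (f' \<odot>\<^sub>2 g') = (f ;; f') \<odot>\<^sub>2 (g ;; g')"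
proof -
  have "src B (Dom B f') = src B (Dom B f)" "trg B (Dom B f') = trg B (Dom B f)"
    "src B (Dom B g') = src B (Dom B g)" "trg B (Dom B g') = trg B (Dom B g)"
    using parallel[OF assms(1)] parallel[OF assms(2)] assms by auto
  then show ?thesis
    using HComp_functor[of "src B (Dom B f)" "src B (Dom B g)" "trg B (Dom B g)"] assms
    by (auto simp: is_functor_def prod_cat_def hcat_simps)
qed

lemma parallel_simps:
  assumes "f \<in> Arr B"
  shows "src B (Cod B f) = src B (Dom B f)" "trg B (Cod B f) = trg B (Dom B f)"
  using parallel[OF assms] by auto

lemma interchange_chain:
  assumes "f \<in> Arr B" "g \<in> Arr B" "f' \<in> Arr B" "g' \<in> Arr B" "k \<in> Arr B"
    and "Cod B f = Dom B f'" "Cod B g = Dom B g'" "trg B (Dom B f) = src B (Dom B g)"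
    and "Dom B k = Cod B f' \<odot> Cod B g'"
  shows "(f \<odot>\<^sub>2 g) ;; ((f' \<odot>\<^sub>2 g') ;; k) = ((f ;; f') \<odot>\<^sub>2 (g ;; g')) ;; k"
  using assms parallel_simps[OF assms(1)] parallel_simps[OF assms(2)]
  by (simp add: interchange[symmetric] comp_assoc)

lemma Assoc_simps [simp]:
  assumes "M \<in> Obj B" "N \<in> Obj B" "P \<in> Obj B" "trg B M = src B N" "trg B N = src B P"
  shows "iso B (\<aa> M N P)" "\<aa> M N P \<in> Arr B" "Dom B (\<aa> M N P) = (M \<odot> N) \<odot> P" "Cod B (\<aa> M N P) = M \<odot> (N \<odot> P)"
proof -
  let ?H = "hcat B (src B M) (trg B P)"
  have *: "iso ?H (\<aa> M N P)" "\<aa> M N P \<in> hom ?H ((M \<odot> N) \<odot> P) (M \<odot> (N \<odot> P))"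
    using Assoc_nat_iso[of "src B M" "src B N" "src B P" "trg B P"] assms
    by (auto simp: nat_iso_def nat_trans_def prod_cat_def hcat_simps cells_def)
  then show "iso B (\<aa> M N P)" "\<aa> M N P \<in> Arr B" "Dom B (\<aa> M N P) = (M \<odot> N) \<odot> P" "Cod B (\<aa> M N P) = M \<odot> (N \<odot> P)"
    using iso_hcat[OF *(1)] by (simp_all add: hom_hcat hom_iff)
qed

lemma Assoc_natural:
  assumes "f \<in> Arr B" "g \<in> Arr B" "h \<in> Arr B"
    and "trg B (Dom B f) = src B (Dom B g)" "trg B (Dom B g) = src B (Dom B h)"
    and "Cod B f = M'" "Cod B g = N'" "Cod B h = P'"
  shows "((f \<odot>\<^sub>2 g) \<odot>\<^sub>2 h) ;; \<aa> M' N' P' = \<aa> (Dom B f) (Dom B g) (Dom B h) ;; (f \<odot>\<^sub>2 (g \<odot>\<^sub>2 h))"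
  using Assoc_nat_iso[of "src B (Dom B f)" "src B (Dom B g)" "src B (Dom B h)" "trg B (Dom B h)"] assms
  by (auto simp: nat_iso_def nat_trans_def prod_cat_def hcat_simps)

lemma Assoc_inv_natural:
  assumes "f \<in> Arr B" "g \<in> Arr B" "h \<in> Arr B"
    and "trg B (Dom B f) = src B (Dom B g)" "trg B (Dom B g) = src B (Dom B h)"
    and "Cod B f = M'" "Cod B g = N'" "Cod B h = P'"
  shows "(f \<odot>\<^sub>2 (g \<odot>\<^sub>2 h)) ;; (\<aa> M' N' P')\<^sup>-\<^sup>1
    = (\<aa> (Dom B f) (Dom B g) (Dom B h))\<^sup>-\<^sup>1 ;; ((f \<odot>\<^sub>2 g) \<odot>\<^sub>2 h)"
  using parallel_simps[OF assms(1)] parallel_simps[OF assms(2)] parallel_simps[OF assms(3)] assms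
  by (intro iso_square Assoc_natural) auto

lemma Lunit_simps [simp]:
  assumes "M \<in> Obj B"
  shows "iso B (\<ll> M)" "\<ll> M \<in> Arr B" "Dom B (\<ll> M) = Unit B (src B M) \<odot> M" "Cod B (\<ll> M) = M"
proof -
  let ?H = "hcat B (src B M) (trg B M)"
  have *: "iso ?H (\<ll> M)" "\<ll> M \<in> hom ?H (Unit B (src B M) \<odot> M) M"
    using Lunit_nat_iso[of "src B M" "trg B M"] assms
    by (auto simp: nat_iso_def nat_trans_def hcat_simps cells_def)
  then show "iso B (\<ll> M)" "\<ll> M \<in> Arr B" "Dom B (\<ll> M) = Unit B (src B M) \<odot> M" "Cod B (\<ll> M) = M"
    using iso_hcat[OF *(1)] by (simp_all add: hom_hcat hom_iff)
qed

lemma Runit_simps [simp]: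
  assumes "M \<in> Obj B"
  shows "iso B (\<rr> M)" "\<rr> M \<in> Arr B" "Dom B (\<rr> M) = M \<odot> Unit B (trg B M)" "Cod B (\<rr> M) = M"
proof -
  let ?H = "hcat B (src B M) (trg B M)"
  have *: "iso ?H (\<rr> M)" "\<rr> M \<in> hom ?H (M \<odot> Unit B (trg B M)) M"
    using Runit_nat_iso[of "src B M" "trg B M"] assms
    by (auto simp: nat_iso_def nat_trans_def hcat_simps cells_def)
  then show "iso B (\<rr> M)" "\<rr> M \<in> Arr B" "Dom B (\<rr> M) = M \<odot> Unit B (trg B M)" "Cod B (\<rr> M) = M"
    using iso_hcat[OF *(1)] by (simp_all add: hom_hcat hom_iff)
qed

lemma Lunit_natural:
  assumes "f \<in> Arr B" "Cod B f = M'" "R = src B (Dom B f)"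
  shows "(\<one> (Unit B R) \<odot>\<^sub>2 f) ;; \<ll> M' = \<ll> (Dom B f) ;; f"
  using Lunit_nat_iso[of "src B (Dom B f)" "trg B (Dom B f)"] assms
  by (auto simp: nat_iso_def nat_trans_def hcat_simps)

lemma Runit_natural:
  assumes "f \<in> Arr B" "Cod B f = M'" "S = trg B (Dom B f)"
  shows "(f \<odot>\<^sub>2 \<one> (Unit B S)) ;; \<rr> M' = \<rr> (Dom B f) ;; f"
  using Runit_nat_iso[of "src B (Dom B f)" "trg B (Dom B f)"] assms
  by (auto simp: nat_iso_def nat_trans_def hcat_simps)

lemma Lunit_inv_natural:
  assumes "f \<in> Arr B" "Cod B f = M'"
  shows "f ;; (\<ll> M')\<^sup>-\<^sup>1 = (\<ll> (Dom B f))\<^sup>-\<^sup>1 ;; (\<one> (Unit B (src B (Dom B f))) \<odot>\<^sub>2 f)"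
  using parallel_simps[OF assms(1)] assms
  by (intro iso_square Lunit_natural) auto

lemma Runit_inv_natural:
  assumes "f \<in> Arr B" "Cod B f = M'"
  shows "f ;; (\<rr> M')\<^sup>-\<^sup>1 = (\<rr> (Dom B f))\<^sup>-\<^sup>1 ;; (f \<odot>\<^sub>2 \<one> (Unit B (trg B (Dom B f))))"
  using parallel_simps[OF assms(1)] assms
  by (intro iso_square Runit_natural) auto

lemma pentagon:
  assumes "M \<in> Obj B" "N \<in> Obj B" "P \<in> Obj B" "Q \<in> Obj B"
    and "trg B M = src B N" "trg B N = src B P" "trg B P = src B Q"
  shows "(\<aa> M N P \<odot>\<^sub>2 \<one> Q) ;; (\<aa> M (N \<odot> P) Q ;; (\<one> M \<odot>\<^sub>2 \<aa> N P Q))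
    = \<aa> (M \<odot> N) P Q ;; \<aa> M N (P \<odot> Q)"
  using Pentagon[of M "src B M" "src B N" N "src B P" P "src B Q" Q "trg B Q"] assms
  by (simp add: cells_def comp_assoc)

lemma triangle:
  assumes "M \<in> Obj B" "N \<in> Obj B" "trg B M = src B N" "S = src B N"
  shows "\<aa> M (Unit B S) N ;; (\<one> M \<odot>\<^sub>2 \<ll> N) = \<rr> M \<odot>\<^sub>2 \<one> N"
  using Triangle[of M "src B M" "src B N" N "trg B N"] assms by (simp add: cells_def)

section \<open>Coherence of associators and unitors\<close>

lemma inverse_pair_HComp2:
  assumes "iso B f" "iso B g" "trg B (Dom B f) = src B (Dom B g)"
  shows "inverse_pair B (f \<odot>\<^sub>2 g) (f\<^sup>-\<^sup>1 \<odot>\<^sub>2 g\<^sup>-\<^sup>1)"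
  using assms parallel_simps[of f] parallel_simps[of g]
  by (simp add: inverse_pair_def hom_iff interchange iso_Arr)

lemma iso_HComp2 [simp]:
  assumes "iso B f" "iso B g" "trg B (Dom B f) = src B (Dom B g)"
  shows "iso B (f \<odot>\<^sub>2 g)" "(f \<odot>\<^sub>2 g)\<^sup>-\<^sup>1 = f\<^sup>-\<^sup>1 \<odot>\<^sub>2 g\<^sup>-\<^sup>1"
  using inverse_pair_HComp2[OF assms] inv_arr_eqI by (auto simp: iso_def)

lemma whisker_left:
  assumes "H \<in> Obj B" "f \<in> Arr B" "g \<in> Arr B" "Cod B f = Dom B g" "trg B H = src B (Dom B f)"
  shows "\<one> H \<odot>\<^sub>2 (f ;; g) = (\<one> H \<odot>\<^sub>2 f) ;; (\<one> H \<odot>\<^sub>2 g)"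
  using assms by (simp add: interchange)

lemma whisker_right:
  assumes "H \<in> Obj B" "f \<in> Arr B" "g \<in> Arr B" "Cod B f = Dom B g" "trg B (Dom B f) = src B H"
  shows "(f ;; g) \<odot>\<^sub>2 \<one> H = (f \<odot>\<^sub>2 \<one> H) ;; (g \<odot>\<^sub>2 \<one> H)"
  using assms by (simp add: interchange)

text \<open>
  Naturality of the associator for a 2-cell whiskered by two 1-cells, oriented so that associators
  move to the front of a chain.
\<close>

lemma Assoc_natural_whiskered:
  shows "\<lbrakk>f \<in> Arr B; N \<in> Obj B; P \<in> Obj B; trg B (Dom B f) = src B N; trg B N = src B P; Cod B f = M'\<rbrakk>
      \<Longrightarrow> ((f \<odot>\<^sub>2 \<one> N) \<odot>\<^sub>2 \<one> P) ;; \<aa> M' N P = \<aa> (Dom B f) N P ;; (f \<odot>\<^sub>2 \<one> (N \<odot> P))"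
    and "\<lbrakk>M \<in> Obj B; g \<in> Arr B; P \<in> Obj B; trg B M = src B (Dom B g); trg B (Dom B g) = src B P; Cod B g = N'\<rbrakk>
      \<Longrightarrow> ((\<one> M \<odot>\<^sub>2 g) \<odot>\<^sub>2 \<one> P) ;; \<aa> M N' P = \<aa> M (Dom B g) P ;; (\<one> M \<odot>\<^sub>2 (g \<odot>\<^sub>2 \<one> P))"
    and "\<lbrakk>M \<in> Obj B; N \<in> Obj B; h \<in> Arr B; trg B M = src B N; trg B N = src B (Dom B h); Cod B h = P'\<rbrakk>
      \<Longrightarrow> (\<one> (M \<odot> N) \<odot>\<^sub>2 h) ;; \<aa> M N P' = \<aa> M N (Dom B h) ;; (\<one> M \<odot>\<^sub>2 (\<one> N \<odot>\<^sub>2 h))"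
  using Assoc_natural[of f "\<one> N" "\<one> P" M' N P] Assoc_natural[of "\<one> M" g "\<one> P" M N' P]
    Assoc_natural[of "\<one> M" "\<one> N" h M N P'] by simp_all

lemma Assoc_inv_natural_whiskered:
  shows "\<lbrakk>f \<in> Arr B; N \<in> Obj B; P \<in> Obj B; trg B (Dom B f) = src B N; trg B N = src B P; Cod B f = M'\<rbrakk>
      \<Longrightarrow> (f \<odot>\<^sub>2 \<one> (N \<odot> P)) ;; (\<aa> M' N P)\<^sup>-\<^sup>1 = (\<aa> (Dom B f) N P)\<^sup>-\<^sup>1 ;; ((f \<odot>\<^sub>2 \<one> N) \<odot>\<^sub>2 \<one> P)"
    and "\<lbrakk>M \<in> Obj B; g \<in> Arr B; P \<in> Obj B; trg B M = src B (Dom B g); trg B (Dom B g) = src B P; Cod B g = N'\<rbrakk>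
      \<Longrightarrow> (\<one> M \<odot>\<^sub>2 (g \<odot>\<^sub>2 \<one> P)) ;; (\<aa> M N' P)\<^sup>-\<^sup>1 = (\<aa> M (Dom B g) P)\<^sup>-\<^sup>1 ;; ((\<one> M \<odot>\<^sub>2 g) \<odot>\<^sub>2 \<one> P)"
    and "\<lbrakk>M \<in> Obj B; N \<in> Obj B; h \<in> Arr B; trg B M = src B N; trg B N = src B (Dom B h); Cod B h = P'\<rbrakk>
      \<Longrightarrow> (\<one> M \<odot>\<^sub>2 (\<one> N \<odot>\<^sub>2 h)) ;; (\<aa> M N P')\<^sup>-\<^sup>1 = (\<aa> M N (Dom B h))\<^sup>-\<^sup>1 ;; (\<one> (M \<odot> N) \<odot>\<^sub>2 h)"
  using Assoc_inv_natural[of f "\<one> N" "\<one> P" M' N P] Assoc_inv_natural[of "\<one> M" g "\<one> P" M N' P]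
    Assoc_inv_natural[of "\<one> M" "\<one> N" h M N P'] by simp_all

lemma Assoc_natural_whiskered_chain:
  shows "\<lbrakk>f \<in> Arr B; N \<in> Obj B; P \<in> Obj B; trg B (Dom B f) = src B N; trg B N = src B P; Cod B f = M';
      k \<in> Arr B; Dom B k = M' \<odot> (N \<odot> P)\<rbrakk>
      \<Longrightarrow> ((f \<odot>\<^sub>2 \<one> N) \<odot>\<^sub>2 \<one> P) ;; (\<aa> M' N P ;; k) = \<aa> (Dom B f) N P ;; ((f \<odot>\<^sub>2 \<one> (N \<odot> P)) ;; k)"
    and "\<lbrakk>M \<in> Obj B; g \<in> Arr B; P \<in> Obj B; trg B M = src B (Dom B g); trg B (Dom B g) = src B P; Cod B g = N';
      k \<in> Arr B; Dom B k = M \<odot> (N' \<odot> P)\<rbrakk>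
      \<Longrightarrow> ((\<one> M \<odot>\<^sub>2 g) \<odot>\<^sub>2 \<one> P) ;; (\<aa> M N' P ;; k) = \<aa> M (Dom B g) P ;; ((\<one> M \<odot>\<^sub>2 (g \<odot>\<^sub>2 \<one> P)) ;; k)"
    and "\<lbrakk>M \<in> Obj B; N \<in> Obj B; h \<in> Arr B; trg B M = src B N; trg B N = src B (Dom B h); Cod B h = P';
      k \<in> Arr B; Dom B k = M \<odot> (N \<odot> P')\<rbrakk>
      \<Longrightarrow> (\<one> (M \<odot> N) \<odot>\<^sub>2 h) ;; (\<aa> M N P' ;; k) = \<aa> M N (Dom B h) ;; ((\<one> M \<odot>\<^sub>2 (\<one> N \<odot>\<^sub>2 h)) ;; k)"
  using parallel_simps[of f] parallel_simps[of g] parallel_simps[of h]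
  by (auto intro!: comp_extend Assoc_natural_whiskered)

lemma Assoc_inv_natural_whiskered_chain:
  shows "\<lbrakk>f \<in> Arr B; N \<in> Obj B; P \<in> Obj B; trg B (Dom B f) = src B N; trg B N = src B P; Cod B f = M';
      k \<in> Arr B; Dom B k = (M' \<odot> N) \<odot> P\<rbrakk>
      \<Longrightarrow> (f \<odot>\<^sub>2 \<one> (N \<odot> P)) ;; ((\<aa> M' N P)\<^sup>-\<^sup>1 ;; k) = (\<aa> (Dom B f) N P)\<^sup>-\<^sup>1 ;; (((f \<odot>\<^sub>2 \<one> N) \<odot>\<^sub>2 \<one> P) ;; k)"
    and "\<lbrakk>M \<in> Obj B; g \<in> Arr B; P \<in> Obj B; trg B M = src B (Dom B g); trg B (Dom B g) = src B P; Cod B g = N';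
      k \<in> Arr B; Dom B k = (M \<odot> N') \<odot> P\<rbrakk>
      \<Longrightarrow> (\<one> M \<odot>\<^sub>2 (g \<odot>\<^sub>2 \<one> P)) ;; ((\<aa> M N' P)\<^sup>-\<^sup>1 ;; k) = (\<aa> M (Dom B g) P)\<^sup>-\<^sup>1 ;; (((\<one> M \<odot>\<^sub>2 g) \<odot>\<^sub>2 \<one> P) ;; k)"
    and "\<lbrakk>M \<in> Obj B; N \<in> Obj B; h \<in> Arr B; trg B M = src B N; trg B N = src B (Dom B h); Cod B h = P';
      k \<in> Arr B; Dom B k = (M \<odot> N) \<odot> P'\<rbrakk>
      \<Longrightarrow> (\<one> M \<odot>\<^sub>2 (\<one> N \<odot>\<^sub>2 h)) ;; ((\<aa> M N P')\<^sup>-\<^sup>1 ;; k) = (\<aa> M N (Dom B h))\<^sup>-\<^sup>1 ;; ((\<one> (M \<odot> N) \<odot>\<^sub>2 h) ;; k)"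
  using parallel_simps[of f] parallel_simps[of g] parallel_simps[of h]
  by (auto intro!: comp_extend Assoc_inv_natural_whiskered)

lemmas slide_Assoc = Assoc_natural_whiskered Assoc_natural_whiskered_chain
lemmas slide_Assoc_inv = Assoc_inv_natural_whiskered Assoc_inv_natural_whiskered_chain
lemmas whisker = whisker_left whisker_right
lemmas merge = interchange interchange_chain

lemma pentagon_inv:
  assumes "M \<in> Obj B" "N \<in> Obj B" "P \<in> Obj B" "Q \<in> Obj B"
    and "trg B M = src B N" "trg B N = src B P" "trg B P = src B Q"
  shows "(\<one> M \<odot>\<^sub>2 (\<aa> N P Q)\<^sup>-\<^sup>1) ;; ((\<aa> M (N \<odot> P) Q)\<^sup>-\<^sup>1 ;; ((\<aa> M N P)\<^sup>-\<^sup>1 \<odot>\<^sub>2 \<one> Q))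
    = (\<aa> M N (P \<odot> Q))\<^sup>-\<^sup>1 ;; (\<aa> (M \<odot> N) P Q)\<^sup>-\<^sup>1"
  using arg_cong[OF pentagon[OF assms], of "inv_arr B"] assms by (simp add: comp_assoc)

lemma pentagon_left_inv:
  assumes "M \<in> Obj B" "N \<in> Obj B" "P \<in> Obj B" "Q \<in> Obj B"
    and "trg B M = src B N" "trg B N = src B P" "trg B P = src B Q"
  shows "(\<one> M \<odot>\<^sub>2 (\<aa> N P Q)\<^sup>-\<^sup>1) ;; (\<aa> M (N \<odot> P) Q)\<^sup>-\<^sup>1
    = (\<aa> M N (P \<odot> Q))\<^sup>-\<^sup>1 ;; ((\<aa> (M \<odot> N) P Q)\<^sup>-\<^sup>1 ;; (\<aa> M N P \<odot>\<^sub>2 \<one> Q))"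
  using assms
  by - (rule iso_mono[of "(\<aa> M N P)\<^sup>-\<^sup>1 \<odot>\<^sub>2 \<one> Q"],
    simp_all add: comp_assoc pentagon_inv interchange)

lemma Lunit_faithful:
  assumes "f \<in> Arr B" "g \<in> Arr B" "Dom B f = Dom B g" "Cod B f = Cod B g"
    and "\<one> (Unit B (src B (Dom B f))) \<odot>\<^sub>2 f = \<one> (Unit B (src B (Dom B f))) \<odot>\<^sub>2 g"
  shows "f = g"
proof (rule iso_epi[of "\<ll> (Dom B f)"])
  show "\<ll> (Dom B f) ;; f = \<ll> (Dom B f) ;; g"
    using Lunit_natural[OF assms(1) refl refl] Lunit_natural[OF assms(2) refl refl] assms(3-5) by metis
qed (use assms in simp_all)

lemma Runit_faithful:
  assumes "f \<in> Arr B" "g \<in> Arr B" "Dom B f = Dom B g" "Cod B f = Cod B g"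
    and "f \<odot>\<^sub>2 \<one> (Unit B (trg B (Dom B f))) = g \<odot>\<^sub>2 \<one> (Unit B (trg B (Dom B f)))"
  shows "f = g"
proof (rule iso_epi[of "\<rr> (Dom B f)"])
  show "\<rr> (Dom B f) ;; f = \<rr> (Dom B f) ;; g"
    using Runit_natural[OF assms(1) refl refl] Runit_natural[OF assms(2) refl refl] assms(3-5) by metis
qed (use assms in simp_all)

text \<open>
  Kelly's lemmas. Whiskering with a unit 1-cell is faithful, and after whiskering both equations follow
  from the pentagon and the triangle.
\<close>

lemma Runit_HComp:
  assumes "M \<in> Obj B" "N \<in> Obj B" "trg B M = src B N" "S = trg B N"
  shows "\<aa> M N (Unit B S) ;; (\<one> M \<odot>\<^sub>2 \<rr> N) = \<rr> (M \<odot> N)"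
proof (rule Runit_faithful)
  let ?U = "Unit B (trg B N)"
  have "((\<aa> M N ?U \<odot>\<^sub>2 \<one> ?U) ;; ((\<one> M \<odot>\<^sub>2 \<rr> N) \<odot>\<^sub>2 \<one> ?U)) ;; \<aa> M N ?U
      = (\<aa> M N ?U \<odot>\<^sub>2 \<one> ?U) ;; (\<aa> M (N \<odot> ?U) ?U ;; (\<one> M \<odot>\<^sub>2 (\<rr> N \<odot>\<^sub>2 \<one> ?U)))"
    using assms by (simp add: comp_assoc Assoc_natural)
  also have "\<dots> = ((\<aa> M N ?U \<odot>\<^sub>2 \<one> ?U) ;; (\<aa> M (N \<odot> ?U) ?U ;; (\<one> M \<odot>\<^sub>2 \<aa> N ?U ?U))) ;; (\<one> M \<odot>\<^sub>2 (\<one> N \<odot>\<^sub>2 \<ll> ?U))"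
    using assms by (simp add: comp_assoc triangle[symmetric] whisker_left)
  also have "\<dots> = (\<aa> (M \<odot> N) ?U ?U ;; (\<one> (M \<odot> N) \<odot>\<^sub>2 \<ll> ?U)) ;; \<aa> M N ?U"
    using assms by (simp add: comp_assoc pentagon slide_Assoc)
  also have "\<dots> = (\<rr> (M \<odot> N) \<odot>\<^sub>2 \<one> ?U) ;; \<aa> M N ?U"
    using assms by (simp add: triangle)
  finally have "(\<aa> M N ?U \<odot>\<^sub>2 \<one> ?U) ;; ((\<one> M \<odot>\<^sub>2 \<rr> N) \<odot>\<^sub>2 \<one> ?U) = \<rr> (M \<odot> N) \<odot>\<^sub>2 \<one> ?U"
    by (rule iso_mono[rotated -1]) (use assms in simp_all)
  then show "(\<aa> M N (Unit B S) ;; (\<one> M \<odot>\<^sub>2 \<rr> N)) \<odot>\<^sub>2 \<one> (Unit B (trg B (Dom B (\<aa> M N (Unit B S) ;; (\<one> M \<odot>\<^sub>2 \<rr> N)))))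
    = \<rr> (M \<odot> N) \<odot>\<^sub>2 \<one> (Unit B (trg B (Dom B (\<aa> M N (Unit B S) ;; (\<one> M \<odot>\<^sub>2 \<rr> N)))))"
    using assms by (simp add: whisker_right)
qed (use assms in simp_all)

lemma Lunit_HComp:
  assumes "M \<in> Obj B" "N \<in> Obj B" "trg B M = src B N" "R = src B M"
  shows "\<aa> (Unit B R) M N ;; \<ll> (M \<odot> N) = \<ll> M \<odot>\<^sub>2 \<one> N"
proof (rule Lunit_faithful)
  let ?U = "Unit B (src B M)"
  have "(\<aa> ?U ?U M \<odot>\<^sub>2 \<one> N) ;; (\<aa> ?U (?U \<odot> M) N ;; ((\<one> ?U \<odot>\<^sub>2 \<aa> ?U M N) ;; (\<one> ?U \<odot>\<^sub>2 \<ll> (M \<odot> N))))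
      = ((\<aa> ?U ?U M \<odot>\<^sub>2 \<one> N) ;; (\<aa> ?U (?U \<odot> M) N ;; (\<one> ?U \<odot>\<^sub>2 \<aa> ?U M N))) ;; (\<one> ?U \<odot>\<^sub>2 \<ll> (M \<odot> N))"
    using assms by (simp add: comp_assoc)
  also have "\<dots> = \<aa> (?U \<odot> ?U) M N ;; (\<rr> ?U \<odot>\<^sub>2 \<one> (M \<odot> N))"
    using assms by (simp add: comp_assoc triangle pentagon)
  also have "\<dots> = ((\<rr> ?U \<odot>\<^sub>2 \<one> M) \<odot>\<^sub>2 \<one> N) ;; \<aa> ?U M N"
    using assms by (simp add: Assoc_natural)
  also have "\<dots> = ((\<aa> ?U ?U M \<odot>\<^sub>2 \<one> N) ;; ((\<one> ?U \<odot>\<^sub>2 \<ll> M) \<odot>\<^sub>2 \<one> N)) ;; \<aa> ?U M N"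
    using assms by (simp add: triangle[symmetric] whisker_right)
  also have "\<dots> = (\<aa> ?U ?U M \<odot>\<^sub>2 \<one> N) ;; (\<aa> ?U (?U \<odot> M) N ;; (\<one> ?U \<odot>\<^sub>2 (\<ll> M \<odot>\<^sub>2 \<one> N)))"
    using assms by (simp add: comp_assoc Assoc_natural)
  finally have "\<aa> ?U (?U \<odot> M) N ;; ((\<one> ?U \<odot>\<^sub>2 \<aa> ?U M N) ;; (\<one> ?U \<odot>\<^sub>2 \<ll> (M \<odot> N)))
      = \<aa> ?U (?U \<odot> M) N ;; (\<one> ?U \<odot>\<^sub>2 (\<ll> M \<odot>\<^sub>2 \<one> N))"
    by (rule iso_epi[rotated -1]) (use assms in simp_all)
  then have "(\<one> ?U \<odot>\<^sub>2 \<aa> ?U M N) ;; (\<one> ?U \<odot>\<^sub>2 \<ll> (M \<odot> N)) = \<one> ?U \<odot>\<^sub>2 (\<ll> M \<odot>\<^sub>2 \<one> N)"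
    by (rule iso_epi[rotated -1]) (use assms in simp_all)
  then show "\<one> (Unit B (src B (Dom B (\<aa> (Unit B R) M N ;; \<ll> (M \<odot> N))))) \<odot>\<^sub>2 (\<aa> (Unit B R) M N ;; \<ll> (M \<odot> N))
    = \<one> (Unit B (src B (Dom B (\<aa> (Unit B R) M N ;; \<ll> (M \<odot> N))))) \<odot>\<^sub>2 (\<ll> M \<odot>\<^sub>2 \<one> N)"
    using assms by (simp add: whisker_left)
qed (use assms in simp_all)

lemma Runit_HComp_inv:
  assumes "M \<in> Obj B" "N \<in> Obj B" "trg B M = src B N" "S = trg B N"
  shows "(\<one> M \<odot>\<^sub>2 (\<rr> N)\<^sup>-\<^sup>1) ;; (\<aa> M N (Unit B S))\<^sup>-\<^sup>1 = (\<rr> (M \<odot> N))\<^sup>-\<^sup>1"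
  using arg_cong[OF Runit_HComp[OF assms], of "inv_arr B"] assms by simp

lemma Lunit_HComp_inv:
  assumes "M \<in> Obj B" "N \<in> Obj B" "trg B M = src B N" "R = src B M"
  shows "(\<ll> (M \<odot> N))\<^sup>-\<^sup>1 ;; (\<aa> (Unit B R) M N)\<^sup>-\<^sup>1 = (\<ll> M)\<^sup>-\<^sup>1 \<odot>\<^sub>2 \<one> N"
  using arg_cong[OF Lunit_HComp[OF assms], of "inv_arr B"] assms by simp

lemma pentagon_cross:
  assumes "M \<in> Obj B" "N \<in> Obj B" "P \<in> Obj B" "Q \<in> Obj B"
    and "trg B M = src B N" "trg B N = src B P" "trg B P = src B Q"
  shows "((\<aa> M N P)\<^sup>-\<^sup>1 \<odot>\<^sub>2 \<one> Q) ;; \<aa> (M \<odot> N) P Q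
    = \<aa> M (N \<odot> P) Q ;; ((\<one> M \<odot>\<^sub>2 \<aa> N P Q) ;; (\<aa> M N (P \<odot> Q))\<^sup>-\<^sup>1)"
proof (rule iso_mono[of "\<aa> M N (P \<odot> Q)"])
  have "(((\<aa> M N P)\<^sup>-\<^sup>1 \<odot>\<^sub>2 \<one> Q) ;; \<aa> (M \<odot> N) P Q) ;; \<aa> M N (P \<odot> Q)
    = ((\<aa> M N P)\<^sup>-\<^sup>1 \<odot>\<^sub>2 \<one> Q) ;; ((\<aa> M N P \<odot>\<^sub>2 \<one> Q) ;; (\<aa> M (N \<odot> P) Q ;; (\<one> M \<odot>\<^sub>2 \<aa> N P Q)))"
    using assms by (simp add: comp_assoc pentagon)
  then show "(((\<aa> M N P)\<^sup>-\<^sup>1 \<odot>\<^sub>2 \<one> Q) ;; \<aa> (M \<odot> N) P Q) ;; \<aa> M N (P \<odot> Q)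
    = (\<aa> M (N \<odot> P) Q ;; ((\<one> M \<odot>\<^sub>2 \<aa> N P Q) ;; (\<aa> M N (P \<odot> Q))\<^sup>-\<^sup>1)) ;; \<aa> M N (P \<odot> Q)"
    using assms by (simp add: comp_assoc merge)
qed (use assms in simp_all)

lemma triangle_inv:
  assumes "M \<in> Obj B" "N \<in> Obj B" "trg B M = src B N" "S = src B N"
  shows "((\<rr> M)\<^sup>-\<^sup>1 \<odot>\<^sub>2 \<one> N) ;; \<aa> M (Unit B S) N = \<one> M \<odot>\<^sub>2 (\<ll> N)\<^sup>-\<^sup>1"
proof (rule iso_mono[of "\<one> M \<odot>\<^sub>2 \<ll> N"])
  show "(((\<rr> M)\<^sup>-\<^sup>1 \<odot>\<^sub>2 \<one> N) ;; \<aa> M (Unit B S) N) ;; (\<one> M \<odot>\<^sub>2 \<ll> N) = (\<one> M \<odot>\<^sub>2 (\<ll> N)\<^sup>-\<^sup>1) ;; (\<one> M \<odot>\<^sub>2 \<ll> N)"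
    using assms by (simp add: comp_assoc triangle interchange)
qed (use assms in simp_all)

section \<open>The adjunctions given by whiskering with a dual pair\<close>

text \<open>
  The two halves of the data of a dual pair, kept apart because a trace begins with the one and ends with
  the other. A composite of dual pairs inherits each half directly from its factors.
\<close>

definition coev :: "'c \<Rightarrow> 'c \<Rightarrow> 'd \<Rightarrow> bool"
  where "coev M Md \<eta> \<longleftrightarrow> M \<in> Obj B \<and> Md \<in> cells B (trg B M) (src B M) \<and>
    \<eta> \<in> hom B (Unit B (src B M)) (M \<odot> Md)"

definition ev :: "'c \<Rightarrow> 'c \<Rightarrow> 'd \<Rightarrow> bool"
  where "ev M Md \<epsilon> \<longleftrightarrow> M \<in> Obj B \<and> Md \<in> cells B (trg B M) (src B M) \<and>
    \<epsilon> \<in> hom B (Md \<odot> M) (Unit B (trg B M))"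

lemma coev_simps:
  assumes "coev M Md \<eta>"
  shows "M \<in> Obj B" "Md \<in> Obj B" "src B Md = trg B M" "trg B Md = src B M"
    "\<eta> \<in> Arr B" "Dom B \<eta> = Unit B (src B M)" "Cod B \<eta> = M \<odot> Md"
  using assms by (auto simp: coev_def cells_def hom_iff)

lemma ev_simps:
  assumes "ev M Md \<epsilon>"
  shows "M \<in> Obj B" "Md \<in> Obj B" "src B Md = trg B M" "trg B Md = src B M"
    "\<epsilon> \<in> Arr B" "Dom B \<epsilon> = Md \<odot> M" "Cod B \<epsilon> = Unit B (trg B M)"
  using assms by (auto simp: ev_def cells_def hom_iff)

text \<open>
  If \<open>(M, Md)\<close> is a dual pair, then \<open>- \<odot> M\<close> is left adjoint to \<open>- \<odot> Md\<close> and \<open>Md \<odot> -\<close> is left adjoint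
  to \<open>M \<odot> -\<close>. The next two maps are the unit \<open>Q \<rightarrow> (Q \<odot> M) \<odot> Md\<close> of the first adjunction and the
  counit \<open>Md \<odot> (M \<odot> P) \<rightarrow> P\<close> of the second. A trace begins with the one and ends with the other;
  in between there are only the 2-cell itself and \<open>\<theta>\<close>.
\<close>

definition dunit :: "'c \<Rightarrow> 'c \<Rightarrow> 'd \<Rightarrow> 'c \<Rightarrow> 'd"
  where "dunit M Md \<eta> Q = (\<rr> Q)\<^sup>-\<^sup>1 ;; (\<one> Q \<odot>\<^sub>2 \<eta>) ;; (\<aa> Q M Md)\<^sup>-\<^sup>1"

definition dcounit :: "'c \<Rightarrow> 'c \<Rightarrow> 'd \<Rightarrow> 'c \<Rightarrow> 'd"
  where "dcounit M Md \<epsilon> P = (\<aa> Md M P)\<^sup>-\<^sup>1 ;; (\<epsilon> \<odot>\<^sub>2 \<one> P) ;; \<ll> P"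

lemma dunit_simps [simp]:
  assumes "coev M Md \<eta>" "Q \<in> Obj B" "trg B Q = src B M"
  shows "dunit M Md \<eta> Q \<in> Arr B" "Dom B (dunit M Md \<eta> Q) = Q"
    "Cod B (dunit M Md \<eta> Q) = (Q \<odot> M) \<odot> Md"
  using assms coev_simps[OF assms(1)] by (simp_all add: dunit_def)

lemma dcounit_simps [simp]:
  assumes "ev M Md \<epsilon>" "P \<in> Obj B" "src B P = trg B M"
  shows "dcounit M Md \<epsilon> P \<in> Arr B" "Dom B (dcounit M Md \<epsilon> P) = Md \<odot> (M \<odot> P)"
    "Cod B (dcounit M Md \<epsilon> P) = P"
  using assms ev_simps[OF assms(1)] by (simp_all add: dcounit_def)

lemma dunit_natural:
  assumes "coev M Md \<eta>" "h \<in> Arr B" "trg B (Dom B h) = src B M" "Cod B h = Q'"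
  shows "h ;; dunit M Md \<eta> Q' = dunit M Md \<eta> (Dom B h) ;; ((h \<odot>\<^sub>2 \<one> M) \<odot>\<^sub>2 \<one> Md)"
proof -
  note simps = assms coev_simps[OF assms(1)] parallel_simps[OF assms(2), unfolded assms]
  have Q': "Q' \<in> Obj B" "src B Q' = src B (Dom B h)" "trg B Q' = trg B (Dom B h)"
    using parallel_simps[OF assms(2)] Cod_Obj[OF assms(2)] assms(4) by simp_all
  have "h ;; dunit M Md \<eta> Q' = (h ;; (\<rr> Q')\<^sup>-\<^sup>1) ;; ((\<one> Q' \<odot>\<^sub>2 \<eta>) ;; (\<aa> Q' M Md)\<^sup>-\<^sup>1)"
    using simps Q' by (simp add: dunit_def comp_assoc)
  also have "\<dots> = (\<rr> (Dom B h))\<^sup>-\<^sup>1 ;; (((h \<odot>\<^sub>2 \<one> (Unit B (src B M))) ;; (\<one> Q' \<odot>\<^sub>2 \<eta>)) ;; (\<aa> Q' M Md)\<^sup>-\<^sup>1)"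
    using simps Q' by (simp add: Runit_inv_natural comp_assoc)
  also have "(h \<odot>\<^sub>2 \<one> (Unit B (src B M))) ;; (\<one> Q' \<odot>\<^sub>2 \<eta>) = (\<one> (Dom B h) \<odot>\<^sub>2 \<eta>) ;; (h \<odot>\<^sub>2 \<one> (M \<odot> Md))"
    using simps Q' by (simp add: interchange)
  also have "(\<rr> (Dom B h))\<^sup>-\<^sup>1 ;; (((\<one> (Dom B h) \<odot>\<^sub>2 \<eta>) ;; (h \<odot>\<^sub>2 \<one> (M \<odot> Md))) ;; (\<aa> Q' M Md)\<^sup>-\<^sup>1)
      = dunit M Md \<eta> (Dom B h) ;; ((h \<odot>\<^sub>2 \<one> M) \<odot>\<^sub>2 \<one> Md)"
    using simps Q' by (simp add: dunit_def comp_assoc slide_Assoc_inv)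
  finally show ?thesis .
qed

lemma dcounit_natural:
  assumes "ev M Md \<epsilon>" "h \<in> Arr B" "src B (Dom B h) = trg B M" "Cod B h = P'"
  shows "(\<one> Md \<odot>\<^sub>2 (\<one> M \<odot>\<^sub>2 h)) ;; dcounit M Md \<epsilon> P' = dcounit M Md \<epsilon> (Dom B h) ;; h"
proof -
  note simps = assms ev_simps[OF assms(1)]
  have P': "P' \<in> Obj B" "src B P' = src B (Dom B h)" "trg B P' = trg B (Dom B h)"
    using parallel_simps[OF assms(2)] Cod_Obj[OF assms(2)] assms(4) by simp_all
  have "(\<one> Md \<odot>\<^sub>2 (\<one> M \<odot>\<^sub>2 h)) ;; dcounit M Md \<epsilon> P'
      = (\<aa> Md M (Dom B h))\<^sup>-\<^sup>1 ;; (((\<one> (Md \<odot> M) \<odot>\<^sub>2 h) ;; (\<epsilon> \<odot>\<^sub>2 \<one> P')) ;; \<ll> P')"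
    using simps P' by (simp add: dcounit_def comp_assoc slide_Assoc_inv)
  also have "(\<one> (Md \<odot> M) \<odot>\<^sub>2 h) ;; (\<epsilon> \<odot>\<^sub>2 \<one> P') = (\<epsilon> \<odot>\<^sub>2 \<one> (Dom B h)) ;; (\<one> (Unit B (trg B M)) \<odot>\<^sub>2 h)"
    using simps P' by (simp add: interchange)
  also have "(\<aa> Md M (Dom B h))\<^sup>-\<^sup>1 ;; (((\<epsilon> \<odot>\<^sub>2 \<one> (Dom B h)) ;; (\<one> (Unit B (trg B M)) \<odot>\<^sub>2 h)) ;; \<ll> P')
      = dcounit M Md \<epsilon> (Dom B h) ;; h"
    using simps P' by (simp add: dcounit_def comp_assoc Lunit_natural)
  finally show ?thesis .
qed

text \<open>
  Whiskering on the side away from the dual pair does not touch the coevaluation, so only associators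
  have to be compared. The same holds for the counit below.
\<close>

lemma dunit_whisker:
  assumes "coev M Md \<eta>" "H \<in> Obj B" "A \<in> Obj B" "trg B H = src B A" "trg B A = src B M"
  shows "dunit M Md \<eta> (H \<odot> A) ;; (\<aa> H A M \<odot>\<^sub>2 \<one> Md)
    = (\<one> H \<odot>\<^sub>2 dunit M Md \<eta> A) ;; (\<aa> H (A \<odot> M) Md)\<^sup>-\<^sup>1"
proof -
  note simps = assms coev_simps[OF assms(1)]
  let ?U = "Unit B (src B M)"
  have "(\<one> H \<odot>\<^sub>2 dunit M Md \<eta> A) ;; (\<aa> H (A \<odot> M) Md)\<^sup>-\<^sup>1
      = (\<one> H \<odot>\<^sub>2 (\<rr> A)\<^sup>-\<^sup>1) ;; ((\<one> H \<odot>\<^sub>2 (\<one> A \<odot>\<^sub>2 \<eta>)) ;; ((\<one> H \<odot>\<^sub>2 (\<aa> A M Md)\<^sup>-\<^sup>1) ;; (\<aa> H (A \<odot> M) Md)\<^sup>-\<^sup>1))"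
    using simps by (simp add: dunit_def comp_assoc whisker)
  also have "\<dots> = ((\<one> H \<odot>\<^sub>2 (\<rr> A)\<^sup>-\<^sup>1) ;; (\<aa> H A ?U)\<^sup>-\<^sup>1) ;; ((\<one> (H \<odot> A) \<odot>\<^sub>2 \<eta>) ;; ((\<aa> (H \<odot> A) M Md)\<^sup>-\<^sup>1 ;; (\<aa> H A M \<odot>\<^sub>2 \<one> Md)))"
    using simps by (simp add: comp_assoc pentagon_left_inv slide_Assoc_inv)
  also have "\<dots> = dunit M Md \<eta> (H \<odot> A) ;; (\<aa> H A M \<odot>\<^sub>2 \<one> Md)"
    using simps by (simp add: dunit_def comp_assoc Runit_HComp_inv)
  finally show ?thesis by simp
qed

lemma dcounit_whisker:
  assumes "ev M Md \<epsilon>" "Y \<in> Obj B" "H \<in> Obj B" "src B Y = trg B M" "trg B Y = src B H"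
  shows "(\<one> Md \<odot>\<^sub>2 (\<aa> M Y H)\<^sup>-\<^sup>1) ;; ((\<aa> Md (M \<odot> Y) H)\<^sup>-\<^sup>1 ;; (dcounit M Md \<epsilon> Y \<odot>\<^sub>2 \<one> H))
    = dcounit M Md \<epsilon> (Y \<odot> H)"
proof -
  note simps = assms ev_simps[OF assms(1)]
  let ?U = "Unit B (trg B M)"
  have "(\<one> Md \<odot>\<^sub>2 (\<aa> M Y H)\<^sup>-\<^sup>1) ;; ((\<aa> Md (M \<odot> Y) H)\<^sup>-\<^sup>1 ;; (dcounit M Md \<epsilon> Y \<odot>\<^sub>2 \<one> H))
      = ((\<one> Md \<odot>\<^sub>2 (\<aa> M Y H)\<^sup>-\<^sup>1) ;; ((\<aa> Md (M \<odot> Y) H)\<^sup>-\<^sup>1 ;; ((\<aa> Md M Y)\<^sup>-\<^sup>1 \<odot>\<^sub>2 \<one> H)))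
        ;; (((\<epsilon> \<odot>\<^sub>2 \<one> Y) \<odot>\<^sub>2 \<one> H) ;; (\<ll> Y \<odot>\<^sub>2 \<one> H))"
    using simps by (simp add: dcounit_def comp_assoc whisker)
  also have "\<dots> = (\<aa> Md M (Y \<odot> H))\<^sup>-\<^sup>1 ;; ((\<aa> (Md \<odot> M) Y H)\<^sup>-\<^sup>1
      ;; ((((\<epsilon> \<odot>\<^sub>2 \<one> Y) \<odot>\<^sub>2 \<one> H) ;; \<aa> ?U Y H) ;; \<ll> (Y \<odot> H)))"
    using simps by (simp add: pentagon_inv Lunit_HComp[symmetric] comp_assoc)
  also have "\<dots> = dcounit M Md \<epsilon> (Y \<odot> H)"
    using simps by (simp add: slide_Assoc dcounit_def comp_assoc)
  finally show ?thesis .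
qed

lemma coev_comp:
  assumes "coev F Fd \<eta>F" "coev G Gd \<eta>G" "trg B F = src B G"
  shows "coev (F \<odot> G) (Gd \<odot> Fd) (comp_unit B F Fd \<eta>F G Gd \<eta>G)"
  using assms(3) coev_simps[OF assms(1)] coev_simps[OF assms(2)]
  by (simp add: coev_def cells_def hom_iff comp_unit_def)

lemma ev_comp:
  assumes "ev F Fd \<epsilon>F" "ev G Gd \<epsilon>G" "trg B F = src B G"
  shows "ev (F \<odot> G) (Gd \<odot> Fd) (comp_counit B F Fd \<epsilon>F G Gd \<epsilon>G)"
  using assms(3) ev_simps[OF assms(1)] ev_simps[OF assms(2)]
  by (simp add: ev_def cells_def hom_iff comp_counit_def)

text \<open>
  The unit and the counit of the composite pair are those of the two factors, one nested in the
  other, as for any composite of adjunctions. This reduces every statement on the composite dual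
  pair to its factors.
\<close>

lemma dunit_comp:
  assumes "coev F Fd \<eta>F" "coev G Gd \<eta>G" "trg B F = src B G" "Q \<in> Obj B" "trg B Q = src B F"
  shows "dunit (F \<odot> G) (Gd \<odot> Fd) (comp_unit B F Fd \<eta>F G Gd \<eta>G) Q
    = dunit F Fd \<eta>F Q ;; ((dunit G Gd \<eta>G (Q \<odot> F) ;; (\<aa> Q F G \<odot>\<^sub>2 \<one> Gd)) \<odot>\<^sub>2 \<one> Fd)
      ;; \<aa> (Q \<odot> (F \<odot> G)) Gd Fd"
proof -
  note simps = assms coev_simps[OF assms(1)] coev_simps[OF assms(2)]
  have *: "(dunit G Gd \<eta>G F \<odot>\<^sub>2 \<one> Fd) ;; \<aa> (F \<odot> G) Gd Fd
      = (\<one> F \<odot>\<^sub>2 ((\<ll> Fd)\<^sup>-\<^sup>1 ;; (\<eta>G \<odot>\<^sub>2 \<one> Fd) ;; \<aa> G Gd Fd)) ;; (\<aa> F G (Gd \<odot> Fd))\<^sup>-\<^sup>1"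
  proof -
    have "(dunit G Gd \<eta>G F \<odot>\<^sub>2 \<one> Fd) ;; \<aa> (F \<odot> G) Gd Fd
      = ((\<rr> F)\<^sup>-\<^sup>1 \<odot>\<^sub>2 \<one> Fd) ;; (((\<one> F \<odot>\<^sub>2 \<eta>G) \<odot>\<^sub>2 \<one> Fd) ;; (((\<aa> F G Gd)\<^sup>-\<^sup>1 \<odot>\<^sub>2 \<one> Fd) ;; \<aa> (F \<odot> G) Gd Fd))"
      using simps by (simp add: dunit_def comp_assoc whisker)
    also have "\<dots> = (((\<rr> F)\<^sup>-\<^sup>1 \<odot>\<^sub>2 \<one> Fd) ;; \<aa> F (Unit B (src B G)) Fd)
        ;; ((\<one> F \<odot>\<^sub>2 (\<eta>G \<odot>\<^sub>2 \<one> Fd)) ;; ((\<one> F \<odot>\<^sub>2 \<aa> G Gd Fd) ;; (\<aa> F G (Gd \<odot> Fd))\<^sup>-\<^sup>1))"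
      using simps by (simp add: comp_assoc pentagon_cross slide_Assoc)
    also have "\<dots> = (\<one> F \<odot>\<^sub>2 ((\<ll> Fd)\<^sup>-\<^sup>1 ;; (\<eta>G \<odot>\<^sub>2 \<one> Fd) ;; \<aa> G Gd Fd)) ;; (\<aa> F G (Gd \<odot> Fd))\<^sup>-\<^sup>1"
      using simps by (simp add: triangle_inv comp_assoc whisker)
    finally show ?thesis .
  qed
  have "dunit F Fd \<eta>F Q ;; ((dunit G Gd \<eta>G (Q \<odot> F) ;; (\<aa> Q F G \<odot>\<^sub>2 \<one> Gd)) \<odot>\<^sub>2 \<one> Fd)
      ;; \<aa> (Q \<odot> (F \<odot> G)) Gd Fd
      = dunit F Fd \<eta>F Q ;; (((\<one> Q \<odot>\<^sub>2 dunit G Gd \<eta>G F) \<odot>\<^sub>2 \<one> Fd)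
        ;; (((\<aa> Q (F \<odot> G) Gd)\<^sup>-\<^sup>1 \<odot>\<^sub>2 \<one> Fd) ;; \<aa> (Q \<odot> (F \<odot> G)) Gd Fd))"
    using simps by (simp add: dunit_whisker comp_assoc whisker)
  also have "\<dots> = (\<rr> Q)\<^sup>-\<^sup>1 ;; ((\<one> Q \<odot>\<^sub>2 \<eta>F) ;; ((\<aa> Q F Fd)\<^sup>-\<^sup>1 ;; (\<aa> Q F Fd ;;
        ((\<one> Q \<odot>\<^sub>2 (dunit G Gd \<eta>G F \<odot>\<^sub>2 \<one> Fd)) ;; ((\<one> Q \<odot>\<^sub>2 \<aa> (F \<odot> G) Gd Fd)
        ;; (\<aa> Q (F \<odot> G) (Gd \<odot> Fd))\<^sup>-\<^sup>1)))))"
    using simps by (simp add: pentagon_cross dunit_def[of F] comp_assoc slide_Assoc)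
  also have "\<dots> = (\<rr> Q)\<^sup>-\<^sup>1 ;; ((\<one> Q \<odot>\<^sub>2 (\<eta>F ;; ((dunit G Gd \<eta>G F \<odot>\<^sub>2 \<one> Fd) ;; \<aa> (F \<odot> G) Gd Fd)))
        ;; (\<aa> Q (F \<odot> G) (Gd \<odot> Fd))\<^sup>-\<^sup>1)"
    using simps by (simp add: comp_assoc whisker)
  also have "\<dots> = dunit (F \<odot> G) (Gd \<odot> Fd) (comp_unit B F Fd \<eta>F G Gd \<eta>G) Q"
    unfolding * using simps by (simp add: comp_assoc dunit_def comp_unit_def)
  finally show ?thesis by simp
qed

lemma dcounit_comp:
  assumes "ev F Fd \<epsilon>F" "ev G Gd \<epsilon>G" "trg B F = src B G" "Z \<in> Obj B" "src B Z = trg B G"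
  shows "dcounit (F \<odot> G) (Gd \<odot> Fd) (comp_counit B F Fd \<epsilon>F G Gd \<epsilon>G) Z
    = \<aa> Gd Fd ((F \<odot> G) \<odot> Z)
      ;; (\<one> Gd \<odot>\<^sub>2 ((\<one> Fd \<odot>\<^sub>2 \<aa> F G Z) ;; dcounit F Fd \<epsilon>F (G \<odot> Z))) ;; dcounit G Gd \<epsilon>G Z"
proof -
  note simps = assms ev_simps[OF assms(1)] ev_simps[OF assms(2)]
  have *: "(\<one> Fd \<odot>\<^sub>2 \<aa> F G Z) ;; dcounit F Fd \<epsilon>F (G \<odot> Z)
      = (\<aa> Fd (F \<odot> G) Z)\<^sup>-\<^sup>1 ;; (dcounit F Fd \<epsilon>F G \<odot>\<^sub>2 \<one> Z)"
    using simps by (simp add: dcounit_whisker[symmetric] merge)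
  have "\<aa> Gd Fd ((F \<odot> G) \<odot> Z)
      ;; (\<one> Gd \<odot>\<^sub>2 ((\<one> Fd \<odot>\<^sub>2 \<aa> F G Z) ;; dcounit F Fd \<epsilon>F (G \<odot> Z))) ;; dcounit G Gd \<epsilon>G Z
      = \<aa> Gd Fd ((F \<odot> G) \<odot> Z) ;; (((\<one> Gd \<odot>\<^sub>2 (\<aa> Fd (F \<odot> G) Z)\<^sup>-\<^sup>1) ;; (\<aa> Gd (Fd \<odot> (F \<odot> G)) Z)\<^sup>-\<^sup>1)
      ;; (((\<one> Gd \<odot>\<^sub>2 dcounit F Fd \<epsilon>F G) \<odot>\<^sub>2 \<one> Z) ;; ((\<epsilon>G \<odot>\<^sub>2 \<one> Z) ;; \<ll> Z)))"
    unfolding * using simps by (simp add: comp_assoc whisker dcounit_def[of G] slide_Assoc_inv)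
  also have "\<dots> = (\<aa> (Gd \<odot> Fd) (F \<odot> G) Z)\<^sup>-\<^sup>1 ;; ((\<aa> Gd Fd (F \<odot> G) \<odot>\<^sub>2 \<one> Z)
      ;; (((\<one> Gd \<odot>\<^sub>2 dcounit F Fd \<epsilon>F G) \<odot>\<^sub>2 \<one> Z) ;; ((\<epsilon>G \<odot>\<^sub>2 \<one> Z) ;; \<ll> Z)))"
    using simps by (simp add: pentagon_left_inv comp_assoc)
  also have "\<dots> = dcounit (F \<odot> G) (Gd \<odot> Fd) (comp_counit B F Fd \<epsilon>F G Gd \<epsilon>G) Z"
    using simps by (simp add: comp_assoc dcounit_def comp_counit_def whisker)
  finally show ?thesis by simp
qed

end

context dual_pair
begin

lemma is_coev: "coev M Md \<eta>"
  by (simp add: coev_def M_closed Md_closed unit_closed)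

lemma is_ev: "ev M Md \<epsilon>"
  by (simp add: ev_def M_closed Md_closed counit_closed)

text \<open>
  The triangle identity for the adjunction between \<open>- \<odot> M\<close> and \<open>- \<odot> Md\<close>, that is, the triangle identity
  of the dual pair whiskered with an arbitrary 1-cell on the left.
\<close>

lemma snake:
  assumes "A \<in> Obj B" "trg B A = src B M"
  shows "(dunit M Md \<eta> A \<odot>\<^sub>2 \<one> M) ;; (\<aa> (A \<odot> M) Md M ;; ((\<one> (A \<odot> M) \<odot>\<^sub>2 \<epsilon>) ;; \<rr> (A \<odot> M))) = \<one> (A \<odot> M)"
proof -
  note simps = assms coev_simps[OF is_coev] ev_simps[OF is_ev]
  let ?U = "Unit B (trg B M)"
  have "(dunit M Md \<eta> A \<odot>\<^sub>2 \<one> M) ;; (\<aa> (A \<odot> M) Md M ;; ((\<one> (A \<odot> M) \<odot>\<^sub>2 \<epsilon>) ;; \<rr> (A \<odot> M)))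
      = ((\<rr> A)\<^sup>-\<^sup>1 \<odot>\<^sub>2 \<one> M) ;; (((\<one> A \<odot>\<^sub>2 \<eta>) \<odot>\<^sub>2 \<one> M) ;; ((((\<aa> A M Md)\<^sup>-\<^sup>1 \<odot>\<^sub>2 \<one> M) ;; \<aa> (A \<odot> M) Md M)
        ;; ((\<one> (A \<odot> M) \<odot>\<^sub>2 \<epsilon>) ;; \<rr> (A \<odot> M))))"
    using simps by (simp add: dunit_def comp_assoc whisker)
  also have "\<dots> = (((\<rr> A)\<^sup>-\<^sup>1 \<odot>\<^sub>2 \<one> M) ;; \<aa> A (Unit B (src B M)) M) ;; ((\<one> A \<odot>\<^sub>2 (\<eta> \<odot>\<^sub>2 \<one> M)) ;; ((\<one> A \<odot>\<^sub>2 \<aa> M Md M)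
        ;; (((\<aa> A M (Md \<odot> M))\<^sup>-\<^sup>1 ;; (\<one> (A \<odot> M) \<odot>\<^sub>2 \<epsilon>)) ;; \<rr> (A \<odot> M))))"
    using simps by (simp add: pentagon_cross comp_assoc slide_Assoc)
  also have "(\<aa> A M (Md \<odot> M))\<^sup>-\<^sup>1 ;; (\<one> (A \<odot> M) \<odot>\<^sub>2 \<epsilon>) = (\<one> A \<odot>\<^sub>2 (\<one> M \<odot>\<^sub>2 \<epsilon>)) ;; (\<aa> A M ?U)\<^sup>-\<^sup>1"
    using simps by (simp add: slide_Assoc_inv)
  also have "(((\<rr> A)\<^sup>-\<^sup>1 \<odot>\<^sub>2 \<one> M) ;; \<aa> A (Unit B (src B M)) M) ;; ((\<one> A \<odot>\<^sub>2 (\<eta> \<odot>\<^sub>2 \<one> M)) ;; ((\<one> A \<odot>\<^sub>2 \<aa> M Md M)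
        ;; (((\<one> A \<odot>\<^sub>2 (\<one> M \<odot>\<^sub>2 \<epsilon>)) ;; (\<aa> A M ?U)\<^sup>-\<^sup>1) ;; \<rr> (A \<odot> M))))
      = \<one> A \<odot>\<^sub>2 ((\<ll> M)\<^sup>-\<^sup>1 ;; (\<eta> \<odot>\<^sub>2 \<one> M) ;; \<aa> M Md M ;; (\<one> M \<odot>\<^sub>2 \<epsilon>) ;; \<rr> M)"
    using simps by (simp add: triangle_inv comp_assoc Runit_HComp[symmetric] whisker)
  also have "\<dots> = \<one> (A \<odot> M)"
    unfolding triangle_M using simps by simp
  finally show ?thesis .
qed

end

section \<open>Evaluations in a closed bicategory\<close>

context closed_bicategory
begin

lemma LHom_simps [simp]:
  assumes "P \<in> Obj B" "M \<in> Obj B" "src B P = src B M"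
  shows "P \<triangleleft> M \<in> Obj B" "src B (P \<triangleleft> M) = trg B M" "trg B (P \<triangleleft> M) = trg B P"
proof -
  have "P \<triangleleft> M \<in> cells B (trg B M) (trg B P)"
    using LHom_functor[of "src B M" "trg B M" "trg B P"] assms
    by (auto simp: is_functor_def prod_cat_def op_cat_def hcat_simps cells_def)
  then show "P \<triangleleft> M \<in> Obj B" "src B (P \<triangleleft> M) = trg B M" "trg B (P \<triangleleft> M) = trg B P"
    by (auto simp: cells_def)
qed

lemma RHom_simps [simp]:
  assumes "N \<in> Obj B" "P \<in> Obj B" "trg B N = trg B P"
  shows "N \<triangleright> P \<in> Obj B" "src B (N \<triangleright> P) = src B P" "trg B (N \<triangleright> P) = src B N"
proof -
  have "N \<triangleright> P \<in> cells B (src B P) (src B N)"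
    using RHom_functor[of "src B P" "src B N" "trg B P"] assms
    by (auto simp: is_functor_def prod_cat_def op_cat_def hcat_simps cells_def)
  then show "N \<triangleright> P \<in> Obj B" "src B (N \<triangleright> P) = src B P" "trg B (N \<triangleright> P) = src B N"
    by (auto simp: cells_def)
qed

lemma LHom2_simps [simp]:
  assumes "h \<in> Arr B" "f \<in> Arr B" "src B (Dom B h) = src B (Dom B f)"
  shows "h \<triangleleft>\<^sub>2 f \<in> Arr B" "Dom B (h \<triangleleft>\<^sub>2 f) = Dom B h \<triangleleft> Cod B f" "Cod B (h \<triangleleft>\<^sub>2 f) = Cod B h \<triangleleft> Dom B f"
proof -
  let ?R = "src B (Dom B f)" and ?S = "trg B (Dom B f)" and ?T = "trg B (Dom B h)"
  have "h \<triangleleft>\<^sub>2 f \<in> hom (hcat B ?S ?T) (Dom B h \<triangleleft> Cod B f) (Cod B h \<triangleleft> Dom B f)"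
    using LHom_functor[of ?R ?S ?T] assms
    by (auto simp: is_functor_def prod_cat_def op_cat_def hcat_simps)
  then show "h \<triangleleft>\<^sub>2 f \<in> Arr B" "Dom B (h \<triangleleft>\<^sub>2 f) = Dom B h \<triangleleft> Cod B f" "Cod B (h \<triangleleft>\<^sub>2 f) = Cod B h \<triangleleft> Dom B f"
    by (auto simp: hom_hcat hom_iff)
qed

lemma RHom2_simps [simp]:
  assumes "g \<in> Arr B" "h \<in> Arr B" "trg B (Dom B g) = trg B (Dom B h)"
  shows "g \<triangleright>\<^sub>2 h \<in> Arr B" "Dom B (g \<triangleright>\<^sub>2 h) = Cod B g \<triangleright> Dom B h" "Cod B (g \<triangleright>\<^sub>2 h) = Dom B g \<triangleright> Cod B h"
proof -
  let ?R = "src B (Dom B h)" and ?S = "src B (Dom B g)" and ?T = "trg B (Dom B h)"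
  have "g \<triangleright>\<^sub>2 h \<in> hom (hcat B ?R ?S) (Cod B g \<triangleright> Dom B h) (Dom B g \<triangleright> Cod B h)"
    using RHom_functor[of ?R ?S ?T] assms
    by (auto simp: is_functor_def prod_cat_def op_cat_def hcat_simps)
  then show "g \<triangleright>\<^sub>2 h \<in> Arr B" "Dom B (g \<triangleright>\<^sub>2 h) = Cod B g \<triangleright> Dom B h" "Cod B (g \<triangleright>\<^sub>2 h) = Dom B g \<triangleright> Cod B h"
    by (auto simp: hom_hcat hom_iff)
qed

lemma LHom2_Idn [simp]:
  assumes "P \<in> Obj B" "M \<in> Obj B" "src B P = src B M"
  shows "\<one> P \<triangleleft>\<^sub>2 \<one> M = \<one> (P \<triangleleft> M)"
  using LHom_functor[of "src B M" "trg B M" "trg B P"] assms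
  by (auto simp: is_functor_def prod_cat_def op_cat_def hcat_simps cells_def)

lemma RHom2_Idn [simp]:
  assumes "N \<in> Obj B" "P \<in> Obj B" "trg B N = trg B P"
  shows "\<one> N \<triangleright>\<^sub>2 \<one> P = \<one> (N \<triangleright> P)"
  using RHom_functor[of "src B P" "src B N" "trg B P"] assms
  by (auto simp: is_functor_def prod_cat_def op_cat_def hcat_simps cells_def)

lemma transpL_simps:
  assumes "M \<in> Obj B" "N \<in> Obj B" "P \<in> Obj B"
    and "trg B M = src B N" "src B P = src B M" "trg B P = trg B N"
    and "k \<in> Arr B" "Dom B k = M \<odot> N" "Cod B k = P"
  shows "transpL B M N P k \<in> Arr B" "Dom B (transpL B M N P k) = N" "Cod B (transpL B M N P k) = P \<triangleleft> M"
proof -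
  have "transpL B M N P k \<in> hom B N (P \<triangleleft> M)"
    using bij_betwE[OF transpL_bij[of M "src B M" "src B N" N "trg B N" P]] assms
    by (simp add: cells_def hom_iff)
  then show "transpL B M N P k \<in> Arr B" "Dom B (transpL B M N P k) = N" "Cod B (transpL B M N P k) = P \<triangleleft> M"
    by (auto simp: hom_iff)
qed

lemma transpR_simps:
  assumes "M \<in> Obj B" "N \<in> Obj B" "P \<in> Obj B"
    and "trg B M = src B N" "src B P = src B M" "trg B P = trg B N"
    and "k \<in> Arr B" "Dom B k = M \<odot> N" "Cod B k = P"
  shows "transpR B M N P k \<in> Arr B" "Dom B (transpR B M N P k) = M" "Cod B (transpR B M N P k) = N \<triangleright> P"
proof -
  have "transpR B M N P k \<in> hom B M (N \<triangleright> P)"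
    using bij_betwE[OF transpR_bij[of M "src B M" "src B N" N "trg B N" P]] assms
    by (simp add: cells_def hom_iff)
  then show "transpR B M N P k \<in> Arr B" "Dom B (transpR B M N P k) = M" "Cod B (transpR B M N P k) = N \<triangleright> P"
    by (auto simp: hom_iff)
qed

lemma evL_hom:
  assumes "M \<in> Obj B" "P \<in> Obj B" "src B P = src B M"
  shows "evL B M P \<in> hom B (M \<odot> (P \<triangleleft> M)) P"
    and "transpL B M (P \<triangleleft> M) P (evL B M P) = \<one> (P \<triangleleft> M)"
proof -
  have "bij_betw (transpL B M (P \<triangleleft> M) P) (hom B (M \<odot> (P \<triangleleft> M)) P) (hom B (P \<triangleleft> M) (P \<triangleleft> M))"
    using transpL_bij[of M "src B M" "trg B M" "P \<triangleleft> M" "trg B P" P] assms by (simp add: cells_def)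
  moreover have "\<one> (P \<triangleleft> M) \<in> hom B (P \<triangleleft> M) (P \<triangleleft> M)"
    using assms by (simp add: hom_iff)
  ultimately show "evL B M P \<in> hom B (M \<odot> (P \<triangleleft> M)) P"
    and "transpL B M (P \<triangleleft> M) P (evL B M P) = \<one> (P \<triangleleft> M)"
    unfolding evL_def by (metis bij_betw_def inv_into_into, metis bij_betw_def f_inv_into_f)
qed

lemma evR_hom:
  assumes "N \<in> Obj B" "P \<in> Obj B" "trg B N = trg B P"
  shows "evR B N P \<in> hom B ((N \<triangleright> P) \<odot> N) P"
    and "transpR B (N \<triangleright> P) N P (evR B N P) = \<one> (N \<triangleright> P)"
proof -
  have "bij_betw (transpR B (N \<triangleright> P) N P) (hom B ((N \<triangleright> P) \<odot> N) P) (hom B (N \<triangleright> P) (N \<triangleright> P))"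
    using transpR_bij[of "N \<triangleright> P" "src B P" "src B N" N "trg B P" P] assms by (simp add: cells_def)
  moreover have "\<one> (N \<triangleright> P) \<in> hom B (N \<triangleright> P) (N \<triangleright> P)"
    using assms by (simp add: hom_iff)
  ultimately show "evR B N P \<in> hom B ((N \<triangleright> P) \<odot> N) P"
    and "transpR B (N \<triangleright> P) N P (evR B N P) = \<one> (N \<triangleright> P)"
    unfolding evR_def by (metis bij_betw_def inv_into_into, metis bij_betw_def f_inv_into_f)
qed

lemma evL_simps [simp]:
  assumes "M \<in> Obj B" "P \<in> Obj B" "src B P = src B M"
  shows "evL B M P \<in> Arr B" "Dom B (evL B M P) = M \<odot> (P \<triangleleft> M)" "Cod B (evL B M P) = P"
  using evL_hom[OF assms] by (simp_all add: hom_iff)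

lemma evR_simps [simp]:
  assumes "N \<in> Obj B" "P \<in> Obj B" "trg B N = trg B P"
  shows "evR B N P \<in> Arr B" "Dom B (evR B N P) = (N \<triangleright> P) \<odot> N" "Cod B (evR B N P) = P"
  using evR_hom[OF assms] by (simp_all add: hom_iff)

text \<open>
  By naturality a 2-cell into an internal hom is the transpose of its composite with the evaluation.
\<close>

lemma transpL_evL:
  assumes "M \<in> Obj B" "P \<in> Obj B" "src B P = src B M" "h \<in> Arr B" "Dom B h = N" "Cod B h = P \<triangleleft> M"
  shows "transpL B M N P ((\<one> M \<odot>\<^sub>2 h) ;; evL B M P) = h"
proof -
  have N: "src B N = trg B M" "trg B N = trg B P"
    using parallel_simps[OF assms(4)] assms by auto
  show ?thesis
    using transpL_natural[of M "src B M" "trg B M" "P \<triangleleft> M" "trg B P" P "\<one> M" M h N "\<one> P" P "evL B M P"]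
      assms N evL_hom[OF assms(1-3)]
    by (simp add: cells_def hom_iff)
qed

lemma transpR_evR:
  assumes "N \<in> Obj B" "P \<in> Obj B" "trg B N = trg B P" "h \<in> Arr B" "Dom B h = M" "Cod B h = N \<triangleright> P"
  shows "transpR B M N P ((h \<odot>\<^sub>2 \<one> N) ;; evR B N P) = h"
proof -
  have M: "src B M = src B P" "trg B M = src B N"
    using parallel_simps[OF assms(4)] assms by auto
  show ?thesis
    using transpR_natural[of "N \<triangleright> P" "src B P" "src B N" N "trg B P" P h M "\<one> N" N "\<one> P" P "evR B N P"]
      assms M evR_hom[OF assms(1-3)]
    by (simp add: cells_def hom_iff)
qed

text \<open>Universal property of the evaluations: existence and uniqueness of the factorisation.\<close>

lemma evL_transpL:
  assumes "M \<in> Obj B" "N \<in> Obj B" "P \<in> Obj B"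
    and "trg B M = src B N" "src B P = src B M" "trg B P = trg B N"
    and "k \<in> Arr B" "Dom B k = M \<odot> N" "Cod B k = P"
  shows "(\<one> M \<odot>\<^sub>2 transpL B M N P k) ;; evL B M P = k"
proof -
  have "inj_on (transpL B M N P) (hom B (M \<odot> N) P)"
    using transpL_bij[of M "src B M" "src B N" N "trg B N" P] assms
    by (simp add: cells_def bij_betw_def)
  then show ?thesis
    by (rule inj_onD) (use assms transpL_simps[OF assms] in \<open>simp_all add: transpL_evL hom_iff\<close>)
qed

lemma evR_transpR:
  assumes "M \<in> Obj B" "N \<in> Obj B" "P \<in> Obj B"
    and "trg B M = src B N" "src B P = src B M" "trg B P = trg B N"
    and "k \<in> Arr B" "Dom B k = M \<odot> N" "Cod B k = P"
  shows "(transpR B M N P k \<odot>\<^sub>2 \<one> N) ;; evR B N P = k"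
proof -
  have "inj_on (transpR B M N P) (hom B (M \<odot> N) P)"
    using transpR_bij[of M "src B M" "src B N" N "trg B N" P] assms
    by (simp add: cells_def bij_betw_def)
  then show ?thesis
    by (rule inj_onD) (use assms transpR_simps[OF assms] in \<open>simp_all add: transpR_evR hom_iff\<close>)
qed

lemma evL_ext:
  assumes "M \<in> Obj B" "P \<in> Obj B" "src B P = src B M"
    and "h \<in> Arr B" "h' \<in> Arr B" "Dom B h = Dom B h'" "Cod B h = P \<triangleleft> M" "Cod B h' = P \<triangleleft> M"
    and "(\<one> M \<odot>\<^sub>2 h) ;; evL B M P = (\<one> M \<odot>\<^sub>2 h') ;; evL B M P"
  shows "h = h'"
  using assms transpL_evL[of M P h "Dom B h"] transpL_evL[of M P h' "Dom B h"] by metis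

text \<open>
  Contravariance of the internal homs is characterised by evaluation: precomposing with a 2-cell
  inside the hom amounts to applying that 2-cell to the argument.
\<close>

lemma evL_dinatural:
  assumes "P \<in> Obj B" "f \<in> Arr B" "src B P = src B (Dom B f)" "Cod B f = M"
  shows "(\<one> (Dom B f) \<odot>\<^sub>2 (\<one> P \<triangleleft>\<^sub>2 f)) ;; evL B (Dom B f) P = (f \<odot>\<^sub>2 \<one> (P \<triangleleft> M)) ;; evL B M P"
proof -
  let ?M' = "Dom B f"
  have M: "M \<in> Obj B" "src B M = src B ?M'" "trg B M = trg B ?M'"
    using parallel_simps[OF assms(2)] Cod_Obj[OF assms(2)] assms(4) by simp_all
  have "transpL B ?M' (P \<triangleleft> M) P ((f \<odot>\<^sub>2 \<one> (P \<triangleleft> M)) ;; evL B M P) = \<one> P \<triangleleft>\<^sub>2 f"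
    using transpL_natural[of M "src B M" "trg B M" "P \<triangleleft> M" "trg B P" P f ?M' "\<one> (P \<triangleleft> M)" "P \<triangleleft> M"
        "\<one> P" P "evL B M P"] assms M evL_hom[of M P]
    by (simp add: cells_def hom_iff)
  then show ?thesis
    using evL_transpL[of ?M' "P \<triangleleft> M" P "(f \<odot>\<^sub>2 \<one> (P \<triangleleft> M)) ;; evL B M P"] assms M by simp
qed

lemma evR_natural:
  assumes "N \<in> Obj B" "h \<in> Arr B" "trg B N = trg B (Dom B h)" "Cod B h = P'"
  shows "((\<one> N \<triangleright>\<^sub>2 h) \<odot>\<^sub>2 \<one> N) ;; evR B N P' = evR B N (Dom B h) ;; h"
proof -
  let ?P = "Dom B h"
  have P': "P' \<in> Obj B" "src B P' = src B ?P" "trg B P' = trg B ?P"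
    using parallel_simps[OF assms(2)] Cod_Obj[OF assms(2)] assms(4) by simp_all
  have "transpR B (N \<triangleright> ?P) N P' (evR B N ?P ;; h) = \<one> N \<triangleright>\<^sub>2 h"
    using transpR_natural[of "N \<triangleright> ?P" "src B ?P" "src B N" N "trg B ?P" ?P "\<one> (N \<triangleright> ?P)" "N \<triangleright> ?P" "\<one> N" N
        h P' "evR B N ?P"] assms P' evR_hom[of N ?P]
    by (simp add: cells_def hom_iff)
  then show ?thesis
    using evR_transpR[of "N \<triangleright> ?P" N P' "evR B N ?P ;; h"] assms P' by simp
qed

lemma evR_dinatural:
  assumes "P \<in> Obj B" "g \<in> Arr B" "trg B P = trg B (Dom B g)" "Cod B g = N"
  shows "((g \<triangleright>\<^sub>2 \<one> P) \<odot>\<^sub>2 \<one> (Dom B g)) ;; evR B (Dom B g) P = (\<one> (N \<triangleright> P) \<odot>\<^sub>2 g) ;; evR B N P"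
proof -
  let ?N' = "Dom B g"
  have N: "N \<in> Obj B" "src B N = src B ?N'" "trg B N = trg B ?N'"
    using parallel_simps[OF assms(2)] Cod_Obj[OF assms(2)] assms(4) by simp_all
  have "transpR B (N \<triangleright> P) ?N' P ((\<one> (N \<triangleright> P) \<odot>\<^sub>2 g) ;; evR B N P) = g \<triangleright>\<^sub>2 \<one> P"
    using transpR_natural[of "N \<triangleright> P" "src B P" "src B N" N "trg B P" P "\<one> (N \<triangleright> P)" "N \<triangleright> P" g ?N'
        "\<one> P" P "evR B N P"] assms N evR_hom[of N P]
    by (simp add: cells_def hom_iff)
  then show ?thesis
    using evR_transpR[of "N \<triangleright> P" ?N' P "(\<one> (N \<triangleright> P) \<odot>\<^sub>2 g) ;; evR B N P"] assms N by simp
qed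

lemma tL_simps [simp]:
  assumes "M \<in> Obj B" "N \<in> Obj B" "P \<in> Obj B" "trg B M = src B N" "src B P = src B M"
  shows "tL B M N P \<in> Arr B" "Dom B (tL B M N P) = P \<triangleleft> (M \<odot> N)" "Cod B (tL B M N P) = (P \<triangleleft> M) \<triangleleft> N"
  using assms by (simp_all add: tL_def Let_def transpL_simps)

lemma tR_simps [simp]:
  assumes "M \<in> Obj B" "N \<in> Obj B" "P \<in> Obj B" "trg B M = src B N" "trg B N = trg B P"
  shows "tR B M N P \<in> Arr B" "Dom B (tR B M N P) = (M \<odot> N) \<triangleright> P" "Cod B (tR B M N P) = M \<triangleright> (N \<triangleright> P)"
  using assms by (simp_all add: tR_def Let_def transpR_simps)

lemma lbar_simps [simp]:
  assumes "M \<in> Obj B"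
  shows "lbar B M \<in> Arr B" "Dom B (lbar B M) = M" "Cod B (lbar B M) = M \<triangleleft> Unit B (src B M)"
  using assms by (simp_all add: lbar_def transpL_simps)

lemma rbar_simps [simp]:
  assumes "M \<in> Obj B"
  shows "rbar B M \<in> Arr B" "Dom B (rbar B M) = M" "Cod B (rbar B M) = Unit B (trg B M) \<triangleright> M"
  using assms by (simp_all add: rbar_def transpR_simps)

lemma lbar_ev:
  assumes "M \<in> Obj B" "R = src B M"
  shows "(\<one> (Unit B R) \<odot>\<^sub>2 lbar B M) ;; evL B (Unit B R) M = \<ll> M"
  using assms by (simp add: lbar_def evL_transpL)

lemma rbar_ev:
  assumes "M \<in> Obj B" "S = trg B M"
  shows "(rbar B M \<odot>\<^sub>2 \<one> (Unit B S)) ;; evR B (Unit B S) M = \<rr> M"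
  using assms by (simp add: rbar_def evR_transpR)

text \<open>
  The canonical map \<open>t\<close> is characterised by the fact that evaluating in two steps agrees with evaluating once. All
  later calculations with \<open>t\<close>, \<open>lbar\<close> and \<open>rbar\<close> go through these equations; the transpositions in
  their definitions do not appear again.
\<close>

lemma tL_ev:
  assumes "M \<in> Obj B" "N \<in> Obj B" "P \<in> Obj B" "trg B M = src B N" "src B P = src B M"
  shows "(\<one> M \<odot>\<^sub>2 (\<one> N \<odot>\<^sub>2 tL B M N P)) ;; ((\<one> M \<odot>\<^sub>2 evL B N (P \<triangleleft> M)) ;; evL B M P)
    = (\<aa> M N (P \<triangleleft> (M \<odot> N)))\<^sup>-\<^sup>1 ;; evL B (M \<odot> N) P"
  using assms by (simp add: tL_def Let_def merge transpL_simps evL_transpL)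

lemma tR_ev:
  assumes "M \<in> Obj B" "N \<in> Obj B" "P \<in> Obj B" "trg B M = src B N" "trg B N = trg B P"
  shows "((tR B M N P \<odot>\<^sub>2 \<one> M) \<odot>\<^sub>2 \<one> N) ;; ((evR B M (N \<triangleright> P) \<odot>\<^sub>2 \<one> N) ;; evR B N P)
    = \<aa> ((M \<odot> N) \<triangleright> P) M N ;; evR B (M \<odot> N) P"
  using assms by (simp add: tR_def Let_def merge transpR_simps evR_transpR)

lemma lbar_iso [simp]:
  assumes "M \<in> Obj B"
  shows "iso B (lbar B M)"
proof -
  let ?U = "Unit B (src B M)"
  let ?g = "(\<ll> (M \<triangleleft> ?U))\<^sup>-\<^sup>1 ;; evL B ?U M"
  have "lbar B M ;; ?g = \<one> M"
  proof -
    have "lbar B M ;; ?g = (\<ll> M)\<^sup>-\<^sup>1 ;; ((\<one> ?U \<odot>\<^sub>2 lbar B M) ;; evL B ?U M)"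
      using assms Lunit_inv_natural[of "lbar B M" "M \<triangleleft> ?U"] by (simp add: comp_assoc[symmetric])
    then show ?thesis using assms by (simp add: lbar_ev)
  qed
  moreover have "?g ;; lbar B M = \<one> (M \<triangleleft> ?U)"
  proof (rule evL_ext[of ?U M])
    have "(\<one> ?U \<odot>\<^sub>2 (?g ;; lbar B M)) ;; evL B ?U M = (\<one> ?U \<odot>\<^sub>2 ?g) ;; \<ll> M"
      using assms by (simp add: whisker_left comp_assoc lbar_ev)
    also have "\<dots> = evL B ?U M"
      using assms by (simp add: Lunit_natural)
    finally show "(\<one> ?U \<odot>\<^sub>2 (?g ;; lbar B M)) ;; evL B ?U M = (\<one> ?U \<odot>\<^sub>2 \<one> (M \<triangleleft> ?U)) ;; evL B ?U M"
      using assms by simp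
  qed (use assms in simp_all)
  ultimately have "inverse_pair B (lbar B M) ?g"
    using assms by (simp add: inverse_pair_def hom_iff)
  then show ?thesis unfolding iso_def by blast
qed

text \<open>
  The inverse is the transpose of the two-step evaluation.
\<close>

lemma tL_iso [simp]:
  assumes "M \<in> Obj B" "N \<in> Obj B" "P \<in> Obj B" "trg B M = src B N" "src B P = src B M"
  shows "iso B (tL B M N P)"
proof -
  let ?Y = "P \<triangleleft> (M \<odot> N)" and ?K = "(P \<triangleleft> M) \<triangleleft> N"
  let ?k = "\<aa> M N ?K ;; ((\<one> M \<odot>\<^sub>2 evL B N (P \<triangleleft> M)) ;; evL B M P)"
  let ?g = "transpL B (M \<odot> N) ?K P ?k"
  have g: "?g \<in> Arr B" "Dom B ?g = ?K" "Cod B ?g = ?Y"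
    using assms by (simp_all add: transpL_simps)
  have ev: "(\<one> (M \<odot> N) \<odot>\<^sub>2 ?g) ;; evL B (M \<odot> N) P = ?k"
    using assms by (simp add: evL_transpL)
  have "tL B M N P ;; ?g = \<one> ?Y"
  proof (rule evL_ext[of "M \<odot> N" P])
    have "(\<one> (M \<odot> N) \<odot>\<^sub>2 (tL B M N P ;; ?g)) ;; evL B (M \<odot> N) P = (\<one> (M \<odot> N) \<odot>\<^sub>2 tL B M N P) ;; ?k"
      using assms g by (simp add: whisker_left comp_assoc ev)
    also have "\<dots> = evL B (M \<odot> N) P"
      using assms by (simp add: slide_Assoc tL_ev)
    finally show "(\<one> (M \<odot> N) \<odot>\<^sub>2 (tL B M N P ;; ?g)) ;; evL B (M \<odot> N) P = (\<one> (M \<odot> N) \<odot>\<^sub>2 \<one> ?Y) ;; evL B (M \<odot> N) P"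
      using assms by simp
  qed (use assms g in simp_all)
  moreover have "?g ;; tL B M N P = \<one> ?K"
  proof (rule evL_ext[of N "P \<triangleleft> M"])
    show "(\<one> N \<odot>\<^sub>2 (?g ;; tL B M N P)) ;; evL B N (P \<triangleleft> M) = (\<one> N \<odot>\<^sub>2 \<one> ?K) ;; evL B N (P \<triangleleft> M)"
    proof (rule evL_ext[of M P])
      have "(\<one> M \<odot>\<^sub>2 ((\<one> N \<odot>\<^sub>2 (?g ;; tL B M N P)) ;; evL B N (P \<triangleleft> M))) ;; evL B M P
        = (\<one> M \<odot>\<^sub>2 (\<one> N \<odot>\<^sub>2 ?g)) ;; ((\<aa> M N ?Y)\<^sup>-\<^sup>1 ;; evL B (M \<odot> N) P)"
        using assms g by (simp add: whisker_left comp_assoc tL_ev)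
      also have "\<dots> = (\<one> M \<odot>\<^sub>2 evL B N (P \<triangleleft> M)) ;; evL B M P"
        using assms g by (simp add: slide_Assoc_inv ev)
      finally show "(\<one> M \<odot>\<^sub>2 ((\<one> N \<odot>\<^sub>2 (?g ;; tL B M N P)) ;; evL B N (P \<triangleleft> M))) ;; evL B M P
        = (\<one> M \<odot>\<^sub>2 ((\<one> N \<odot>\<^sub>2 \<one> ?K) ;; evL B N (P \<triangleleft> M))) ;; evL B M P"
        using assms by simp
    qed (use assms g in simp_all)
  qed (use assms g in simp_all)
  ultimately have "inverse_pair B (tL B M N P) ?g"
    using assms g by (simp add: inverse_pair_def hom_iff)
  then show ?thesis unfolding iso_def by blast
qed

section \<open>The first and the last part of a cotrace\<close>

text \<open>
  The part of a cotrace after \<open>\<theta>\<close>: the canonical isomorphisms disappear, and what remains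
  is to insert the coevaluation in front and to evaluate twice. Both sides are compared
  after transposing to \<open>N \<triangleleft> (F \<odot> Fd) \<rightarrow> N \<triangleleft> U\<close>, where the claim is dinaturality of the evaluation in \<open>\<eta>\<close>.
\<close>

lemma cotrace_exit:
  assumes "coev F Fd \<eta>" "N \<in> Obj B" "src B N = src B F"
  defines "K \<equiv> (N \<triangleleft> F) \<triangleleft> Fd"
  shows "(tL B F Fd N)\<^sup>-\<^sup>1 ;; (\<one> N \<triangleleft>\<^sub>2 \<eta>) ;; (lbar B N)\<^sup>-\<^sup>1
    = (\<ll> K)\<^sup>-\<^sup>1 ;; ((\<eta> \<odot>\<^sub>2 \<one> K) ;; (\<aa> F Fd K ;; ((\<one> F \<odot>\<^sub>2 evL B Fd (N \<triangleleft> F)) ;; evL B F N)))"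
    (is "?u = ?v")
proof -
  let ?U = "Unit B (src B F)" and ?Y = "N \<triangleleft> (F \<odot> Fd)"
  note simps = assms(2,3) coev_simps[OF assms(1)]
  have K: "K \<in> Obj B" "src B K = src B F" "trg B K = trg B N"
    using simps by (simp_all add: K_def)
  have v: "?v \<in> Arr B" "Dom B ?v = K" "Cod B ?v = N"
    using simps K by (simp_all add: K_def)
  have tL: "tL B F Fd N \<in> Arr B" "Dom B (tL B F Fd N) = ?Y" "Cod B (tL B F Fd N) = K"
    using simps by (simp_all add: K_def)
  have "tL B F Fd N ;; (?v ;; lbar B N) = \<one> N \<triangleleft>\<^sub>2 \<eta>"
  proof (rule evL_ext[of ?U N])
    have "(\<one> ?U \<odot>\<^sub>2 (tL B F Fd N ;; (?v ;; lbar B N))) ;; evL B ?U N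
        = (\<one> ?U \<odot>\<^sub>2 (tL B F Fd N ;; ?v)) ;; \<ll> N"
      using simps K v tL by (simp add: whisker_left comp_assoc lbar_ev)
    also have "\<dots> = \<ll> ?Y ;; (tL B F Fd N ;; ?v)"
      using simps K v tL by (simp add: Lunit_natural)
    also have "\<dots> = \<ll> ?Y ;; ((tL B F Fd N ;; (\<ll> K)\<^sup>-\<^sup>1) ;; ((\<eta> \<odot>\<^sub>2 \<one> K) ;; (\<aa> F Fd K ;; ((\<one> F \<odot>\<^sub>2 evL B Fd (N \<triangleleft> F)) ;; evL B F N))))"
      using simps K tL by (simp add: comp_assoc K_def)
    also have "tL B F Fd N ;; (\<ll> K)\<^sup>-\<^sup>1 = (\<ll> ?Y)\<^sup>-\<^sup>1 ;; (\<one> ?U \<odot>\<^sub>2 tL B F Fd N)"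
      using simps K tL by (simp add: Lunit_inv_natural)
    also have "\<ll> ?Y ;; (((\<ll> ?Y)\<^sup>-\<^sup>1 ;; (\<one> ?U \<odot>\<^sub>2 tL B F Fd N)) ;; ((\<eta> \<odot>\<^sub>2 \<one> K) ;; (\<aa> F Fd K ;; ((\<one> F \<odot>\<^sub>2 evL B Fd (N \<triangleleft> F)) ;; evL B F N))))
      = ((\<one> ?U \<odot>\<^sub>2 tL B F Fd N) ;; (\<eta> \<odot>\<^sub>2 \<one> K)) ;; (\<aa> F Fd K ;; ((\<one> F \<odot>\<^sub>2 evL B Fd (N \<triangleleft> F)) ;; evL B F N))"
      using simps K tL by (simp add: comp_assoc K_def)
    also have "(\<one> ?U \<odot>\<^sub>2 tL B F Fd N) ;; (\<eta> \<odot>\<^sub>2 \<one> K) = (\<eta> \<odot>\<^sub>2 \<one> ?Y) ;; (\<one> (F \<odot> Fd) \<odot>\<^sub>2 tL B F Fd N)"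
      using simps K tL by (simp add: interchange)
    also have "((\<eta> \<odot>\<^sub>2 \<one> ?Y) ;; (\<one> (F \<odot> Fd) \<odot>\<^sub>2 tL B F Fd N)) ;; (\<aa> F Fd K ;; ((\<one> F \<odot>\<^sub>2 evL B Fd (N \<triangleleft> F)) ;; evL B F N))
      = (\<eta> \<odot>\<^sub>2 \<one> ?Y) ;; evL B (F \<odot> Fd) N"
      using simps by (simp add: comp_assoc K_def slide_Assoc tL_ev)
    finally show "(\<one> ?U \<odot>\<^sub>2 (tL B F Fd N ;; (?v ;; lbar B N))) ;; evL B ?U N = (\<one> ?U \<odot>\<^sub>2 (\<one> N \<triangleleft>\<^sub>2 \<eta>)) ;; evL B ?U N"
      using evL_dinatural[of N \<eta>] simps by simp
  qed (use simps v tL in simp_all)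
  then have "?u = (tL B F Fd N)\<^sup>-\<^sup>1 ;; (tL B F Fd N ;; (?v ;; lbar B N)) ;; (lbar B N)\<^sup>-\<^sup>1"
    by simp
  also have "\<dots> = ?v"
    using simps v tL by (simp add: comp_assoc)
  finally show ?thesis .
qed

text \<open>
  The part of a cotrace before the 2-cell is applied. Its transpose \<open>M \<odot> Fd \<rightarrow> F \<triangleright> M\<close>, transposed once more,
  is the contraction of \<open>Fd\<close> against \<open>F\<close>.
\<close>

lemma cotrace_entry:
  assumes "ev F Fd \<epsilon>" "M \<in> Obj B" "trg B M = trg B F"
  defines "u \<equiv> rbar B M ;; (\<epsilon> \<triangleright>\<^sub>2 \<one> M) ;; tR B Fd F M"
  shows "u \<in> hom B M (Fd \<triangleright> (F \<triangleright> M))"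
    and "(((u \<odot>\<^sub>2 \<one> Fd) ;; evR B Fd (F \<triangleright> M)) \<odot>\<^sub>2 \<one> F) ;; evR B F M = \<aa> M Fd F ;; ((\<one> M \<odot>\<^sub>2 \<epsilon>) ;; \<rr> M)"
proof -
  note simps = assms(2,3) ev_simps[OF assms(1)]
  let ?h = "rbar B M ;; (\<epsilon> \<triangleright>\<^sub>2 \<one> M)"
  have h: "?h \<in> Arr B" "Dom B ?h = M" "Cod B ?h = (Fd \<odot> F) \<triangleright> M"
    using simps by simp_all
  show "u \<in> hom B M (Fd \<triangleright> (F \<triangleright> M))"
    using simps by (simp add: u_def hom_iff)
  have "(?h \<odot>\<^sub>2 \<one> (Fd \<odot> F)) ;; evR B (Fd \<odot> F) M
      = (rbar B M \<odot>\<^sub>2 \<one> (Fd \<odot> F)) ;; ((\<one> (Unit B (trg B F) \<triangleright> M) \<odot>\<^sub>2 \<epsilon>) ;; evR B (Unit B (trg B F)) M)"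
    using simps evR_dinatural[of M \<epsilon>] by (simp add: whisker_right comp_assoc)
  also have "\<dots> = (\<one> M \<odot>\<^sub>2 \<epsilon>) ;; ((rbar B M \<odot>\<^sub>2 \<one> (Unit B (trg B F))) ;; evR B (Unit B (trg B F)) M)"
    using simps by (simp add: merge)
  finally have *: "(?h \<odot>\<^sub>2 \<one> (Fd \<odot> F)) ;; evR B (Fd \<odot> F) M = (\<one> M \<odot>\<^sub>2 \<epsilon>) ;; \<rr> M"
    using simps by (simp add: rbar_ev)
  have "(((u \<odot>\<^sub>2 \<one> Fd) ;; evR B Fd (F \<triangleright> M)) \<odot>\<^sub>2 \<one> F) ;; evR B F M
      = ((?h \<odot>\<^sub>2 \<one> Fd) \<odot>\<^sub>2 \<one> F) ;; (((tR B Fd F M \<odot>\<^sub>2 \<one> Fd) \<odot>\<^sub>2 \<one> F) ;; ((evR B Fd (F \<triangleright> M) \<odot>\<^sub>2 \<one> F) ;; evR B F M))"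
    using simps by (simp add: u_def whisker_right comp_assoc)
  also have "\<dots> = ((?h \<odot>\<^sub>2 \<one> Fd) \<odot>\<^sub>2 \<one> F) ;; (\<aa> ((Fd \<odot> F) \<triangleright> M) Fd F ;; evR B (Fd \<odot> F) M)"
    using simps by (simp add: tR_ev)
  also have "\<dots> = \<aa> M Fd F ;; ((?h \<odot>\<^sub>2 \<one> (Fd \<odot> F)) ;; evR B (Fd \<odot> F) M)"
    using simps by (simp add: slide_Assoc)
  finally show "(((u \<odot>\<^sub>2 \<one> Fd) ;; evR B Fd (F \<triangleright> M)) \<odot>\<^sub>2 \<one> F) ;; evR B F M = \<aa> M Fd F ;; ((\<one> M \<odot>\<^sub>2 \<epsilon>) ;; \<rr> M)"
    unfolding * .
qed

end

section \<open>Traces\<close>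

context shadow
begin

lemma Sh_simps [simp]:
  assumes "M \<in> Obj B" "src B M = trg B M"
  shows "Sh \<Sigma> M \<in> Obj T" "Sh2 \<Sigma> (\<one> M) = \<one>\<^bsub>T\<^esub> (Sh \<Sigma> M)"
  using Sh_functor[of "trg B M"] assms by (auto simp: is_functor_def hcat_simps cells_def)

lemma Sh2_simps [simp]:
  assumes "f \<in> Arr B" "src B (Dom B f) = trg B (Dom B f)"
  shows "Sh2 \<Sigma> f \<in> Arr T" "Dom T (Sh2 \<Sigma> f) = Sh \<Sigma> (Dom B f)" "Cod T (Sh2 \<Sigma> f) = Sh \<Sigma> (Cod B f)"
  using Sh_functor[of "trg B (Dom B f)"] assms
  by (auto simp: is_functor_def hcat_simps T.hom_iff)

lemma Sh2_comp:
  assumes "f \<in> Arr B" "g \<in> Arr B" "Cod B f = Dom B g" "src B (Dom B f) = trg B (Dom B f)"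
  shows "Sh2 \<Sigma> (f ;; g) = Sh2 \<Sigma> f ;;\<^bsub>T\<^esub> Sh2 \<Sigma> g"
  using Sh_functor[of "trg B (Dom B f)"] assms parallel_simps[OF assms(1)]
  by (auto simp: is_functor_def hcat_simps)

lemma Sh2_comp_chain:
  assumes "f \<in> Arr B" "g \<in> Arr B" "Cod B f = Dom B g" "src B (Dom B f) = trg B (Dom B f)"
    and "k \<in> Arr T" "Dom T k = Sh \<Sigma> (Cod B g)"
  shows "Sh2 \<Sigma> f ;;\<^bsub>T\<^esub> (Sh2 \<Sigma> g ;;\<^bsub>T\<^esub> k) = Sh2 \<Sigma> (f ;; g) ;;\<^bsub>T\<^esub> k"
  using assms parallel_simps[OF assms(1)] by (simp add: Sh2_comp T.comp_assoc)

lemma Sh\<theta>_simps [simp]: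
  assumes "M \<in> Obj B" "N \<in> Obj B" "trg B M = src B N" "trg B N = src B M"
  shows "Sh\<theta> \<Sigma> M N \<in> Arr T" "Dom T (Sh\<theta> \<Sigma> M N) = Sh \<Sigma> (M \<odot> N)" "Cod T (Sh\<theta> \<Sigma> M N) = Sh \<Sigma> (N \<odot> M)"
  using Sh\<theta>_nat_iso[of "src B M" "src B N"] assms
  by (auto simp: nat_iso_def nat_trans_def prod_cat_def hcat_simps cells_def T.hom_iff)

lemma Sh\<theta>_natural:
  assumes "f \<in> Arr B" "g \<in> Arr B" "trg B (Dom B f) = src B (Dom B g)" "trg B (Dom B g) = src B (Dom B f)"
    and "Cod B f = M'" "Cod B g = N'"
  shows "Sh2 \<Sigma> (f \<odot>\<^sub>2 g) ;;\<^bsub>T\<^esub> Sh\<theta> \<Sigma> M' N' = Sh\<theta> \<Sigma> (Dom B f) (Dom B g) ;;\<^bsub>T\<^esub> Sh2 \<Sigma> (g \<odot>\<^sub>2 f)"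
  using Sh\<theta>_nat_iso[of "src B (Dom B f)" "src B (Dom B g)"] assms
  by (auto simp: nat_iso_def nat_trans_def prod_cat_def hcat_simps)

lemma Sh\<theta>_natural_chain:
  assumes "f \<in> Arr B" "g \<in> Arr B" "trg B (Dom B f) = src B (Dom B g)" "trg B (Dom B g) = src B (Dom B f)"
    and "Cod B f = M'" "Cod B g = N'" "k \<in> Arr T" "Dom T k = Sh \<Sigma> (N' \<odot> M')"
  shows "Sh2 \<Sigma> (f \<odot>\<^sub>2 g) ;;\<^bsub>T\<^esub> (Sh\<theta> \<Sigma> M' N' ;;\<^bsub>T\<^esub> k)
    = Sh\<theta> \<Sigma> (Dom B f) (Dom B g) ;;\<^bsub>T\<^esub> (Sh2 \<Sigma> (g \<odot>\<^sub>2 f) ;;\<^bsub>T\<^esub> k)"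
proof -
  have "M' \<in> Obj B" "N' \<in> Obj B" "src B M' = src B (Dom B f)" "trg B M' = trg B (Dom B f)"
    "src B N' = src B (Dom B g)" "trg B N' = trg B (Dom B g)"
    using assms(5,6) parallel_simps[OF assms(1)] parallel_simps[OF assms(2)]
      Cod_Obj[OF assms(1)] Cod_Obj[OF assms(2)] by simp_all
  then show ?thesis
    using assms by (intro T.comp_extend Sh\<theta>_natural) simp_all
qed

lemma hexagon:
  assumes "M \<in> Obj B" "N \<in> Obj B" "P \<in> Obj B"
    and "trg B M = src B N" "trg B N = src B P" "trg B P = src B M"
  shows "Sh2 \<Sigma> (\<aa> M N P) ;;\<^bsub>T\<^esub> (Sh\<theta> \<Sigma> M (N \<odot> P) ;;\<^bsub>T\<^esub> Sh2 \<Sigma> (\<aa> N P M))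
    = Sh\<theta> \<Sigma> (M \<odot> N) P ;;\<^bsub>T\<^esub> (Sh2 \<Sigma> ((\<aa> P M N)\<^sup>-\<^sup>1) ;;\<^bsub>T\<^esub> Sh\<theta> \<Sigma> (P \<odot> M) N)"
  using Sh\<theta>_hexagon[of M "src B M" "src B N" N "src B P" P] assms
  by (simp add: cells_def T.comp_assoc)

lemma Sh\<theta>_unit:
  assumes "M \<in> Obj B" "src B M = R" "trg B M = R"
  shows "Sh\<theta> \<Sigma> M (Unit B R) ;;\<^bsub>T\<^esub> Sh2 \<Sigma> (\<ll> M) = Sh2 \<Sigma> (\<rr> M)"
  using Sh\<theta>_unit_right[of M R] assms by (simp add: cells_def)

lemma trace_eq:
  assumes "coev M Md \<eta>" "ev M Md \<epsilon>" "Q \<in> Obj B" "P \<in> Obj B"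
    and "src B Q = src B M" "trg B Q = src B M" "src B P = trg B M" "trg B P = trg B M"
    and "f \<in> Arr B" "Dom B f = Q \<odot> M" "Cod B f = M \<odot> P"
  shows "trace B T \<Sigma> M Md \<eta> \<epsilon> Q P f
    = Sh2 \<Sigma> (dunit M Md \<eta> Q ;; (f \<odot>\<^sub>2 \<one> Md)) ;;\<^bsub>T\<^esub> (Sh\<theta> \<Sigma> (M \<odot> P) Md ;;\<^bsub>T\<^esub> Sh2 \<Sigma> (dcounit M Md \<epsilon> P))"
proof -
  note simps = assms coev_simps[OF assms(1)]
  show ?thesis
    unfolding trace_def dunit_def[symmetric] dcounit_def[symmetric]
    using simps by (simp add: Sh2_comp T.comp_assoc)
qed

lemma trace_simps:
  assumes "coev M Md \<eta>" "ev M Md \<epsilon>" "Q \<in> Obj B" "P \<in> Obj B"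
    and "src B Q = src B M" "trg B Q = src B M" "src B P = trg B M" "trg B P = trg B M"
    and "f \<in> Arr B" "Dom B f = Q \<odot> M" "Cod B f = M \<odot> P"
  shows "trace B T \<Sigma> M Md \<eta> \<epsilon> Q P f \<in> Arr T" "Dom T (trace B T \<Sigma> M Md \<eta> \<epsilon> Q P f) = Sh \<Sigma> Q"
    "Cod T (trace B T \<Sigma> M Md \<eta> \<epsilon> Q P f) = Sh \<Sigma> P"
  using assms coev_simps[OF assms(1)] by (simp_all add: trace_eq)

lemma trace_natural:
  assumes "coev M Md \<eta>" "ev M Md \<epsilon>" "Q \<in> Obj B" "P \<in> Obj B"
    and "src B Q = src B M" "trg B Q = src B M" "src B P = trg B M" "trg B P = trg B M"
    and "f \<in> Arr B" "Dom B f = Q \<odot> M" "Cod B f = M \<odot> P"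
    and "h \<in> Arr B" "Cod B h = Q"
  shows "Sh2 \<Sigma> h ;;\<^bsub>T\<^esub> trace B T \<Sigma> M Md \<eta> \<epsilon> Q P f
    = trace B T \<Sigma> M Md \<eta> \<epsilon> (Dom B h) P ((h \<odot>\<^sub>2 \<one> M) ;; f)"
proof -
  have h: "src B (Dom B h) = src B M" "trg B (Dom B h) = src B M"
    using parallel_simps[OF assms(12)] assms by auto
  note simps = assms coev_simps[OF assms(1)] h
  have "h ;; (dunit M Md \<eta> Q ;; (f \<odot>\<^sub>2 \<one> Md)) = (h ;; dunit M Md \<eta> Q) ;; (f \<odot>\<^sub>2 \<one> Md)"
    using simps by (simp add: comp_assoc)
  also have "\<dots> = dunit M Md \<eta> (Dom B h) ;; (((h \<odot>\<^sub>2 \<one> M) ;; f) \<odot>\<^sub>2 \<one> Md)"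
    using simps by (simp add: dunit_natural whisker_right comp_assoc)
  finally show ?thesis
    using simps by (simp add: trace_eq Sh2_comp_chain)
qed

text \<open>
  The trace of a 2-cell that leaves the factor \<open>M\<close> alone. The rotation \<open>\<theta>\<close> in front and the
  rotation inside the trace combine by the hexagon into one rotation past \<open>Md \<odot> M\<close>; after \<open>\<epsilon>\<close> this is a
  rotation past a unit 1-cell, hence trivial, and the triangle identity removes \<open>\<eta>\<close> and \<open>\<epsilon>\<close>.
\<close>

lemma trace_cyclic:
  assumes "dual_pair B M Md \<eta> \<epsilon>" "A \<in> Obj B" "src B A = trg B M" "trg B A = src B M"
    and "\<kappa> \<in> Arr B" "Dom B \<kappa> = A \<odot> M" "Cod B \<kappa> = W"
  shows "Sh\<theta> \<Sigma> A M ;;\<^bsub>T\<^esub> trace B T \<Sigma> M Md \<eta> \<epsilon> (M \<odot> A) W (\<aa> M A M ;; (\<one> M \<odot>\<^sub>2 \<kappa>)) = Sh2 \<Sigma> \<kappa>"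
proof -
  interpret D: dual_pair B M Md \<eta> \<epsilon> by fact
  note simps = assms(2-7) coev_simps[OF D.is_coev] ev_simps[OF D.is_ev] D.is_coev D.is_ev
  have W: "W \<in> Obj B" "src B W = trg B M" "trg B W = trg B M"
    using parallel_simps[OF assms(5)] Cod_Obj[OF assms(5)] simps by auto
  let ?k = "dunit M Md \<eta> A ;; (\<kappa> \<odot>\<^sub>2 \<one> Md)"
  have "dunit M Md \<eta> (M \<odot> A) ;; ((\<aa> M A M ;; (\<one> M \<odot>\<^sub>2 \<kappa>)) \<odot>\<^sub>2 \<one> Md)
      = (dunit M Md \<eta> (M \<odot> A) ;; (\<aa> M A M \<odot>\<^sub>2 \<one> Md)) ;; ((\<one> M \<odot>\<^sub>2 \<kappa>) \<odot>\<^sub>2 \<one> Md)"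
    using simps W by (simp add: whisker_right comp_assoc)
  also have "\<dots> = (\<one> M \<odot>\<^sub>2 ?k) ;; (\<aa> M W Md)\<^sup>-\<^sup>1"
    using simps W by (simp add: dunit_whisker whisker_left slide_Assoc_inv comp_assoc)
  finally have "Sh\<theta> \<Sigma> A M ;;\<^bsub>T\<^esub> trace B T \<Sigma> M Md \<eta> \<epsilon> (M \<odot> A) W (\<aa> M A M ;; (\<one> M \<odot>\<^sub>2 \<kappa>))
      = Sh\<theta> \<Sigma> A M ;;\<^bsub>T\<^esub> (Sh2 \<Sigma> (\<one> M \<odot>\<^sub>2 ?k) ;;\<^bsub>T\<^esub>
         (Sh2 \<Sigma> ((\<aa> M W Md)\<^sup>-\<^sup>1) ;;\<^bsub>T\<^esub> (Sh\<theta> \<Sigma> (M \<odot> W) Md ;;\<^bsub>T\<^esub> Sh2 \<Sigma> (dcounit M Md \<epsilon> W))))"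
    using simps W by (simp add: trace_eq Sh2_comp T.comp_assoc)
  also have "\<dots> = Sh2 \<Sigma> (?k \<odot>\<^sub>2 \<one> M) ;;\<^bsub>T\<^esub> (Sh\<theta> \<Sigma> (W \<odot> Md) M ;;\<^bsub>T\<^esub>
         (Sh2 \<Sigma> ((\<aa> M W Md)\<^sup>-\<^sup>1) ;;\<^bsub>T\<^esub> (Sh\<theta> \<Sigma> (M \<odot> W) Md ;;\<^bsub>T\<^esub> Sh2 \<Sigma> (dcounit M Md \<epsilon> W))))"
    using simps W by (simp add: Sh\<theta>_natural_chain)
  also have "\<dots> = Sh2 \<Sigma> (?k \<odot>\<^sub>2 \<one> M) ;;\<^bsub>T\<^esub> ((Sh\<theta> \<Sigma> (W \<odot> Md) M ;;\<^bsub>T\<^esub>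
         (Sh2 \<Sigma> ((\<aa> M W Md)\<^sup>-\<^sup>1) ;;\<^bsub>T\<^esub> Sh\<theta> \<Sigma> (M \<odot> W) Md)) ;;\<^bsub>T\<^esub> Sh2 \<Sigma> (dcounit M Md \<epsilon> W))"
    using simps W by (simp add: T.comp_assoc)
  also have "\<dots> = Sh2 \<Sigma> (?k \<odot>\<^sub>2 \<one> M) ;;\<^bsub>T\<^esub> (Sh2 \<Sigma> (\<aa> W Md M) ;;\<^bsub>T\<^esub> (Sh\<theta> \<Sigma> W (Md \<odot> M) ;;\<^bsub>T\<^esub>
         Sh2 \<Sigma> (\<aa> Md M W ;; dcounit M Md \<epsilon> W)))"
    using simps W by (simp add: hexagon[symmetric] T.comp_assoc Sh2_comp)
  also have "\<aa> Md M W ;; dcounit M Md \<epsilon> W = (\<epsilon> \<odot>\<^sub>2 \<one> W) ;; \<ll> W"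
    using simps W by (simp add: dcounit_def comp_assoc)
  also have "Sh\<theta> \<Sigma> W (Md \<odot> M) ;;\<^bsub>T\<^esub> Sh2 \<Sigma> ((\<epsilon> \<odot>\<^sub>2 \<one> W) ;; \<ll> W)
      = Sh2 \<Sigma> (\<one> W \<odot>\<^sub>2 \<epsilon>) ;;\<^bsub>T\<^esub> (Sh\<theta> \<Sigma> W (Unit B (trg B M)) ;;\<^bsub>T\<^esub> Sh2 \<Sigma> (\<ll> W))"
    using simps W by (simp add: Sh2_comp Sh\<theta>_natural_chain)
  also have "Sh2 \<Sigma> (?k \<odot>\<^sub>2 \<one> M) ;;\<^bsub>T\<^esub> (Sh2 \<Sigma> (\<aa> W Md M) ;;\<^bsub>T\<^esub> (Sh2 \<Sigma> (\<one> W \<odot>\<^sub>2 \<epsilon>) ;;\<^bsub>T\<^esub>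
        (Sh\<theta> \<Sigma> W (Unit B (trg B M)) ;;\<^bsub>T\<^esub> Sh2 \<Sigma> (\<ll> W))))
      = Sh2 \<Sigma> ((?k \<odot>\<^sub>2 \<one> M) ;; (\<aa> W Md M ;; ((\<one> W \<odot>\<^sub>2 \<epsilon>) ;; \<rr> W)))"
    using simps W by (simp add: Sh\<theta>_unit Sh2_comp)
  also have "(?k \<odot>\<^sub>2 \<one> M) ;; (\<aa> W Md M ;; ((\<one> W \<odot>\<^sub>2 \<epsilon>) ;; \<rr> W)) = \<kappa>"
  proof -
    have "(?k \<odot>\<^sub>2 \<one> M) ;; (\<aa> W Md M ;; ((\<one> W \<odot>\<^sub>2 \<epsilon>) ;; \<rr> W))
        = (dunit M Md \<eta> A \<odot>\<^sub>2 \<one> M) ;; (\<aa> (A \<odot> M) Md M ;; (((\<kappa> \<odot>\<^sub>2 \<one> (Md \<odot> M)) ;; (\<one> W \<odot>\<^sub>2 \<epsilon>)) ;; \<rr> W))"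
      using simps W by (simp add: whisker_right comp_assoc slide_Assoc)
    also have "(\<kappa> \<odot>\<^sub>2 \<one> (Md \<odot> M)) ;; (\<one> W \<odot>\<^sub>2 \<epsilon>) = (\<one> (A \<odot> M) \<odot>\<^sub>2 \<epsilon>) ;; (\<kappa> \<odot>\<^sub>2 \<one> (Unit B (trg B M)))"
      using simps W by (simp add: interchange)
    also have "(dunit M Md \<eta> A \<odot>\<^sub>2 \<one> M) ;; (\<aa> (A \<odot> M) Md M ;;
          (((\<one> (A \<odot> M) \<odot>\<^sub>2 \<epsilon>) ;; (\<kappa> \<odot>\<^sub>2 \<one> (Unit B (trg B M)))) ;; \<rr> W))
        = ((dunit M Md \<eta> A \<odot>\<^sub>2 \<one> M) ;; (\<aa> (A \<odot> M) Md M ;; ((\<one> (A \<odot> M) \<odot>\<^sub>2 \<epsilon>) ;; \<rr> (A \<odot> M)))) ;; \<kappa>"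
      using simps W by (simp add: Runit_natural comp_assoc)
    also have "\<dots> = \<kappa>"
      using simps W by (simp add: D.snake)
    finally show ?thesis .
  qed
  finally show ?thesis .
qed

text \<open>
  The rotation past \<open>Gd \<odot> Fd\<close> is, by the hexagon,
  a rotation past \<open>Fd\<close> followed by one past \<open>Gd\<close>. The part of the composite trace that
  belongs to \<open>G\<close> is then moved past the counit of \<open>F\<close> by naturality.
\<close>

lemma trace_comp:
  assumes F: "coev F Fd \<eta>F" "ev F Fd \<epsilon>F" and G: "coev G Gd \<eta>G" "ev G Gd \<epsilon>G"
    and FG: "trg B F = src B G"
    and X: "X \<in> Obj B" "src B X = src B F" "trg B X = src B F"
    and W: "W \<in> Obj B" "src B W = src B G" "trg B W = src B G"
    and Z: "Z \<in> Obj B" "src B Z = trg B G" "trg B Z = trg B G"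
    and \<phi>: "\<phi> \<in> Arr B" "Dom B \<phi> = X \<odot> F" "Cod B \<phi> = F \<odot> W"
    and \<delta>: "\<delta> \<in> Arr B" "Dom B \<delta> = W \<odot> G" "Cod B \<delta> = G \<odot> Z"
  defines "\<Phi> \<equiv> (\<aa> X F G)\<^sup>-\<^sup>1 ;; ((\<phi> \<odot>\<^sub>2 \<one> G) ;; (\<aa> F W G ;; ((\<one> F \<odot>\<^sub>2 \<delta>) ;; (\<aa> F G Z)\<^sup>-\<^sup>1)))"
  shows "trace B T \<Sigma> (F \<odot> G) (Gd \<odot> Fd)
      (comp_unit B F Fd \<eta>F G Gd \<eta>G) (comp_counit B F Fd \<epsilon>F G Gd \<epsilon>G) X Z \<Phi>
    = trace B T \<Sigma> F Fd \<eta>F \<epsilon>F X W \<phi> ;;\<^bsub>T\<^esub> trace B T \<Sigma> G Gd \<eta>G \<epsilon>G W Z \<delta>"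
proof -
  note simps = F G FG X W Z \<phi> \<delta> coev_simps[OF F(1)] coev_simps[OF G(1)] ev_simps[OF F(2)] ev_simps[OF G(2)]
  let ?\<eta> = "comp_unit B F Fd \<eta>F G Gd \<eta>G" and ?\<epsilon> = "comp_counit B F Fd \<epsilon>F G Gd \<epsilon>G"
  have cFG: "coev (F \<odot> G) (Gd \<odot> Fd) ?\<eta>" "ev (F \<odot> G) (Gd \<odot> Fd) ?\<epsilon>"
    using simps by (simp_all add: coev_comp ev_comp)
  have \<Phi>: "\<Phi> \<in> Arr B" "Dom B \<Phi> = X \<odot> (F \<odot> G)" "Cod B \<Phi> = (F \<odot> G) \<odot> Z"
    using simps by (simp_all add: \<Phi>_def)
  let ?eG = "dcounit G Gd \<epsilon>G Z" and ?eF = "dcounit F Fd \<epsilon>F"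
  let ?p = "dunit F Fd \<eta>F X ;; (\<phi> \<odot>\<^sub>2 \<one> Fd)"
  let ?u = "dunit G Gd \<eta>G W ;; (\<delta> \<odot>\<^sub>2 \<one> Gd)"
  let ?x = "(\<aa> F (G \<odot> Z) Gd)\<^sup>-\<^sup>1 ;; ((\<aa> F G Z)\<^sup>-\<^sup>1 \<odot>\<^sub>2 \<one> Gd)"
  let ?y = "(\<one> Fd \<odot>\<^sub>2 \<aa> F G Z) ;; ?eF (G \<odot> Z)"
  define \<Psi> where "\<Psi> = (\<phi> \<odot>\<^sub>2 \<one> G) ;; (\<aa> F W G ;; ((\<one> F \<odot>\<^sub>2 \<delta>) ;; (\<aa> F G Z)\<^sup>-\<^sup>1))"
  have \<Psi>: "\<Psi> \<in> Arr B" "Dom B \<Psi> = (X \<odot> F) \<odot> G" "Cod B \<Psi> = (F \<odot> G) \<odot> Z"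
    using simps by (simp_all add: \<Psi>_def)
  have p: "?p \<in> Arr B" "Dom B ?p = X" "Cod B ?p = (F \<odot> W) \<odot> Fd"
    and u: "?u \<in> Arr B" "Dom B ?u = W" "Cod B ?u = (G \<odot> Z) \<odot> Gd"
    and x: "?x \<in> Arr B" "Dom B ?x = F \<odot> ((G \<odot> Z) \<odot> Gd)" "Cod B ?x = ((F \<odot> G) \<odot> Z) \<odot> Gd"
    and y: "?y \<in> Arr B" "Dom B ?y = Fd \<odot> ((F \<odot> G) \<odot> Z)" "Cod B ?y = G \<odot> Z"
    using simps by simp_all
  \<comment> \<open>\<open>\<Psi>\<close> is \<open>\<Phi>\<close> with its source regrouped; \<open>\<phi>\<close> then leaves the scope of the coevaluation of \<open>G\<close>.\<close>
  have mateG: "dunit G Gd \<eta>G (X \<odot> F) ;; (\<Psi> \<odot>\<^sub>2 \<one> Gd) = \<phi> ;; ((\<one> F \<odot>\<^sub>2 ?u) ;; ?x)"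
  proof -
    have "dunit G Gd \<eta>G (X \<odot> F) ;; (\<Psi> \<odot>\<^sub>2 \<one> Gd)
        = (dunit G Gd \<eta>G (X \<odot> F) ;; ((\<phi> \<odot>\<^sub>2 \<one> G) \<odot>\<^sub>2 \<one> Gd)) ;; ((\<aa> F W G \<odot>\<^sub>2 \<one> Gd) ;;
            (((\<one> F \<odot>\<^sub>2 \<delta>) \<odot>\<^sub>2 \<one> Gd) ;; ((\<aa> F G Z)\<^sup>-\<^sup>1 \<odot>\<^sub>2 \<one> Gd)))"
      using simps by (simp add: \<Psi>_def whisker_right comp_assoc)
    also have "\<dots> = \<phi> ;; ((dunit G Gd \<eta>G (F \<odot> W) ;; (\<aa> F W G \<odot>\<^sub>2 \<one> Gd)) ;;
            (((\<one> F \<odot>\<^sub>2 \<delta>) \<odot>\<^sub>2 \<one> Gd) ;; ((\<aa> F G Z)\<^sup>-\<^sup>1 \<odot>\<^sub>2 \<one> Gd)))"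
    proof -
      have "dunit G Gd \<eta>G (X \<odot> F) ;; ((\<phi> \<odot>\<^sub>2 \<one> G) \<odot>\<^sub>2 \<one> Gd) = \<phi> ;; dunit G Gd \<eta>G (F \<odot> W)"
        using simps dunit_natural[OF G(1) \<phi>(1), of "F \<odot> W"] by simp
      then show ?thesis using simps by (simp add: comp_assoc)
    qed
    also have "\<dots> = \<phi> ;; ((\<one> F \<odot>\<^sub>2 ?u) ;; ?x)"
      using simps by (simp add: dunit_whisker whisker_left slide_Assoc_inv comp_assoc)
    finally show ?thesis .
  qed
  have mate: "dunit (F \<odot> G) (Gd \<odot> Fd) ?\<eta> X ;; (\<Phi> \<odot>\<^sub>2 \<one> (Gd \<odot> Fd))
      = ?p ;; (((\<one> F \<odot>\<^sub>2 ?u) \<odot>\<^sub>2 \<one> Fd) ;; ((?x \<odot>\<^sub>2 \<one> Fd) ;; \<aa> ((F \<odot> G) \<odot> Z) Gd Fd))"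
  proof -
    have "dunit (F \<odot> G) (Gd \<odot> Fd) ?\<eta> X ;; (\<Phi> \<odot>\<^sub>2 \<one> (Gd \<odot> Fd))
        = dunit F Fd \<eta>F X ;; ((dunit G Gd \<eta>G (X \<odot> F) \<odot>\<^sub>2 \<one> Fd) ;; (((\<aa> X F G \<odot>\<^sub>2 \<one> Gd) \<odot>\<^sub>2 \<one> Fd) ;;
           (((\<Phi> \<odot>\<^sub>2 \<one> Gd) \<odot>\<^sub>2 \<one> Fd) ;; \<aa> ((F \<odot> G) \<odot> Z) Gd Fd)))"
      using simps \<Phi> by (simp add: dunit_comp whisker_right slide_Assoc comp_assoc)
    also have "\<dots> = dunit F Fd \<eta>F X ;; (((dunit G Gd \<eta>G (X \<odot> F) ;; ((\<aa> X F G ;; \<Phi>) \<odot>\<^sub>2 \<one> Gd)) \<odot>\<^sub>2 \<one> Fd)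
           ;; \<aa> ((F \<odot> G) \<odot> Z) Gd Fd)"
      using simps \<Phi> by (simp add: whisker_right comp_assoc)
    also have "\<aa> X F G ;; \<Phi> = \<Psi>"
      using simps by (simp add: \<Phi>_def \<Psi>_def)
    also note mateG
    also have "dunit F Fd \<eta>F X ;; (((\<phi> ;; ((\<one> F \<odot>\<^sub>2 ?u) ;; ?x)) \<odot>\<^sub>2 \<one> Fd) ;; \<aa> ((F \<odot> G) \<odot> Z) Gd Fd)
      = ?p ;; (((\<one> F \<odot>\<^sub>2 ?u) \<odot>\<^sub>2 \<one> Fd) ;; ((?x \<odot>\<^sub>2 \<one> Fd) ;; \<aa> ((F \<odot> G) \<odot> Z) Gd Fd))"
      using simps u x by (simp add: whisker_right comp_assoc)
    finally show ?thesis .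
  qed
  have y_natural: "Sh\<theta> \<Sigma> (Fd \<odot> ((F \<odot> G) \<odot> Z)) Gd ;;\<^bsub>T\<^esub> Sh2 \<Sigma> (\<one> Gd \<odot>\<^sub>2 ?y)
      = Sh2 \<Sigma> (?y \<odot>\<^sub>2 \<one> Gd) ;;\<^bsub>T\<^esub> Sh\<theta> \<Sigma> (G \<odot> Z) Gd"
    using simps y by (subst Sh\<theta>_natural) simp_all
  have coherence: "(\<one> Fd \<odot>\<^sub>2 ?x) ;; ((\<aa> Fd ((F \<odot> G) \<odot> Z) Gd)\<^sup>-\<^sup>1 ;; (?y \<odot>\<^sub>2 \<one> Gd)) = ?eF ((G \<odot> Z) \<odot> Gd)"
  proof -
    have "(\<one> Fd \<odot>\<^sub>2 ?x) ;; ((\<aa> Fd ((F \<odot> G) \<odot> Z) Gd)\<^sup>-\<^sup>1 ;; (?y \<odot>\<^sub>2 \<one> Gd))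
      = (\<one> Fd \<odot>\<^sub>2 (\<aa> F (G \<odot> Z) Gd)\<^sup>-\<^sup>1) ;; ((\<aa> Fd (F \<odot> (G \<odot> Z)) Gd)\<^sup>-\<^sup>1 ;;
          (((\<one> Fd \<odot>\<^sub>2 (\<aa> F G Z)\<^sup>-\<^sup>1) \<odot>\<^sub>2 \<one> Gd) ;; (((\<one> Fd \<odot>\<^sub>2 \<aa> F G Z) \<odot>\<^sub>2 \<one> Gd) ;; (?eF (G \<odot> Z) \<odot>\<^sub>2 \<one> Gd))))"
      using simps by (simp add: whisker slide_Assoc_inv comp_assoc)
    also have "\<dots> = ?eF ((G \<odot> Z) \<odot> Gd)"
      using simps by (simp add: merge dcounit_whisker)
    finally show ?thesis .
  qed
  \<comment> \<open>The dual of \<open>F\<close> is rotated to the front first; then the counit of \<open>F\<close> is applied, and only then the dual of \<open>G\<close> is rotated.\<close>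
  have middle: "Sh2 \<Sigma> (?x \<odot>\<^sub>2 \<one> Fd) ;;\<^bsub>T\<^esub> (Sh2 \<Sigma> (\<aa> ((F \<odot> G) \<odot> Z) Gd Fd) ;;\<^bsub>T\<^esub>
        (Sh\<theta> \<Sigma> ((F \<odot> G) \<odot> Z) (Gd \<odot> Fd) ;;\<^bsub>T\<^esub> Sh2 \<Sigma> (dcounit (F \<odot> G) (Gd \<odot> Fd) ?\<epsilon> Z)))
      = Sh\<theta> \<Sigma> (F \<odot> ((G \<odot> Z) \<odot> Gd)) Fd ;;\<^bsub>T\<^esub> (Sh2 \<Sigma> (?eF ((G \<odot> Z) \<odot> Gd)) ;;\<^bsub>T\<^esub>
          (Sh\<theta> \<Sigma> (G \<odot> Z) Gd ;;\<^bsub>T\<^esub> Sh2 \<Sigma> ?eG))"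
  proof -
    have "Sh2 \<Sigma> (?x \<odot>\<^sub>2 \<one> Fd) ;;\<^bsub>T\<^esub> (Sh2 \<Sigma> (\<aa> ((F \<odot> G) \<odot> Z) Gd Fd) ;;\<^bsub>T\<^esub>
        (Sh\<theta> \<Sigma> ((F \<odot> G) \<odot> Z) (Gd \<odot> Fd) ;;\<^bsub>T\<^esub> Sh2 \<Sigma> (dcounit (F \<odot> G) (Gd \<odot> Fd) ?\<epsilon> Z)))
      = Sh2 \<Sigma> (?x \<odot>\<^sub>2 \<one> Fd) ;;\<^bsub>T\<^esub> ((Sh2 \<Sigma> (\<aa> ((F \<odot> G) \<odot> Z) Gd Fd) ;;\<^bsub>T\<^esub>
        (Sh\<theta> \<Sigma> ((F \<odot> G) \<odot> Z) (Gd \<odot> Fd) ;;\<^bsub>T\<^esub> Sh2 \<Sigma> (\<aa> Gd Fd ((F \<odot> G) \<odot> Z)))) ;;\<^bsub>T\<^esub>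
          (Sh2 \<Sigma> (\<one> Gd \<odot>\<^sub>2 ?y) ;;\<^bsub>T\<^esub> Sh2 \<Sigma> ?eG))"
      using simps x y by (simp add: dcounit_comp Sh2_comp[of "_ ;; _" ?eG] Sh2_comp[of "\<aa> _ _ _"] T.comp_assoc)
    also have "\<dots> = Sh2 \<Sigma> (?x \<odot>\<^sub>2 \<one> Fd) ;;\<^bsub>T\<^esub> (Sh\<theta> \<Sigma> (((F \<odot> G) \<odot> Z) \<odot> Gd) Fd ;;\<^bsub>T\<^esub>
        (Sh2 \<Sigma> ((\<aa> Fd ((F \<odot> G) \<odot> Z) Gd)\<^sup>-\<^sup>1) ;;\<^bsub>T\<^esub> ((Sh\<theta> \<Sigma> (Fd \<odot> ((F \<odot> G) \<odot> Z)) Gd ;;\<^bsub>T\<^esub>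
          Sh2 \<Sigma> (\<one> Gd \<odot>\<^sub>2 ?y)) ;;\<^bsub>T\<^esub> Sh2 \<Sigma> ?eG)))"
      using simps x y by (simp add: hexagon T.comp_assoc)
    also have "\<dots> = Sh\<theta> \<Sigma> (F \<odot> ((G \<odot> Z) \<odot> Gd)) Fd ;;\<^bsub>T\<^esub> (Sh2 \<Sigma> (\<one> Fd \<odot>\<^sub>2 ?x) ;;\<^bsub>T\<^esub>
        (Sh2 \<Sigma> ((\<aa> Fd ((F \<odot> G) \<odot> Z) Gd)\<^sup>-\<^sup>1) ;;\<^bsub>T\<^esub> (Sh2 \<Sigma> (?y \<odot>\<^sub>2 \<one> Gd) ;;\<^bsub>T\<^esub>
          (Sh\<theta> \<Sigma> (G \<odot> Z) Gd ;;\<^bsub>T\<^esub> Sh2 \<Sigma> ?eG))))"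
      unfolding y_natural using simps x y
      by (simp add: Sh\<theta>_natural_chain T.comp_assoc)
    also have "\<dots> = Sh\<theta> \<Sigma> (F \<odot> ((G \<odot> Z) \<odot> Gd)) Fd ;;\<^bsub>T\<^esub> (Sh2 \<Sigma> ((\<one> Fd \<odot>\<^sub>2 ?x) ;;
        ((\<aa> Fd ((F \<odot> G) \<odot> Z) Gd)\<^sup>-\<^sup>1 ;; (?y \<odot>\<^sub>2 \<one> Gd))) ;;\<^bsub>T\<^esub> (Sh\<theta> \<Sigma> (G \<odot> Z) Gd ;;\<^bsub>T\<^esub> Sh2 \<Sigma> ?eG))"
      using simps x y by (simp add: Sh2_comp_chain comp_assoc)
    finally show ?thesis unfolding coherence .
  qed
  have "trace B T \<Sigma> (F \<odot> G) (Gd \<odot> Fd) ?\<eta> ?\<epsilon> X Z \<Phi>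
      = Sh2 \<Sigma> (?p ;; (((\<one> F \<odot>\<^sub>2 ?u) \<odot>\<^sub>2 \<one> Fd) ;; ((?x \<odot>\<^sub>2 \<one> Fd) ;; \<aa> ((F \<odot> G) \<odot> Z) Gd Fd))) ;;\<^bsub>T\<^esub>
        (Sh\<theta> \<Sigma> ((F \<odot> G) \<odot> Z) (Gd \<odot> Fd) ;;\<^bsub>T\<^esub> Sh2 \<Sigma> (dcounit (F \<odot> G) (Gd \<odot> Fd) ?\<epsilon> Z))"
    using simps cFG \<Phi> by (simp add: trace_eq mate)
  also have "\<dots> = Sh2 \<Sigma> ?p ;;\<^bsub>T\<^esub> (Sh2 \<Sigma> ((\<one> F \<odot>\<^sub>2 ?u) \<odot>\<^sub>2 \<one> Fd) ;;\<^bsub>T\<^esub>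
      (Sh2 \<Sigma> (?x \<odot>\<^sub>2 \<one> Fd) ;;\<^bsub>T\<^esub> (Sh2 \<Sigma> (\<aa> ((F \<odot> G) \<odot> Z) Gd Fd) ;;\<^bsub>T\<^esub>
        (Sh\<theta> \<Sigma> ((F \<odot> G) \<odot> Z) (Gd \<odot> Fd) ;;\<^bsub>T\<^esub> Sh2 \<Sigma> (dcounit (F \<odot> G) (Gd \<odot> Fd) ?\<epsilon> Z)))))"
    using simps cFG p u x by (simp add: Sh2_comp_chain)
  also have "\<dots> = Sh2 \<Sigma> ?p ;;\<^bsub>T\<^esub> (Sh\<theta> \<Sigma> (F \<odot> W) Fd ;;\<^bsub>T\<^esub> ((Sh2 \<Sigma> (\<one> Fd \<odot>\<^sub>2 (\<one> F \<odot>\<^sub>2 ?u)) ;;\<^bsub>T\<^esub>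
      Sh2 \<Sigma> (?eF ((G \<odot> Z) \<odot> Gd))) ;;\<^bsub>T\<^esub> (Sh\<theta> \<Sigma> (G \<odot> Z) Gd ;;\<^bsub>T\<^esub> Sh2 \<Sigma> ?eG)))"
    unfolding middle using simps p u
    by (simp add: Sh\<theta>_natural_chain T.comp_assoc)
  also have "Sh2 \<Sigma> (\<one> Fd \<odot>\<^sub>2 (\<one> F \<odot>\<^sub>2 ?u)) ;;\<^bsub>T\<^esub> Sh2 \<Sigma> (?eF ((G \<odot> Z) \<odot> Gd)) = Sh2 \<Sigma> (?eF W) ;;\<^bsub>T\<^esub> Sh2 \<Sigma> ?u"
  proof -
    have "(\<one> Fd \<odot>\<^sub>2 (\<one> F \<odot>\<^sub>2 ?u)) ;; ?eF ((G \<odot> Z) \<odot> Gd) = ?eF W ;; ?u"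
      using dcounit_natural[OF F(2) u(1), of "(G \<odot> Z) \<odot> Gd"] simps u by simp
    then show ?thesis
      using simps u by (simp add: Sh2_comp[symmetric])
  qed
  also have "Sh2 \<Sigma> ?p ;;\<^bsub>T\<^esub> (Sh\<theta> \<Sigma> (F \<odot> W) Fd ;;\<^bsub>T\<^esub> ((Sh2 \<Sigma> (?eF W) ;;\<^bsub>T\<^esub> Sh2 \<Sigma> ?u) ;;\<^bsub>T\<^esub>
      (Sh\<theta> \<Sigma> (G \<odot> Z) Gd ;;\<^bsub>T\<^esub> Sh2 \<Sigma> ?eG)))
      = trace B T \<Sigma> F Fd \<eta>F \<epsilon>F X W \<phi> ;;\<^bsub>T\<^esub> trace B T \<Sigma> G Gd \<eta>G \<epsilon>G W Z \<delta>"
    using simps p u by (simp add: trace_eq T.comp_assoc)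
  finally show ?thesis .
qed

end

section \<open>Exchanging the two traces of a composite dual pair\<close>

context bicategory
begin

text \<open>
  The right-hand side of the compatibility hypothesis, with its source regrouped, has the form to
  which the decomposition of traces over \<open>F \<odot> G\<close> applies: a 2-cell past \<open>F\<close>
  (leaving that factor alone) followed by a 2-cell past \<open>G\<close>. Only associators are moved.
\<close>

lemma compatibility_regrouped:
  assumes F: "F \<in> Obj B" and G: "G \<in> Obj B" "src B G = trg B F"
    and J: "J \<in> Obj B" "src B J = trg B F" "trg B J = src B F"
    and Q: "Q \<in> Obj B" "src B Q = src B F" "trg B Q = src B F"
    and P: "P \<in> Obj B" "src B P = trg B F" "trg B P = trg B F"
    and M: "M \<in> Obj B" "src B M = trg B F" "trg B M = trg B F"
    and Z: "Z \<in> Obj B" "src B Z = trg B G" "trg B Z = trg B G"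
    and \<xi>: "\<xi> \<in> Arr B" "Dom B \<xi> = Q \<odot> F" "Cod B \<xi> = F \<odot> P"
    and w: "w \<in> Arr B" "Dom B w = J \<odot> F" "Cod B w = M"
    and \<delta>: "\<delta> \<in> Arr B" "Dom B \<delta> = (M \<odot> P) \<odot> G" "Cod B \<delta> = G \<odot> Z"
  defines "\<kappa> \<equiv> \<aa> J Q F ;; (\<one> J \<odot>\<^sub>2 \<xi>)"
    and "\<delta>' \<equiv> (((\<aa> J F P)\<^sup>-\<^sup>1 ;; (w \<odot>\<^sub>2 \<one> P)) \<odot>\<^sub>2 \<one> G) ;; \<delta>"
  shows "((\<aa> F J Q)\<^sup>-\<^sup>1 \<odot>\<^sub>2 \<one> (F \<odot> G)) ;; (\<aa> (F \<odot> J) Q (F \<odot> G) ;;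
      ((\<one> (F \<odot> J) \<odot>\<^sub>2 ((\<aa> Q F G)\<^sup>-\<^sup>1 ;; (\<xi> \<odot>\<^sub>2 \<one> G) ;; \<aa> F P G))
        ;; \<aa> F J (F \<odot> (P \<odot> G))
        ;; (\<one> F \<odot>\<^sub>2 ((\<aa> J F (P \<odot> G))\<^sup>-\<^sup>1 ;; (w \<odot>\<^sub>2 \<one> (P \<odot> G)) ;; (\<aa> M P G)\<^sup>-\<^sup>1 ;; \<delta>))
        ;; (\<aa> F G Z)\<^sup>-\<^sup>1))
    = (\<aa> (F \<odot> (J \<odot> Q)) F G)\<^sup>-\<^sup>1 ;; (((\<aa> F (J \<odot> Q) F ;; (\<one> F \<odot>\<^sub>2 \<kappa>)) \<odot>\<^sub>2 \<one> G)
        ;; (\<aa> F (J \<odot> (F \<odot> P)) G ;; ((\<one> F \<odot>\<^sub>2 \<delta>') ;; (\<aa> F G Z)\<^sup>-\<^sup>1)))"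
proof -
  note simps = F G J Q P M Z \<xi> w \<delta>
  let ?t = "(\<aa> Q F G)\<^sup>-\<^sup>1 ;; ((\<xi> \<odot>\<^sub>2 \<one> G) ;; \<aa> F P G)"
  let ?s = "(\<aa> J F (P \<odot> G))\<^sup>-\<^sup>1 ;; ((w \<odot>\<^sub>2 \<one> (P \<odot> G)) ;; ((\<aa> M P G)\<^sup>-\<^sup>1 ;; \<delta>))"
  have t: "?t \<in> Arr B" "Dom B ?t = Q \<odot> (F \<odot> G)" "Cod B ?t = F \<odot> (P \<odot> G)"
    and s: "?s \<in> Arr B" "Dom B ?s = J \<odot> (F \<odot> (P \<odot> G))" "Cod B ?s = G \<odot> Z"
    and \<kappa>: "\<kappa> \<in> Arr B" "Dom B \<kappa> = (J \<odot> Q) \<odot> F" "Cod B \<kappa> = J \<odot> (F \<odot> P)"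
    and \<delta>': "\<delta>' \<in> Arr B" "Dom B \<delta>' = (J \<odot> (F \<odot> P)) \<odot> G" "Cod B \<delta>' = G \<odot> Z"
    using simps by (simp_all add: \<kappa>_def \<delta>'_def)
  have pent_left: "((\<aa> F J Q)\<^sup>-\<^sup>1 \<odot>\<^sub>2 \<one> (F \<odot> G)) ;; (\<aa> (F \<odot> J) Q (F \<odot> G) ;; \<aa> F J (Q \<odot> (F \<odot> G)))
      = \<aa> F (J \<odot> Q) (F \<odot> G) ;; (\<one> F \<odot>\<^sub>2 \<aa> J Q (F \<odot> G))"
    using simps by (simp add: pentagon[symmetric] merge)
  have pent_right: "(\<aa> (F \<odot> (J \<odot> Q)) F G)\<^sup>-\<^sup>1 ;; ((\<aa> F (J \<odot> Q) F \<odot>\<^sub>2 \<one> G) ;; \<aa> F ((J \<odot> Q) \<odot> F) G)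
      = \<aa> F (J \<odot> Q) (F \<odot> G) ;; (\<one> F \<odot>\<^sub>2 (\<aa> (J \<odot> Q) F G)\<^sup>-\<^sup>1)"
    using simps by - (rule iso_mono[of "\<one> F \<odot>\<^sub>2 \<aa> (J \<odot> Q) F G"], simp_all add: comp_assoc pentagon merge)
  have pent_J: "\<aa> J Q (F \<odot> G) ;; ((\<one> J \<odot>\<^sub>2 (\<aa> Q F G)\<^sup>-\<^sup>1) ;; (\<aa> J (Q \<odot> F) G)\<^sup>-\<^sup>1)
      = (\<aa> (J \<odot> Q) F G)\<^sup>-\<^sup>1 ;; (\<aa> J Q F \<odot>\<^sub>2 \<one> G)"
    using simps by (simp add: pentagon_left_inv)
  have pent_P: "(\<one> J \<odot>\<^sub>2 \<aa> F P G) ;; ((\<aa> J F (P \<odot> G))\<^sup>-\<^sup>1 ;; (\<aa> (J \<odot> F) P G)\<^sup>-\<^sup>1)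
      = (\<aa> J (F \<odot> P) G)\<^sup>-\<^sup>1 ;; ((\<aa> J F P)\<^sup>-\<^sup>1 \<odot>\<^sub>2 \<one> G)"
    using simps by (simp add: pentagon_inv[symmetric] merge)
  have inner: "\<aa> J Q (F \<odot> G) ;; ((\<one> J \<odot>\<^sub>2 ?t) ;; ?s) = (\<aa> (J \<odot> Q) F G)\<^sup>-\<^sup>1 ;; ((\<kappa> \<odot>\<^sub>2 \<one> G) ;; \<delta>')"
  proof -
    have "\<aa> J Q (F \<odot> G) ;; ((\<one> J \<odot>\<^sub>2 ?t) ;; ?s)
      = \<aa> J Q (F \<odot> G) ;; ((\<one> J \<odot>\<^sub>2 (\<aa> Q F G)\<^sup>-\<^sup>1) ;; ((\<one> J \<odot>\<^sub>2 (\<xi> \<odot>\<^sub>2 \<one> G)) ;;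
          (((\<one> J \<odot>\<^sub>2 \<aa> F P G) ;; ((\<aa> J F (P \<odot> G))\<^sup>-\<^sup>1 ;; (\<aa> (J \<odot> F) P G)\<^sup>-\<^sup>1)) ;; (((w \<odot>\<^sub>2 \<one> P) \<odot>\<^sub>2 \<one> G) ;; \<delta>))))"
      using simps by (simp add: whisker_left slide_Assoc_inv comp_assoc)
    also have "\<dots> = (\<aa> J Q (F \<odot> G) ;; ((\<one> J \<odot>\<^sub>2 (\<aa> Q F G)\<^sup>-\<^sup>1) ;; (\<aa> J (Q \<odot> F) G)\<^sup>-\<^sup>1)) ;;
        (((\<one> J \<odot>\<^sub>2 \<xi>) \<odot>\<^sub>2 \<one> G) ;; (((\<aa> J F P)\<^sup>-\<^sup>1 \<odot>\<^sub>2 \<one> G) ;; (((w \<odot>\<^sub>2 \<one> P) \<odot>\<^sub>2 \<one> G) ;; \<delta>)))"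
      unfolding pent_P using simps by (simp add: slide_Assoc_inv comp_assoc)
    also have "\<dots> = (\<aa> (J \<odot> Q) F G)\<^sup>-\<^sup>1 ;; ((\<kappa> \<odot>\<^sub>2 \<one> G) ;; \<delta>')"
      unfolding pent_J using simps by (simp add: \<kappa>_def \<delta>'_def whisker_right comp_assoc)
    finally show ?thesis .
  qed
  have "((\<aa> F J Q)\<^sup>-\<^sup>1 \<odot>\<^sub>2 \<one> (F \<odot> G)) ;; (\<aa> (F \<odot> J) Q (F \<odot> G) ;;
      ((\<one> (F \<odot> J) \<odot>\<^sub>2 ((\<aa> Q F G)\<^sup>-\<^sup>1 ;; (\<xi> \<odot>\<^sub>2 \<one> G) ;; \<aa> F P G))
        ;; \<aa> F J (F \<odot> (P \<odot> G))
        ;; (\<one> F \<odot>\<^sub>2 ((\<aa> J F (P \<odot> G))\<^sup>-\<^sup>1 ;; (w \<odot>\<^sub>2 \<one> (P \<odot> G)) ;; (\<aa> M P G)\<^sup>-\<^sup>1 ;; \<delta>))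
        ;; (\<aa> F G Z)\<^sup>-\<^sup>1))
    = ((\<aa> F J Q)\<^sup>-\<^sup>1 \<odot>\<^sub>2 \<one> (F \<odot> G)) ;; (\<aa> (F \<odot> J) Q (F \<odot> G) ;;
      ((\<one> (F \<odot> J) \<odot>\<^sub>2 ?t) ;; (\<aa> F J (F \<odot> (P \<odot> G)) ;; ((\<one> F \<odot>\<^sub>2 ?s) ;; (\<aa> F G Z)\<^sup>-\<^sup>1))))"
    using simps by (simp add: comp_assoc)
  also have "\<dots> = (((\<aa> F J Q)\<^sup>-\<^sup>1 \<odot>\<^sub>2 \<one> (F \<odot> G)) ;; (\<aa> (F \<odot> J) Q (F \<odot> G) ;; \<aa> F J (Q \<odot> (F \<odot> G)))) ;;
      ((\<one> F \<odot>\<^sub>2 (\<one> J \<odot>\<^sub>2 ?t)) ;; ((\<one> F \<odot>\<^sub>2 ?s) ;; (\<aa> F G Z)\<^sup>-\<^sup>1))"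
    using simps t s by (simp add: slide_Assoc comp_assoc[of _ _ "_ ;; _"])
  also have "\<dots> = \<aa> F (J \<odot> Q) (F \<odot> G) ;; ((\<one> F \<odot>\<^sub>2 (\<aa> J Q (F \<odot> G) ;; ((\<one> J \<odot>\<^sub>2 ?t) ;; ?s))) ;; (\<aa> F G Z)\<^sup>-\<^sup>1)"
    unfolding pent_left using simps t s
    by (simp add: whisker_left comp_assoc)
  also have "\<dots> = (\<aa> F (J \<odot> Q) (F \<odot> G) ;; (\<one> F \<odot>\<^sub>2 (\<aa> (J \<odot> Q) F G)\<^sup>-\<^sup>1)) ;;
      ((\<one> F \<odot>\<^sub>2 (\<kappa> \<odot>\<^sub>2 \<one> G)) ;; ((\<one> F \<odot>\<^sub>2 \<delta>') ;; (\<aa> F G Z)\<^sup>-\<^sup>1))"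
    unfolding inner using simps \<kappa> \<delta>' by (simp add: whisker_left comp_assoc)
  also have "\<dots> = (\<aa> (F \<odot> (J \<odot> Q)) F G)\<^sup>-\<^sup>1 ;; (((\<aa> F (J \<odot> Q) F ;; (\<one> F \<odot>\<^sub>2 \<kappa>)) \<odot>\<^sub>2 \<one> G)
        ;; (\<aa> F (J \<odot> (F \<odot> P)) G ;; ((\<one> F \<odot>\<^sub>2 \<delta>') ;; (\<aa> F G Z)\<^sup>-\<^sup>1)))"
    unfolding pent_right[symmetric] using simps \<kappa> \<delta>' by (simp add: whisker_right slide_Assoc comp_assoc)
  finally show ?thesis .
qed

text \<open>
  Transposing \<open>1 \<odot> \<epsilon>\<close> and evaluating again gives back the contraction of \<open>Fd\<close> against \<open>F\<close>. This is how the
  right evaluation in the pairing axiom becomes the end of the trace over \<open>F\<close>.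
\<close>

lemma dcounit_via_transpose:
  assumes "ev F Fd \<epsilon>"
    and M: "M \<in> Obj B" "src B M = trg B F" "trg B M = trg B F"
    and P: "P \<in> Obj B" "src B P = trg B F"
    and u: "u \<in> Arr B" "Dom B u = M \<odot> Fd" "Cod B u = J"
    and w: "w \<in> Arr B" "Dom B w = J \<odot> F" "Cod B w = M"
    and uw: "(u \<odot>\<^sub>2 \<one> F) ;; w = \<aa> M Fd F ;; ((\<one> M \<odot>\<^sub>2 \<epsilon>) ;; \<rr> M)"
  shows "(\<aa> M Fd (F \<odot> P))\<^sup>-\<^sup>1 ;; ((u \<odot>\<^sub>2 \<one> (F \<odot> P)) ;; ((\<aa> J F P)\<^sup>-\<^sup>1 ;; (w \<odot>\<^sub>2 \<one> P)))
    = \<one> M \<odot>\<^sub>2 dcounit F Fd \<epsilon> P"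
proof -
  note simps = assms(1) M P u w ev_simps[OF assms(1)]
  let ?U = "Unit B (trg B F)"
  have J: "J \<in> Obj B" "src B J = trg B F" "trg B J = src B F"
    using parallel_simps[OF u(1)] Cod_Obj[OF u(1)] simps by auto
  have "(\<aa> M Fd (F \<odot> P))\<^sup>-\<^sup>1 ;; ((u \<odot>\<^sub>2 \<one> (F \<odot> P)) ;; ((\<aa> J F P)\<^sup>-\<^sup>1 ;; (w \<odot>\<^sub>2 \<one> P)))
      = (\<aa> M Fd (F \<odot> P))\<^sup>-\<^sup>1 ;; ((\<aa> (M \<odot> Fd) F P)\<^sup>-\<^sup>1 ;; (((u \<odot>\<^sub>2 \<one> F) ;; w) \<odot>\<^sub>2 \<one> P))"
    using simps J by (simp add: slide_Assoc_inv whisker_right)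
  also have "\<dots> = ((\<aa> M Fd (F \<odot> P))\<^sup>-\<^sup>1 ;; ((\<aa> (M \<odot> Fd) F P)\<^sup>-\<^sup>1 ;; (\<aa> M Fd F \<odot>\<^sub>2 \<one> P))) ;;
      (((\<one> M \<odot>\<^sub>2 \<epsilon>) \<odot>\<^sub>2 \<one> P) ;; (\<rr> M \<odot>\<^sub>2 \<one> P))"
    unfolding uw using simps J by (simp add: whisker_right comp_assoc)
  also have "\<dots> = (\<one> M \<odot>\<^sub>2 (\<aa> Fd F P)\<^sup>-\<^sup>1) ;; ((\<aa> M (Fd \<odot> F) P)\<^sup>-\<^sup>1 ;;
      (((\<one> M \<odot>\<^sub>2 \<epsilon>) \<odot>\<^sub>2 \<one> P) ;; (\<aa> M ?U P ;; (\<one> M \<odot>\<^sub>2 \<ll> P))))"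
    using simps J by (simp add: pentagon_left_inv[symmetric] triangle comp_assoc)
  also have "\<dots> = \<one> M \<odot>\<^sub>2 dcounit F Fd \<epsilon> P"
    using simps J by (simp add: slide_Assoc dcounit_def whisker_left comp_assoc)
  finally show ?thesis .
qed

end

context shadow
begin

lemma Sh\<theta>_unit_inv:
  assumes "M \<in> Obj B" "src B M = R" "trg B M = R"
  shows "Sh2 \<Sigma> ((\<rr> M)\<^sup>-\<^sup>1) ;;\<^bsub>T\<^esub> Sh\<theta> \<Sigma> M (Unit B R) = Sh2 \<Sigma> ((\<ll> M)\<^sup>-\<^sup>1)"
proof -
  have R: "R \<in> Zero B" using src_closed[OF assms(1)] assms by simp
  have "Sh2 \<Sigma> ((\<rr> M)\<^sup>-\<^sup>1) ;;\<^bsub>T\<^esub> Sh\<theta> \<Sigma> M (Unit B R)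
      = Sh2 \<Sigma> ((\<rr> M)\<^sup>-\<^sup>1) ;;\<^bsub>T\<^esub> ((Sh\<theta> \<Sigma> M (Unit B R) ;;\<^bsub>T\<^esub> Sh2 \<Sigma> (\<ll> M)) ;;\<^bsub>T\<^esub> Sh2 \<Sigma> ((\<ll> M)\<^sup>-\<^sup>1))"
    using assms R by (simp add: T.comp_assoc Sh2_comp[symmetric])
  also have "\<dots> = Sh2 \<Sigma> ((\<ll> M)\<^sup>-\<^sup>1)"
    using assms R by (simp add: Sh\<theta>_unit Sh2_comp_chain)
  finally show ?thesis .
qed

text \<open>
  On the right the coevaluation stands to the left of \<open>K \<odot> Q\<close>. In a shadow it may as well be inserted to the
  right of \<open>K \<odot> Q\<close>, with \<open>Fd\<close> and \<open>F\<close> rotated to the front afterwards: the two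
  rotations combine by the hexagon, and a rotation past a unit is trivial. The left-hand side is
  the form in which the pairing axiom can be applied, because there the coevaluation acts on \<open>Q\<close> alone.
\<close>

lemma whiskered_unit_rotation:
  assumes "coev F Fd \<eta>"
    and Q: "Q \<in> Obj B" "src B Q = src B F" "trg B Q = src B F"
    and K: "K \<in> Obj B" "src B K = src B F" "trg B K = src B F"
    and e: "e \<in> Arr B" "Dom B e = Fd \<odot> K" "Cod B e = L"
    and e': "e' \<in> Arr B" "Dom B e' = F \<odot> L" "Cod B e' = N"
  defines "v \<equiv> (\<ll> K)\<^sup>-\<^sup>1 ;; ((\<eta> \<odot>\<^sub>2 \<one> K) ;; (\<aa> F Fd K ;; ((\<one> F \<odot>\<^sub>2 e) ;; e')))"
  shows "Sh2 \<Sigma> (\<one> K \<odot>\<^sub>2 dunit F Fd \<eta> Q) ;;\<^bsub>T\<^esub> (Sh2 \<Sigma> ((\<aa> K (Q \<odot> F) Fd)\<^sup>-\<^sup>1) ;;\<^bsub>T\<^esub> (Sh\<theta> \<Sigma> (K \<odot> (Q \<odot> F)) Fd ;;\<^bsub>T\<^esub>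
      (Sh2 \<Sigma> ((\<aa> Fd K (Q \<odot> F))\<^sup>-\<^sup>1 ;; (e \<odot>\<^sub>2 \<one> (Q \<odot> F))) ;;\<^bsub>T\<^esub> (Sh2 \<Sigma> ((\<aa> L Q F)\<^sup>-\<^sup>1) ;;\<^bsub>T\<^esub>
      (Sh\<theta> \<Sigma> (L \<odot> Q) F ;;\<^bsub>T\<^esub> Sh2 \<Sigma> ((\<aa> F L Q)\<^sup>-\<^sup>1 ;; (e' \<odot>\<^sub>2 \<one> Q)))))))
    = Sh2 \<Sigma> (v \<odot>\<^sub>2 \<one> Q)"
proof -
  note simps = assms(1) Q K e e' coev_simps[OF assms(1)]
  let ?U = "Unit B (src B F)"
  have L: "L \<in> Obj B" "src B L = trg B F" "trg B L = src B F"
    using parallel_simps[OF e(1)] Cod_Obj[OF e(1)] simps by auto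
  let ?post = "Sh2 \<Sigma> ((\<aa> F L Q)\<^sup>-\<^sup>1 ;; (e' \<odot>\<^sub>2 \<one> Q))"
  have "Sh2 \<Sigma> ((\<aa> Fd K (Q \<odot> F))\<^sup>-\<^sup>1 ;; (e \<odot>\<^sub>2 \<one> (Q \<odot> F))) ;;\<^bsub>T\<^esub> (Sh2 \<Sigma> ((\<aa> L Q F)\<^sup>-\<^sup>1) ;;\<^bsub>T\<^esub>
      (Sh\<theta> \<Sigma> (L \<odot> Q) F ;;\<^bsub>T\<^esub> ?post))
      = Sh2 \<Sigma> (((\<aa> Fd K (Q \<odot> F))\<^sup>-\<^sup>1 ;; (\<aa> (Fd \<odot> K) Q F)\<^sup>-\<^sup>1) ;; ((e \<odot>\<^sub>2 \<one> Q) \<odot>\<^sub>2 \<one> F)) ;;\<^bsub>T\<^esub>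
        (Sh\<theta> \<Sigma> (L \<odot> Q) F ;;\<^bsub>T\<^esub> ?post)"
    using simps L by (simp add: Sh2_comp_chain slide_Assoc_inv comp_assoc)
  also have "(\<aa> Fd K (Q \<odot> F))\<^sup>-\<^sup>1 ;; (\<aa> (Fd \<odot> K) Q F)\<^sup>-\<^sup>1
      = (\<one> Fd \<odot>\<^sub>2 (\<aa> K Q F)\<^sup>-\<^sup>1) ;; ((\<aa> Fd (K \<odot> Q) F)\<^sup>-\<^sup>1 ;; ((\<aa> Fd K Q)\<^sup>-\<^sup>1 \<odot>\<^sub>2 \<one> F))"
    using simps by (simp add: pentagon_inv)
  also have "Sh2 \<Sigma> (((\<one> Fd \<odot>\<^sub>2 (\<aa> K Q F)\<^sup>-\<^sup>1) ;; ((\<aa> Fd (K \<odot> Q) F)\<^sup>-\<^sup>1 ;; ((\<aa> Fd K Q)\<^sup>-\<^sup>1 \<odot>\<^sub>2 \<one> F))) ;; ((e \<odot>\<^sub>2 \<one> Q) \<odot>\<^sub>2 \<one> F)) ;;\<^bsub>T\<^esub>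
        (Sh\<theta> \<Sigma> (L \<odot> Q) F ;;\<^bsub>T\<^esub> ?post)
      = Sh2 \<Sigma> (\<one> Fd \<odot>\<^sub>2 (\<aa> K Q F)\<^sup>-\<^sup>1) ;;\<^bsub>T\<^esub> (Sh2 \<Sigma> ((\<aa> Fd (K \<odot> Q) F)\<^sup>-\<^sup>1) ;;\<^bsub>T\<^esub>
        (Sh2 \<Sigma> (((\<aa> Fd K Q)\<^sup>-\<^sup>1 ;; (e \<odot>\<^sub>2 \<one> Q)) \<odot>\<^sub>2 \<one> F) ;;\<^bsub>T\<^esub> (Sh\<theta> \<Sigma> (L \<odot> Q) F ;;\<^bsub>T\<^esub> ?post)))"
    using simps L by (simp add: Sh2_comp T.comp_assoc whisker_right)
  also have "\<dots> = Sh2 \<Sigma> (\<one> Fd \<odot>\<^sub>2 (\<aa> K Q F)\<^sup>-\<^sup>1) ;;\<^bsub>T\<^esub> (Sh2 \<Sigma> ((\<aa> Fd (K \<odot> Q) F)\<^sup>-\<^sup>1) ;;\<^bsub>T\<^esub>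
        (Sh\<theta> \<Sigma> (Fd \<odot> (K \<odot> Q)) F ;;\<^bsub>T\<^esub> (Sh2 \<Sigma> (\<one> F \<odot>\<^sub>2 ((\<aa> Fd K Q)\<^sup>-\<^sup>1 ;; (e \<odot>\<^sub>2 \<one> Q))) ;;\<^bsub>T\<^esub> ?post)))"
    using simps L by (simp add: Sh\<theta>_natural_chain)
  finally have right: "Sh2 \<Sigma> ((\<aa> Fd K (Q \<odot> F))\<^sup>-\<^sup>1 ;; (e \<odot>\<^sub>2 \<one> (Q \<odot> F))) ;;\<^bsub>T\<^esub> (Sh2 \<Sigma> ((\<aa> L Q F)\<^sup>-\<^sup>1) ;;\<^bsub>T\<^esub>
      (Sh\<theta> \<Sigma> (L \<odot> Q) F ;;\<^bsub>T\<^esub> ?post)) = \<dots>" .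
  let ?post' = "Sh2 \<Sigma> (\<one> F \<odot>\<^sub>2 ((\<aa> Fd K Q)\<^sup>-\<^sup>1 ;; (e \<odot>\<^sub>2 \<one> Q))) ;;\<^bsub>T\<^esub> ?post"
  have left: "(\<one> K \<odot>\<^sub>2 dunit F Fd \<eta> Q) ;; ((\<aa> K (Q \<odot> F) Fd)\<^sup>-\<^sup>1 ;; (((\<aa> K Q F)\<^sup>-\<^sup>1 \<odot>\<^sub>2 \<one> Fd) ;; \<aa> (K \<odot> Q) F Fd))
      = (\<rr> (K \<odot> Q))\<^sup>-\<^sup>1 ;; (\<one> (K \<odot> Q) \<odot>\<^sub>2 \<eta>)"
  proof -
    have "(\<one> K \<odot>\<^sub>2 dunit F Fd \<eta> Q) ;; ((\<aa> K (Q \<odot> F) Fd)\<^sup>-\<^sup>1 ;; (((\<aa> K Q F)\<^sup>-\<^sup>1 \<odot>\<^sub>2 \<one> Fd) ;; \<aa> (K \<odot> Q) F Fd))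
        = (dunit F Fd \<eta> (K \<odot> Q) ;; (\<aa> K Q F \<odot>\<^sub>2 \<one> Fd)) ;; (((\<aa> K Q F)\<^sup>-\<^sup>1 \<odot>\<^sub>2 \<one> Fd) ;; \<aa> (K \<odot> Q) F Fd)"
      using simps by (simp add: dunit_whisker comp_assoc)
    also have "\<dots> = dunit F Fd \<eta> (K \<odot> Q) ;; \<aa> (K \<odot> Q) F Fd"
      using simps by (simp add: comp_assoc merge)
    also have "\<dots> = (\<rr> (K \<odot> Q))\<^sup>-\<^sup>1 ;; (\<one> (K \<odot> Q) \<odot>\<^sub>2 \<eta>)"
      using simps by (simp add: dunit_def comp_assoc)
    finally show ?thesis .
  qed
  have "Sh2 \<Sigma> (\<one> K \<odot>\<^sub>2 dunit F Fd \<eta> Q) ;;\<^bsub>T\<^esub> (Sh2 \<Sigma> ((\<aa> K (Q \<odot> F) Fd)\<^sup>-\<^sup>1) ;;\<^bsub>T\<^esub> (Sh\<theta> \<Sigma> (K \<odot> (Q \<odot> F)) Fd ;;\<^bsub>T\<^esub>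
      (Sh2 \<Sigma> (\<one> Fd \<odot>\<^sub>2 (\<aa> K Q F)\<^sup>-\<^sup>1) ;;\<^bsub>T\<^esub> (Sh2 \<Sigma> ((\<aa> Fd (K \<odot> Q) F)\<^sup>-\<^sup>1) ;;\<^bsub>T\<^esub>
        (Sh\<theta> \<Sigma> (Fd \<odot> (K \<odot> Q)) F ;;\<^bsub>T\<^esub> ?post')))))
    = Sh2 \<Sigma> (\<one> K \<odot>\<^sub>2 dunit F Fd \<eta> Q) ;;\<^bsub>T\<^esub> (Sh2 \<Sigma> ((\<aa> K (Q \<odot> F) Fd)\<^sup>-\<^sup>1) ;;\<^bsub>T\<^esub>
      (Sh2 \<Sigma> ((\<aa> K Q F)\<^sup>-\<^sup>1 \<odot>\<^sub>2 \<one> Fd) ;;\<^bsub>T\<^esub> ((Sh\<theta> \<Sigma> ((K \<odot> Q) \<odot> F) Fd ;;\<^bsub>T\<^esub> (Sh2 \<Sigma> ((\<aa> Fd (K \<odot> Q) F)\<^sup>-\<^sup>1) ;;\<^bsub>T\<^esub>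
        Sh\<theta> \<Sigma> (Fd \<odot> (K \<odot> Q)) F)) ;;\<^bsub>T\<^esub> ?post')))"
    using simps L by (simp add: Sh\<theta>_natural_chain T.comp_assoc)
  also have "\<dots> = Sh2 \<Sigma> ((\<one> K \<odot>\<^sub>2 dunit F Fd \<eta> Q) ;; ((\<aa> K (Q \<odot> F) Fd)\<^sup>-\<^sup>1 ;;
      (((\<aa> K Q F)\<^sup>-\<^sup>1 \<odot>\<^sub>2 \<one> Fd) ;; \<aa> (K \<odot> Q) F Fd))) ;;\<^bsub>T\<^esub> (Sh\<theta> \<Sigma> (K \<odot> Q) (F \<odot> Fd) ;;\<^bsub>T\<^esub>
        (Sh2 \<Sigma> (\<aa> F Fd (K \<odot> Q)) ;;\<^bsub>T\<^esub> ?post'))"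
    using simps L by (simp add: hexagon[symmetric] Sh2_comp T.comp_assoc)
  also have "\<dots> = (Sh2 \<Sigma> ((\<rr> (K \<odot> Q))\<^sup>-\<^sup>1) ;;\<^bsub>T\<^esub> Sh\<theta> \<Sigma> (K \<odot> Q) ?U) ;;\<^bsub>T\<^esub>
      (Sh2 \<Sigma> (\<eta> \<odot>\<^sub>2 \<one> (K \<odot> Q)) ;;\<^bsub>T\<^esub> (Sh2 \<Sigma> (\<aa> F Fd (K \<odot> Q)) ;;\<^bsub>T\<^esub> ?post'))"
    unfolding left using simps L by (simp add: Sh2_comp Sh\<theta>_natural_chain T.comp_assoc)
  also have "\<dots> = Sh2 \<Sigma> ((\<ll> (K \<odot> Q))\<^sup>-\<^sup>1 ;; ((\<eta> \<odot>\<^sub>2 \<one> (K \<odot> Q)) ;; (\<aa> F Fd (K \<odot> Q) ;;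
      ((\<one> F \<odot>\<^sub>2 ((\<aa> Fd K Q)\<^sup>-\<^sup>1 ;; (e \<odot>\<^sub>2 \<one> Q))) ;; ((\<aa> F L Q)\<^sup>-\<^sup>1 ;; (e' \<odot>\<^sub>2 \<one> Q))))))"
    using simps L by (simp add: Sh\<theta>_unit_inv Sh2_comp)
  also have "(\<ll> (K \<odot> Q))\<^sup>-\<^sup>1 ;; ((\<eta> \<odot>\<^sub>2 \<one> (K \<odot> Q)) ;; (\<aa> F Fd (K \<odot> Q) ;;
      ((\<one> F \<odot>\<^sub>2 ((\<aa> Fd K Q)\<^sup>-\<^sup>1 ;; (e \<odot>\<^sub>2 \<one> Q))) ;; ((\<aa> F L Q)\<^sup>-\<^sup>1 ;; (e' \<odot>\<^sub>2 \<one> Q))))) = v \<odot>\<^sub>2 \<one> Q"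
  proof -
    have "(\<ll> (K \<odot> Q))\<^sup>-\<^sup>1 ;; ((\<eta> \<odot>\<^sub>2 \<one> (K \<odot> Q)) ;; (\<aa> F Fd (K \<odot> Q) ;;
      ((\<one> F \<odot>\<^sub>2 ((\<aa> Fd K Q)\<^sup>-\<^sup>1 ;; (e \<odot>\<^sub>2 \<one> Q))) ;; ((\<aa> F L Q)\<^sup>-\<^sup>1 ;; (e' \<odot>\<^sub>2 \<one> Q)))))
      = (\<ll> (K \<odot> Q))\<^sup>-\<^sup>1 ;; ((\<eta> \<odot>\<^sub>2 \<one> (K \<odot> Q)) ;; (\<aa> F Fd (K \<odot> Q) ;;
      (((\<one> F \<odot>\<^sub>2 (\<aa> Fd K Q)\<^sup>-\<^sup>1) ;; (\<aa> F (Fd \<odot> K) Q)\<^sup>-\<^sup>1) ;; (((\<one> F \<odot>\<^sub>2 e) \<odot>\<^sub>2 \<one> Q) ;; (e' \<odot>\<^sub>2 \<one> Q)))))"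
      using simps L by (simp add: whisker_left slide_Assoc_inv comp_assoc)
    also have "\<dots> = ((\<ll> (K \<odot> Q))\<^sup>-\<^sup>1 ;; (\<aa> ?U K Q)\<^sup>-\<^sup>1) ;; (((\<eta> \<odot>\<^sub>2 \<one> K) \<odot>\<^sub>2 \<one> Q) ;; ((\<aa> F Fd K \<odot>\<^sub>2 \<one> Q) ;;
      (((\<one> F \<odot>\<^sub>2 e) \<odot>\<^sub>2 \<one> Q) ;; (e' \<odot>\<^sub>2 \<one> Q))))"
      using simps L by (simp add: pentagon_left_inv slide_Assoc_inv comp_assoc)
    also have "\<dots> = v \<odot>\<^sub>2 \<one> Q"
      using simps L by (simp add: Lunit_HComp_inv v_def whisker_right)
    finally show ?thesis .
  qed
  finally show ?thesis unfolding right .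
qed

text \<open>
  What is left of the theorem after the pairing has been used; it concerns a single shadow.
  The 2-cells \<open>g\<close>, \<open>e\<close> and \<open>w\<close> stand for \<open>\<gamma>\<close> and the two evaluations, and \<open>u\<close> for the transpose from the
  first part of the cotrace. The hypothesis replaces the 2-cell traced over \<open>F \<odot> G\<close> by one
  whose trace over \<open>F\<close> is that of a 2-cell \<open>F \<odot> \<kappa>\<close>, so this
  trace, preceded by a rotation, is the value of the shadow at \<open>\<kappa>\<close>.
\<close>

lemma trace_exchange:
  assumes F: "dual_pair B F Fd \<eta>F \<epsilon>F" and G: "dual_pair B G Gd \<eta>G \<epsilon>G" "src B G = trg B F"
    and Q: "Q \<in> Obj B" "src B Q = src B F" "trg B Q = src B F"
    and P: "P \<in> Obj B" "src B P = trg B F" "trg B P = trg B F"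
    and M: "M \<in> Obj B" "src B M = trg B F" "trg B M = trg B F"
    and Z: "Z \<in> Obj B" "src B Z = trg B G" "trg B Z = trg B G"
    and \<xi>: "\<xi> \<in> Arr B" "Dom B \<xi> = Q \<odot> F" "Cod B \<xi> = F \<odot> P"
    and u: "u \<in> Arr B" "Dom B u = M \<odot> Fd" "Cod B u = J"
    and g: "g \<in> Arr B" "Dom B g = J" "Cod B g = L"
    and e: "e \<in> Arr B" "Dom B e = F \<odot> L" "Cod B e = N"
    and w: "w \<in> Arr B" "Dom B w = J \<odot> F" "Cod B w = M"
    and \<zeta>: "\<zeta> \<in> Arr B" "Dom B \<zeta> = (N \<odot> Q) \<odot> (F \<odot> G)" "Cod B \<zeta> = (F \<odot> G) \<odot> Z"
    and \<delta>: "\<delta> \<in> Arr B" "Dom B \<delta> = (M \<odot> P) \<odot> G" "Cod B \<delta> = G \<odot> Z"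
    and uw: "(u \<odot>\<^sub>2 \<one> F) ;; w = \<aa> M Fd F ;; ((\<one> M \<odot>\<^sub>2 \<epsilon>F) ;; \<rr> M)"
    and square: "((\<one> F \<odot>\<^sub>2 g) \<odot>\<^sub>2 \<one> (Q \<odot> (F \<odot> G)))
          ;; (e \<odot>\<^sub>2 \<one> (Q \<odot> (F \<odot> G)))
          ;; (\<aa> N Q (F \<odot> G))\<^sup>-\<^sup>1
          ;; \<zeta>
        = (\<one> (F \<odot> J) \<odot>\<^sub>2 ((\<aa> Q F G)\<^sup>-\<^sup>1 ;; (\<xi> \<odot>\<^sub>2 \<one> G) ;; \<aa> F P G))
          ;; \<aa> F J (F \<odot> (P \<odot> G))
          ;; (\<one> F \<odot>\<^sub>2 ((\<aa> J F (P \<odot> G))\<^sup>-\<^sup>1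
                ;; (w \<odot>\<^sub>2 \<one> (P \<odot> G))
                ;; (\<aa> M P G)\<^sup>-\<^sup>1
                ;; \<delta>))
          ;; (\<aa> F G Z)\<^sup>-\<^sup>1"
  shows "Sh2 \<Sigma> ((\<aa> M Fd (Q \<odot> F))\<^sup>-\<^sup>1 ;; ((u ;; g) \<odot>\<^sub>2 \<one> (Q \<odot> F))) ;;\<^bsub>T\<^esub>
      (Sh2 \<Sigma> ((\<aa> L Q F)\<^sup>-\<^sup>1) ;;\<^bsub>T\<^esub> (Sh\<theta> \<Sigma> (L \<odot> Q) F ;;\<^bsub>T\<^esub> (Sh2 \<Sigma> ((\<aa> F L Q)\<^sup>-\<^sup>1 ;; (e \<odot>\<^sub>2 \<one> Q)) ;;\<^bsub>T\<^esub>
        trace B T \<Sigma> (F \<odot> G) (Gd \<odot> Fd)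
          (comp_unit B F Fd \<eta>F G Gd \<eta>G) (comp_counit B F Fd \<epsilon>F G Gd \<epsilon>G) (N \<odot> Q) Z \<zeta>)))
    = Sh2 \<Sigma> (\<one> M \<odot>\<^sub>2 ((\<one> Fd \<odot>\<^sub>2 \<xi>) ;; dcounit F Fd \<epsilon>F P)) ;;\<^bsub>T\<^esub> trace B T \<Sigma> G Gd \<eta>G \<epsilon>G (M \<odot> P) Z \<delta>"
proof -
  interpret F: dual_pair B F Fd \<eta>F \<epsilon>F by fact
  interpret G: dual_pair B G Gd \<eta>G \<epsilon>G by fact
  note simps = G(2) Q P M Z \<xi> u g e w \<zeta> \<delta> F.is_coev F.is_ev G.is_coev G.is_ev
    coev_simps[OF F.is_coev] ev_simps[OF F.is_ev] coev_simps[OF G.is_coev] ev_simps[OF G.is_ev]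
  have J: "J \<in> Obj B" "src B J = trg B F" "trg B J = src B F"
    using parallel_simps[OF u(1)] Cod_Obj[OF u(1)] simps by auto
  have L: "L \<in> Obj B" "src B L = trg B F" "trg B L = src B F"
    using parallel_simps[OF g(1)] Cod_Obj[OF g(1)] simps J by auto
  have N: "N \<in> Obj B" "src B N = src B F" "trg B N = src B F"
    using parallel_simps[OF e(1)] Cod_Obj[OF e(1)] simps L by auto
  let ?\<eta> = "comp_unit B F Fd \<eta>F G Gd \<eta>G" and ?\<epsilon> = "comp_counit B F Fd \<epsilon>F G Gd \<epsilon>G"
  let ?tr = "trace B T \<Sigma> (F \<odot> G) (Gd \<odot> Fd) ?\<eta> ?\<epsilon>" and ?trG = "trace B T \<Sigma> G Gd \<eta>G \<epsilon>G"
  have FG: "coev (F \<odot> G) (Gd \<odot> Fd) ?\<eta>" "ev (F \<odot> G) (Gd \<odot> Fd) ?\<epsilon>"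
    using simps by (simp_all add: coev_comp ev_comp)
  define \<kappa> where "\<kappa> = \<aa> J Q F ;; (\<one> J \<odot>\<^sub>2 \<xi>)"
  define \<beta> where "\<beta> = (\<aa> J F P)\<^sup>-\<^sup>1 ;; (w \<odot>\<^sub>2 \<one> P)"
  define \<delta>' where "\<delta>' = (\<beta> \<odot>\<^sub>2 \<one> G) ;; \<delta>"
  define \<pi> where "\<pi> = (\<aa> F J Q)\<^sup>-\<^sup>1 ;; (((\<one> F \<odot>\<^sub>2 g) ;; e) \<odot>\<^sub>2 \<one> Q)"
  have \<kappa>: "\<kappa> \<in> Arr B" "Dom B \<kappa> = (J \<odot> Q) \<odot> F" "Cod B \<kappa> = J \<odot> (F \<odot> P)"
    and \<beta>: "\<beta> \<in> Arr B" "Dom B \<beta> = J \<odot> (F \<odot> P)" "Cod B \<beta> = M \<odot> P"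
    and \<pi>: "\<pi> \<in> Arr B" "Dom B \<pi> = F \<odot> (J \<odot> Q)" "Cod B \<pi> = N \<odot> Q"
    using simps J L N by (simp_all add: \<kappa>_def \<beta>_def \<pi>_def)
  have \<delta>': "\<delta>' \<in> Arr B" "Dom B \<delta>' = (J \<odot> (F \<odot> P)) \<odot> G" "Cod B \<delta>' = G \<odot> Z"
    using simps J \<beta> by (simp_all add: \<delta>'_def)
  have \<phi>: "\<aa> F (J \<odot> Q) F ;; (\<one> F \<odot>\<^sub>2 \<kappa>) \<in> Arr B"
    "Dom B (\<aa> F (J \<odot> Q) F ;; (\<one> F \<odot>\<^sub>2 \<kappa>)) = (F \<odot> (J \<odot> Q)) \<odot> F"
    "Cod B (\<aa> F (J \<odot> Q) F ;; (\<one> F \<odot>\<^sub>2 \<kappa>)) = F \<odot> (J \<odot> (F \<odot> P))"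
    using simps J \<kappa> by simp_all
  \<comment> \<open>The compatibility hypothesis enters here.\<close>
  have integrand: "(\<pi> \<odot>\<^sub>2 \<one> (F \<odot> G)) ;; \<zeta>
      = (\<aa> (F \<odot> (J \<odot> Q)) F G)\<^sup>-\<^sup>1 ;; (((\<aa> F (J \<odot> Q) F ;; (\<one> F \<odot>\<^sub>2 \<kappa>)) \<odot>\<^sub>2 \<one> G)
        ;; (\<aa> F (J \<odot> (F \<odot> P)) G ;; ((\<one> F \<odot>\<^sub>2 \<delta>') ;; (\<aa> F G Z)\<^sup>-\<^sup>1)))"
  proof -
    have "(\<pi> \<odot>\<^sub>2 \<one> (F \<odot> G)) ;; \<zeta> = ((\<aa> F J Q)\<^sup>-\<^sup>1 \<odot>\<^sub>2 \<one> (F \<odot> G)) ;; (((((\<one> F \<odot>\<^sub>2 g) ;; e) \<odot>\<^sub>2 \<one> Q) \<odot>\<^sub>2 \<one> (F \<odot> G)) ;; \<zeta>)"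
      using simps J L N by (simp add: \<pi>_def whisker_right comp_assoc)
    also have "(((((\<one> F \<odot>\<^sub>2 g) ;; e) \<odot>\<^sub>2 \<one> Q) \<odot>\<^sub>2 \<one> (F \<odot> G)) ;; \<zeta>)
      = (((((\<one> F \<odot>\<^sub>2 g) ;; e) \<odot>\<^sub>2 \<one> Q) \<odot>\<^sub>2 \<one> (F \<odot> G)) ;; \<aa> N Q (F \<odot> G)) ;; ((\<aa> N Q (F \<odot> G))\<^sup>-\<^sup>1 ;; \<zeta>)"
      using simps J L N by (simp add: comp_assoc)
    also have "\<dots> = \<aa> (F \<odot> J) Q (F \<odot> G) ;; (((\<one> F \<odot>\<^sub>2 g) \<odot>\<^sub>2 \<one> (Q \<odot> (F \<odot> G)))
          ;; (e \<odot>\<^sub>2 \<one> (Q \<odot> (F \<odot> G)))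
          ;; (\<aa> N Q (F \<odot> G))\<^sup>-\<^sup>1
          ;; \<zeta>)"
      using simps J L N by (simp add: slide_Assoc whisker_right comp_assoc)
    finally show ?thesis
      unfolding square \<kappa>_def \<delta>'_def \<beta>_def
      using compatibility_regrouped[of F G J Q P M Z \<xi> w \<delta>] simps J by simp
  qed
  have "Sh2 \<Sigma> ((\<aa> M Fd (Q \<odot> F))\<^sup>-\<^sup>1 ;; ((u ;; g) \<odot>\<^sub>2 \<one> (Q \<odot> F))) ;;\<^bsub>T\<^esub>
      (Sh2 \<Sigma> ((\<aa> L Q F)\<^sup>-\<^sup>1) ;;\<^bsub>T\<^esub> (Sh\<theta> \<Sigma> (L \<odot> Q) F ;;\<^bsub>T\<^esub> (Sh2 \<Sigma> ((\<aa> F L Q)\<^sup>-\<^sup>1 ;; (e \<odot>\<^sub>2 \<one> Q)) ;;\<^bsub>T\<^esub> ?tr (N \<odot> Q) Z \<zeta>)))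
    = Sh2 \<Sigma> ((\<aa> M Fd (Q \<odot> F))\<^sup>-\<^sup>1 ;; ((u \<odot>\<^sub>2 \<one> (Q \<odot> F)) ;; (\<aa> J Q F)\<^sup>-\<^sup>1)) ;;\<^bsub>T\<^esub> (Sh2 \<Sigma> ((g \<odot>\<^sub>2 \<one> Q) \<odot>\<^sub>2 \<one> F) ;;\<^bsub>T\<^esub>
      (Sh\<theta> \<Sigma> (L \<odot> Q) F ;;\<^bsub>T\<^esub> (Sh2 \<Sigma> ((\<aa> F L Q)\<^sup>-\<^sup>1 ;; (e \<odot>\<^sub>2 \<one> Q)) ;;\<^bsub>T\<^esub> ?tr (N \<odot> Q) Z \<zeta>)))"
    using simps J L N FG by (simp add: Sh2_comp_chain trace_simps whisker_right slide_Assoc_inv comp_assoc)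
  also have "\<dots> = Sh2 \<Sigma> ((\<aa> M Fd (Q \<odot> F))\<^sup>-\<^sup>1 ;; ((u \<odot>\<^sub>2 \<one> (Q \<odot> F)) ;; (\<aa> J Q F)\<^sup>-\<^sup>1)) ;;\<^bsub>T\<^esub>
      (Sh\<theta> \<Sigma> (J \<odot> Q) F ;;\<^bsub>T\<^esub> (Sh2 \<Sigma> \<pi> ;;\<^bsub>T\<^esub> ?tr (N \<odot> Q) Z \<zeta>))"
    using simps J L N FG
    by (simp add: Sh\<theta>_natural_chain Sh2_comp_chain trace_simps whisker_right slide_Assoc_inv comp_assoc \<pi>_def)
  also have "Sh2 \<Sigma> \<pi> ;;\<^bsub>T\<^esub> ?tr (N \<odot> Q) Z \<zeta> = ?tr (F \<odot> (J \<odot> Q)) Z ((\<pi> \<odot>\<^sub>2 \<one> (F \<odot> G)) ;; \<zeta>)"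
    using simps J L N FG \<pi> by (simp add: trace_natural)
  also have "\<dots> = trace B T \<Sigma> F Fd \<eta>F \<epsilon>F (F \<odot> (J \<odot> Q)) (J \<odot> (F \<odot> P)) (\<aa> F (J \<odot> Q) F ;; (\<one> F \<odot>\<^sub>2 \<kappa>))
      ;;\<^bsub>T\<^esub> ?trG (J \<odot> (F \<odot> P)) Z \<delta>'"
    unfolding integrand using simps J \<phi> \<delta>' by (intro trace_comp) simp_all
  also have "?trG (J \<odot> (F \<odot> P)) Z \<delta>' = Sh2 \<Sigma> \<beta> ;;\<^bsub>T\<^esub> ?trG (M \<odot> P) Z \<delta>"
    using simps J \<beta> by (simp add: trace_natural \<delta>'_def)
  also have "Sh\<theta> \<Sigma> (J \<odot> Q) F ;;\<^bsub>T\<^esub> (trace B T \<Sigma> F Fd \<eta>F \<epsilon>F (F \<odot> (J \<odot> Q)) (J \<odot> (F \<odot> P)) (\<aa> F (J \<odot> Q) F ;; (\<one> F \<odot>\<^sub>2 \<kappa>))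
      ;;\<^bsub>T\<^esub> (Sh2 \<Sigma> \<beta> ;;\<^bsub>T\<^esub> ?trG (M \<odot> P) Z \<delta>))
      = (Sh\<theta> \<Sigma> (J \<odot> Q) F ;;\<^bsub>T\<^esub> trace B T \<Sigma> F Fd \<eta>F \<epsilon>F (F \<odot> (J \<odot> Q)) (J \<odot> (F \<odot> P)) (\<aa> F (J \<odot> Q) F ;; (\<one> F \<odot>\<^sub>2 \<kappa>)))
      ;;\<^bsub>T\<^esub> (Sh2 \<Sigma> \<beta> ;;\<^bsub>T\<^esub> ?trG (M \<odot> P) Z \<delta>)"
    using simps J \<phi> \<beta> by (simp add: trace_simps T.comp_assoc[of _ _ "_ ;;\<^bsub>T\<^esub> _"])
  also have "Sh\<theta> \<Sigma> (J \<odot> Q) F ;;\<^bsub>T\<^esub> trace B T \<Sigma> F Fd \<eta>F \<epsilon>F (F \<odot> (J \<odot> Q)) (J \<odot> (F \<odot> P)) (\<aa> F (J \<odot> Q) F ;; (\<one> F \<odot>\<^sub>2 \<kappa>))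
      = Sh2 \<Sigma> \<kappa>"
    by (rule trace_cyclic) (use F simps J \<kappa> in simp_all)
  also have "Sh2 \<Sigma> ((\<aa> M Fd (Q \<odot> F))\<^sup>-\<^sup>1 ;; ((u \<odot>\<^sub>2 \<one> (Q \<odot> F)) ;; (\<aa> J Q F)\<^sup>-\<^sup>1)) ;;\<^bsub>T\<^esub>
      (Sh2 \<Sigma> \<kappa> ;;\<^bsub>T\<^esub> (Sh2 \<Sigma> \<beta> ;;\<^bsub>T\<^esub> ?trG (M \<odot> P) Z \<delta>))
    = Sh2 \<Sigma> ((\<aa> M Fd (Q \<odot> F))\<^sup>-\<^sup>1 ;; ((u \<odot>\<^sub>2 \<one> (Q \<odot> F)) ;; ((\<one> J \<odot>\<^sub>2 \<xi>) ;; \<beta>))) ;;\<^bsub>T\<^esub> ?trG (M \<odot> P) Z \<delta>"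
    using simps J \<kappa> \<beta> by (simp add: Sh2_comp_chain trace_simps comp_assoc) (simp add: \<kappa>_def comp_assoc)
  also have "(\<aa> M Fd (Q \<odot> F))\<^sup>-\<^sup>1 ;; ((u \<odot>\<^sub>2 \<one> (Q \<odot> F)) ;; ((\<one> J \<odot>\<^sub>2 \<xi>) ;; \<beta>))
      = \<one> M \<odot>\<^sub>2 ((\<one> Fd \<odot>\<^sub>2 \<xi>) ;; dcounit F Fd \<epsilon>F P)"
  proof -
    have "(\<aa> M Fd (Q \<odot> F))\<^sup>-\<^sup>1 ;; ((u \<odot>\<^sub>2 \<one> (Q \<odot> F)) ;; ((\<one> J \<odot>\<^sub>2 \<xi>) ;; \<beta>))
      = (\<aa> M Fd (Q \<odot> F))\<^sup>-\<^sup>1 ;; ((\<one> (M \<odot> Fd) \<odot>\<^sub>2 \<xi>) ;; ((u \<odot>\<^sub>2 \<one> (F \<odot> P)) ;; \<beta>))"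
      using simps J \<beta> by (simp add: interchange_chain)
    also have "\<dots> = (\<one> M \<odot>\<^sub>2 (\<one> Fd \<odot>\<^sub>2 \<xi>)) ;; ((\<aa> M Fd (F \<odot> P))\<^sup>-\<^sup>1 ;; ((u \<odot>\<^sub>2 \<one> (F \<odot> P)) ;; \<beta>))"
      using simps J \<beta> by (simp add: slide_Assoc_inv)
    also have "(\<aa> M Fd (F \<odot> P))\<^sup>-\<^sup>1 ;; ((u \<odot>\<^sub>2 \<one> (F \<odot> P)) ;; \<beta>) = \<one> M \<odot>\<^sub>2 dcounit F Fd \<epsilon>F P"
      unfolding \<beta>_def using simps uw by (intro dcounit_via_transpose) simp_all
    finally show ?thesis using simps by (simp add: whisker_left)
  qed
  finally show ?thesis .
qed

end

section \<open>Pairing a coshadow with a shadow\<close>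

context coshadow
begin

lemma Csh_simps [simp]:
  assumes "M \<in> Obj B" "src B M = trg B M"
  shows "Csh \<Gamma> M \<in> Obj T" "Csh2 \<Gamma> (\<one> M) = \<one>\<^bsub>T\<^esub> (Csh \<Gamma> M)"
  using Csh_functor[of "trg B M"] assms by (auto simp: is_functor_def hcat_simps cells_def)

lemma Csh2_simps [simp]:
  assumes "f \<in> Arr B" "src B (Dom B f) = trg B (Dom B f)"
  shows "Csh2 \<Gamma> f \<in> Arr T" "Dom T (Csh2 \<Gamma> f) = Csh \<Gamma> (Dom B f)" "Cod T (Csh2 \<Gamma> f) = Csh \<Gamma> (Cod B f)"
  using Csh_functor[of "trg B (Dom B f)"] assms
  by (auto simp: is_functor_def hcat_simps T.hom_iff)

lemma Csh\<theta>_simps [simp]: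
  assumes "M \<in> Obj B" "N \<in> Obj B" "src B M = src B N" "trg B M = trg B N"
  shows "iso T (Csh\<theta> \<Gamma> M N)" "Csh\<theta> \<Gamma> M N \<in> Arr T"
    "Dom T (Csh\<theta> \<Gamma> M N) = Csh \<Gamma> (M \<triangleright> N)" "Cod T (Csh\<theta> \<Gamma> M N) = Csh \<Gamma> (N \<triangleleft> M)"
  using Csh\<theta>_nat_iso[of "src B N" "trg B N"] assms
  by (auto simp: nat_iso_def nat_trans_def prod_cat_def op_cat_def hcat_simps cells_def T.hom_iff)

end

context monoidal_category
begin

lemma Tens2_simps [simp]:
  assumes "f \<in> Arr T" "g \<in> Arr T"
  shows "f \<otimes>\<^sub>2 g \<in> Arr T" "Dom T (f \<otimes>\<^sub>2 g) = Dom T f \<otimes> Dom T g" "Cod T (f \<otimes>\<^sub>2 g) = Cod T f \<otimes> Cod T g"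
  using Tens_functor assms by (auto simp: is_functor_def prod_cat_def hom_iff)

lemma Tens2_comp:
  assumes "f \<in> Arr T" "g \<in> Arr T" "f' \<in> Arr T" "g' \<in> Arr T" "Cod T f = Dom T f'" "Cod T g = Dom T g'"
  shows "(f \<otimes>\<^sub>2 g) ;; (f' \<otimes>\<^sub>2 g') = (f ;; f') \<otimes>\<^sub>2 (g ;; g')"
  using Tens_functor assms by (auto simp: is_functor_def prod_cat_def)

lemma Tens2_comp_chain:
  assumes "f \<in> Arr T" "g \<in> Arr T" "f' \<in> Arr T" "g' \<in> Arr T" "Cod T f = Dom T f'" "Cod T g = Dom T g'"
    and "k \<in> Arr T" "Dom T k = Cod T f' \<otimes> Cod T g'"
  shows "(f \<otimes>\<^sub>2 g) ;; ((f' \<otimes>\<^sub>2 g') ;; k) = ((f ;; f') \<otimes>\<^sub>2 (g ;; g')) ;; k"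
  using assms by (simp add: Tens2_comp[symmetric] comp_assoc)

end

context pairing
begin

lemma \<rho>_simps [simp]:
  assumes "M \<in> Obj B" "N \<in> Obj B" "src B M = trg B M" "src B N = trg B N" "trg B M = trg B N"
  shows "\<rho> M N \<in> Arr T" "Dom T (\<rho> M N) = Csh \<Gamma> M \<otimes>\<^bsub>T\<^esub> Sh \<Sigma>2 N" "Cod T (\<rho> M N) = Sh \<Sigma>1 (M \<odot> N)"
  using pairing_natural[of "trg B N"] assms
  by (auto simp: nat_trans_def prod_cat_def hcat_simps cells_def T.hom_iff)

lemma \<rho>_natural:
  assumes "f \<in> Arr B" "g \<in> Arr B" "src B (Dom B f) = R" "trg B (Dom B f) = R"
    "src B (Dom B g) = R" "trg B (Dom B g) = R" "Cod B f = M'" "Cod B g = N'"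
  shows "(Csh2 \<Gamma> f \<otimes>\<^sub>2\<^bsub>T\<^esub> Sh2 \<Sigma>2 g) ;;\<^bsub>T\<^esub> \<rho> M' N' = \<rho> (Dom B f) (Dom B g) ;;\<^bsub>T\<^esub> Sh2 \<Sigma>1 (f \<odot>\<^sub>2 g)"
proof -
  have "R \<in> Zero B" using src_closed[OF Dom_Obj[OF assms(1)]] assms by simp
  then show ?thesis
    using pairing_natural[of R] assms
    by (auto simp: nat_trans_def prod_cat_def hcat_simps cells_def)
qed

lemma \<rho>_natural_left:
  assumes "f \<in> Arr B" "N \<in> Obj B" "src B (Dom B f) = R" "trg B (Dom B f) = R"
    "src B N = R" "trg B N = R" "Cod B f = M'"
  shows "(Csh2 \<Gamma> f \<otimes>\<^sub>2\<^bsub>T\<^esub> \<one>\<^bsub>T\<^esub> (Sh \<Sigma>2 N)) ;;\<^bsub>T\<^esub> \<rho> M' N = \<rho> (Dom B f) N ;;\<^bsub>T\<^esub> Sh2 \<Sigma>1 (f \<odot>\<^sub>2 \<one> N)"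
  using \<rho>_natural[of f "\<one> N" R M' N] assms by simp

lemma \<rho>_natural_right:
  assumes "M \<in> Obj B" "g \<in> Arr B" "src B M = R" "trg B M = R"
    "src B (Dom B g) = R" "trg B (Dom B g) = R" "Cod B g = N'"
  shows "(\<one>\<^bsub>T\<^esub> (Csh \<Gamma> M) \<otimes>\<^sub>2\<^bsub>T\<^esub> Sh2 \<Sigma>2 g) ;;\<^bsub>T\<^esub> \<rho> M N' = \<rho> M (Dom B g) ;;\<^bsub>T\<^esub> Sh2 \<Sigma>1 (\<one> M \<odot>\<^sub>2 g)"
  using \<rho>_natural[of "\<one> M" g R M N'] assms by simp

lemma \<rho>_cyclic:
  assumes "X \<in> Obj B" "Z \<in> Obj B" "Y \<in> Obj B"
    and "src B Z = src B X" "trg B Z = trg B X" "src B Y = trg B X" "trg B Y = src B X"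
  shows "\<rho> (Z \<triangleleft> X) (Y \<odot> X)
        ;;\<^bsub>T\<^esub> (Sh2 \<Sigma>1 ((\<aa> (Z \<triangleleft> X) Y X)\<^sup>-\<^sup>1)
        ;;\<^bsub>T\<^esub> (Sh\<theta> \<Sigma>1 ((Z \<triangleleft> X) \<odot> Y) X
        ;;\<^bsub>T\<^esub> Sh2 \<Sigma>1 ((\<aa> X (Z \<triangleleft> X) Y)\<^sup>-\<^sup>1 ;; (evL B X Z \<odot>\<^sub>2 \<one> Y))))
    = ((Csh\<theta> \<Gamma> X Z)\<^sup>-\<^sup>1\<^bsub>T\<^esub> \<otimes>\<^sub>2\<^bsub>T\<^esub> Sh\<theta> \<Sigma>2 Y X)
        ;;\<^bsub>T\<^esub> (\<rho> (X \<triangleright> Z) (X \<odot> Y)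
        ;;\<^bsub>T\<^esub> Sh2 \<Sigma>1 ((\<aa> (X \<triangleright> Z) X Y)\<^sup>-\<^sup>1 ;; (evR B X Z \<odot>\<^sub>2 \<one> Y)))"
  using pairing_cyclic[of X "src B X" "trg B X" Z Y] assms
  by (simp add: cells_def T.comp_assoc)

text \<open>
  A cotrace followed by the pairing, rewritten so that the argument of the coshadow stays untouched
  and that of the shadow is treated by the first half of a trace over \<open>F\<close>. The coevaluation at the
  end of the cotrace acts on the argument of the coshadow; naturality of the pairing moves it to the common
  target, the rotation lemma makes it act on \<open>Q\<close>, and the pairing axiom for \<open>Fd\<close> cancels
  the \<open>\<theta>\<close> of the cotrace while producing the \<open>\<theta>\<close> of the trace.
\<close>

lemma cotrace_pairing:
  assumes F: "dual_pair B F Fd \<eta> \<epsilon>"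
    and M: "M \<in> Obj B" "src B M = trg B F" "trg B M = trg B F"
    and N: "N \<in> Obj B" "src B N = src B F" "trg B N = src B F"
    and Q: "Q \<in> Obj B" "src B Q = src B F" "trg B Q = src B F"
    and \<gamma>: "\<gamma> \<in> Arr B" "Dom B \<gamma> = F \<triangleright> M" "Cod B \<gamma> = N \<triangleleft> F"
  defines "u \<equiv> ((rbar B M ;; (\<epsilon> \<triangleright>\<^sub>2 \<one> M) ;; tR B Fd F M) \<odot>\<^sub>2 \<one> Fd) ;; evR B Fd (F \<triangleright> M)"
    and "L \<equiv> N \<triangleleft> F"
  shows "(cotrace B T \<Gamma> F Fd \<eta> \<epsilon> M N \<gamma> \<otimes>\<^sub>2\<^bsub>T\<^esub> \<one>\<^bsub>T\<^esub> (Sh \<Sigma>2 Q)) ;;\<^bsub>T\<^esub> \<rho> N Q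
    = (\<one>\<^bsub>T\<^esub> (Csh \<Gamma> M) \<otimes>\<^sub>2\<^bsub>T\<^esub> (Sh2 \<Sigma>2 (dunit F Fd \<eta> Q) ;;\<^bsub>T\<^esub> Sh\<theta> \<Sigma>2 (Q \<odot> F) Fd)) ;;\<^bsub>T\<^esub>
      (\<rho> M (Fd \<odot> (Q \<odot> F)) ;;\<^bsub>T\<^esub>
      (Sh2 \<Sigma>1 ((\<aa> M Fd (Q \<odot> F))\<^sup>-\<^sup>1 ;; ((u ;; \<gamma>) \<odot>\<^sub>2 \<one> (Q \<odot> F))) ;;\<^bsub>T\<^esub> (Sh2 \<Sigma>1 ((\<aa> L Q F)\<^sup>-\<^sup>1) ;;\<^bsub>T\<^esub>
      (Sh\<theta> \<Sigma>1 (L \<odot> Q) F ;;\<^bsub>T\<^esub> Sh2 \<Sigma>1 ((\<aa> F L Q)\<^sup>-\<^sup>1 ;; (evL B F N \<odot>\<^sub>2 \<one> Q))))))"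
proof -
  interpret F: dual_pair B F Fd \<eta> \<epsilon> by fact
  note simps = M N Q \<gamma>(1,2) \<gamma>(3)[folded L_def] F.is_coev F.is_ev coev_simps[OF F.is_coev] ev_simps[OF F.is_ev]
  define c where "c = rbar B M ;; (\<epsilon> \<triangleright>\<^sub>2 \<one> M) ;; tR B Fd F M"
  define K where "K = L \<triangleleft> Fd"
  define v where "v = (\<ll> K)\<^sup>-\<^sup>1 ;; ((\<eta> \<odot>\<^sub>2 \<one> K) ;; (\<aa> F Fd K ;; ((\<one> F \<odot>\<^sub>2 evL B Fd L) ;; evL B F N)))"
  have L: "L \<in> Obj B" "src B L = trg B F" "trg B L = src B F"
    and eL: "evL B F N \<in> Arr B" "Dom B (evL B F N) = F \<odot> L" "Cod B (evL B F N) = N"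
    using simps by (simp_all add: L_def)
  have K: "K \<in> Obj B" "src B K = src B F" "trg B K = src B F"
    and eK: "evL B Fd L \<in> Arr B" "Dom B (evL B Fd L) = Fd \<odot> K" "Cod B (evL B Fd L) = L"
    using simps L by (simp_all add: K_def)
  have v: "v \<in> Arr B" "Dom B v = K" "Cod B v = N"
    using simps L K eL eK by (simp_all add: v_def)
  have c: "c \<in> Arr B" "Dom B c = M" "Cod B c = Fd \<triangleright> (F \<triangleright> M)"
    using cotrace_entry(1)[OF F.is_ev, of M] simps by (simp_all add: c_def hom_iff)
  let ?cg = "c ;; (\<one> Fd \<triangleright>\<^sub>2 \<gamma>)"
  have cg: "?cg \<in> Arr B" "Dom B ?cg = M" "Cod B ?cg = Fd \<triangleright> L"
    using simps c L by simp_all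
  have cotrace: "cotrace B T \<Gamma> F Fd \<eta> \<epsilon> M N \<gamma> = Csh2 \<Gamma> ?cg ;;\<^bsub>T\<^esub> (Csh\<theta> \<Gamma> Fd L ;;\<^bsub>T\<^esub> Csh2 \<Gamma> v)"
  proof -
    have "(tL B F Fd N)\<^sup>-\<^sup>1 ;; (\<one> N \<triangleleft>\<^sub>2 \<eta>) ;; (lbar B N)\<^sup>-\<^sup>1 = v"
      using cotrace_exit[OF F.is_coev, of N] simps unfolding v_def K_def L_def by simp
    then have "cotrace B T \<Gamma> F Fd \<eta> \<epsilon> M N \<gamma> = Csh2 \<Gamma> ?cg ;;\<^bsub>T\<^esub> Csh\<theta> \<Gamma> Fd L ;;\<^bsub>T\<^esub> Csh2 \<Gamma> v"
      by (simp add: cotrace_def c_def L_def)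
    then show ?thesis
      using simps cg L K v by (simp add: T.comp_assoc K_def)
  qed
  let ?d = "dunit F Fd \<eta> Q"
  let ?rest = "Sh2 \<Sigma>1 ((\<aa> L Q F)\<^sup>-\<^sup>1) ;;\<^bsub>T\<^esub>
      (Sh\<theta> \<Sigma>1 (L \<odot> Q) F ;;\<^bsub>T\<^esub> Sh2 \<Sigma>1 ((\<aa> F L Q)\<^sup>-\<^sup>1 ;; (evL B F N \<odot>\<^sub>2 \<one> Q)))"
  have rest: "?rest \<in> Arr T" "Dom T ?rest = Sh \<Sigma>1 (L \<odot> (Q \<odot> F))"
    using simps L eL by simp_all
  define r where "r = ?rest"
  have r: "r \<in> Arr T" "Dom T r = Sh \<Sigma>1 (L \<odot> (Q \<odot> F))"
    unfolding r_def by (fact rest)+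
  let ?oneQ = "\<one>\<^bsub>T\<^esub> (Sh \<Sigma>2 Q)"
  let ?ev = "Sh2 \<Sigma>1 ((\<aa> (Fd \<triangleright> L) Fd (Q \<odot> F))\<^sup>-\<^sup>1 ;; (evR B Fd L \<odot>\<^sub>2 \<one> (Q \<odot> F)))"
  have "(cotrace B T \<Gamma> F Fd \<eta> \<epsilon> M N \<gamma> \<otimes>\<^sub>2\<^bsub>T\<^esub> ?oneQ) ;;\<^bsub>T\<^esub> \<rho> N Q
      = (Csh2 \<Gamma> ?cg \<otimes>\<^sub>2\<^bsub>T\<^esub> ?oneQ) ;;\<^bsub>T\<^esub> ((Csh\<theta> \<Gamma> Fd L \<otimes>\<^sub>2\<^bsub>T\<^esub> ?oneQ) ;;\<^bsub>T\<^esub>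
        ((Csh2 \<Gamma> v \<otimes>\<^sub>2\<^bsub>T\<^esub> ?oneQ) ;;\<^bsub>T\<^esub> \<rho> N Q))"
    unfolding cotrace using simps cg L K v by (simp add: T.Tens2_comp_chain K_def)
  also have "(Csh2 \<Gamma> v \<otimes>\<^sub>2\<^bsub>T\<^esub> ?oneQ) ;;\<^bsub>T\<^esub> \<rho> N Q = \<rho> K Q ;;\<^bsub>T\<^esub> Sh2 \<Sigma>1 (v \<odot>\<^sub>2 \<one> Q)"
    using simps K v \<rho>_natural_left[of v Q "src B F" N] by simp
  also have "Sh2 \<Sigma>1 (v \<odot>\<^sub>2 \<one> Q)
      = Sh2 \<Sigma>1 (\<one> K \<odot>\<^sub>2 ?d) ;;\<^bsub>T\<^esub> (Sh2 \<Sigma>1 ((\<aa> K (Q \<odot> F) Fd)\<^sup>-\<^sup>1) ;;\<^bsub>T\<^esub> (Sh\<theta> \<Sigma>1 (K \<odot> (Q \<odot> F)) Fd ;;\<^bsub>T\<^esub>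
      (Sh2 \<Sigma>1 ((\<aa> Fd K (Q \<odot> F))\<^sup>-\<^sup>1 ;; (evL B Fd L \<odot>\<^sub>2 \<one> (Q \<odot> F))) ;;\<^bsub>T\<^esub> r)))"
    unfolding v_def r_def
    using Sh1.whiskered_unit_rotation[OF F.is_coev Q K eK eL] by simp
  also have "\<rho> K Q ;;\<^bsub>T\<^esub> (Sh2 \<Sigma>1 (\<one> K \<odot>\<^sub>2 ?d) ;;\<^bsub>T\<^esub> (Sh2 \<Sigma>1 ((\<aa> K (Q \<odot> F) Fd)\<^sup>-\<^sup>1) ;;\<^bsub>T\<^esub> (Sh\<theta> \<Sigma>1 (K \<odot> (Q \<odot> F)) Fd ;;\<^bsub>T\<^esub>
      (Sh2 \<Sigma>1 ((\<aa> Fd K (Q \<odot> F))\<^sup>-\<^sup>1 ;; (evL B Fd L \<odot>\<^sub>2 \<one> (Q \<odot> F))) ;;\<^bsub>T\<^esub> r))))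
      = (\<rho> K Q ;;\<^bsub>T\<^esub> Sh2 \<Sigma>1 (\<one> K \<odot>\<^sub>2 ?d)) ;;\<^bsub>T\<^esub> (Sh2 \<Sigma>1 ((\<aa> K (Q \<odot> F) Fd)\<^sup>-\<^sup>1) ;;\<^bsub>T\<^esub> (Sh\<theta> \<Sigma>1 (K \<odot> (Q \<odot> F)) Fd ;;\<^bsub>T\<^esub>
      (Sh2 \<Sigma>1 ((\<aa> Fd K (Q \<odot> F))\<^sup>-\<^sup>1 ;; (evL B Fd L \<odot>\<^sub>2 \<one> (Q \<odot> F))) ;;\<^bsub>T\<^esub> r)))"
    using simps K L eK r by (simp add: T.comp_assoc)
  also have "\<rho> K Q ;;\<^bsub>T\<^esub> Sh2 \<Sigma>1 (\<one> K \<odot>\<^sub>2 ?d) = (\<one>\<^bsub>T\<^esub> (Csh \<Gamma> K) \<otimes>\<^sub>2\<^bsub>T\<^esub> Sh2 \<Sigma>2 ?d) ;;\<^bsub>T\<^esub> \<rho> K ((Q \<odot> F) \<odot> Fd)"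
    using simps K \<rho>_natural_right[of K ?d "src B F" "(Q \<odot> F) \<odot> Fd"] by simp
  also have "((\<one>\<^bsub>T\<^esub> (Csh \<Gamma> K) \<otimes>\<^sub>2\<^bsub>T\<^esub> Sh2 \<Sigma>2 ?d) ;;\<^bsub>T\<^esub> \<rho> K ((Q \<odot> F) \<odot> Fd)) ;;\<^bsub>T\<^esub>
      (Sh2 \<Sigma>1 ((\<aa> K (Q \<odot> F) Fd)\<^sup>-\<^sup>1) ;;\<^bsub>T\<^esub> (Sh\<theta> \<Sigma>1 (K \<odot> (Q \<odot> F)) Fd ;;\<^bsub>T\<^esub>
      (Sh2 \<Sigma>1 ((\<aa> Fd K (Q \<odot> F))\<^sup>-\<^sup>1 ;; (evL B Fd L \<odot>\<^sub>2 \<one> (Q \<odot> F))) ;;\<^bsub>T\<^esub> r)))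
      = (\<one>\<^bsub>T\<^esub> (Csh \<Gamma> K) \<otimes>\<^sub>2\<^bsub>T\<^esub> Sh2 \<Sigma>2 ?d) ;;\<^bsub>T\<^esub> ((\<rho> K ((Q \<odot> F) \<odot> Fd) ;;\<^bsub>T\<^esub>
      (Sh2 \<Sigma>1 ((\<aa> K (Q \<odot> F) Fd)\<^sup>-\<^sup>1) ;;\<^bsub>T\<^esub> (Sh\<theta> \<Sigma>1 (K \<odot> (Q \<odot> F)) Fd ;;\<^bsub>T\<^esub>
      Sh2 \<Sigma>1 ((\<aa> Fd K (Q \<odot> F))\<^sup>-\<^sup>1 ;; (evL B Fd L \<odot>\<^sub>2 \<one> (Q \<odot> F)))))) ;;\<^bsub>T\<^esub> r)"
    using simps K L eK r by (simp add: T.comp_assoc)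
  also have "\<rho> K ((Q \<odot> F) \<odot> Fd) ;;\<^bsub>T\<^esub>
      (Sh2 \<Sigma>1 ((\<aa> K (Q \<odot> F) Fd)\<^sup>-\<^sup>1) ;;\<^bsub>T\<^esub> (Sh\<theta> \<Sigma>1 (K \<odot> (Q \<odot> F)) Fd ;;\<^bsub>T\<^esub>
      Sh2 \<Sigma>1 ((\<aa> Fd K (Q \<odot> F))\<^sup>-\<^sup>1 ;; (evL B Fd L \<odot>\<^sub>2 \<one> (Q \<odot> F)))))
      = ((Csh\<theta> \<Gamma> Fd L)\<^sup>-\<^sup>1\<^bsub>T\<^esub> \<otimes>\<^sub>2\<^bsub>T\<^esub> Sh\<theta> \<Sigma>2 (Q \<odot> F) Fd) ;;\<^bsub>T\<^esub> (\<rho> (Fd \<triangleright> L) (Fd \<odot> (Q \<odot> F)) ;;\<^bsub>T\<^esub> ?ev)"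
    unfolding K_def by (rule \<rho>_cyclic) (use simps L in simp_all)
  also have "(Csh2 \<Gamma> ?cg \<otimes>\<^sub>2\<^bsub>T\<^esub> ?oneQ) ;;\<^bsub>T\<^esub> ((Csh\<theta> \<Gamma> Fd L \<otimes>\<^sub>2\<^bsub>T\<^esub> ?oneQ) ;;\<^bsub>T\<^esub>
      ((\<one>\<^bsub>T\<^esub> (Csh \<Gamma> K) \<otimes>\<^sub>2\<^bsub>T\<^esub> Sh2 \<Sigma>2 ?d) ;;\<^bsub>T\<^esub> ((((Csh\<theta> \<Gamma> Fd L)\<^sup>-\<^sup>1\<^bsub>T\<^esub> \<otimes>\<^sub>2\<^bsub>T\<^esub> Sh\<theta> \<Sigma>2 (Q \<odot> F) Fd) ;;\<^bsub>T\<^esub>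
        (\<rho> (Fd \<triangleright> L) (Fd \<odot> (Q \<odot> F)) ;;\<^bsub>T\<^esub> ?ev)) ;;\<^bsub>T\<^esub> r)))
      = (Csh2 \<Gamma> ?cg \<otimes>\<^sub>2\<^bsub>T\<^esub> (Sh2 \<Sigma>2 ?d ;;\<^bsub>T\<^esub> Sh\<theta> \<Sigma>2 (Q \<odot> F) Fd)) ;;\<^bsub>T\<^esub>
        (\<rho> (Fd \<triangleright> L) (Fd \<odot> (Q \<odot> F)) ;;\<^bsub>T\<^esub> (?ev ;;\<^bsub>T\<^esub> r))"
    using simps cg L K r by (simp add: T.Tens2_comp_chain T.comp_assoc K_def)
  also have "\<dots> = (\<one>\<^bsub>T\<^esub> (Csh \<Gamma> M) \<otimes>\<^sub>2\<^bsub>T\<^esub> (Sh2 \<Sigma>2 ?d ;;\<^bsub>T\<^esub> Sh\<theta> \<Sigma>2 (Q \<odot> F) Fd)) ;;\<^bsub>T\<^esub>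
      (((Csh2 \<Gamma> ?cg \<otimes>\<^sub>2\<^bsub>T\<^esub> \<one>\<^bsub>T\<^esub> (Sh \<Sigma>2 (Fd \<odot> (Q \<odot> F)))) ;;\<^bsub>T\<^esub> \<rho> (Fd \<triangleright> L) (Fd \<odot> (Q \<odot> F))) ;;\<^bsub>T\<^esub> (?ev ;;\<^bsub>T\<^esub> r))"
    using simps cg L K r by (simp add: T.Tens2_comp_chain T.comp_assoc)
  also have "(Csh2 \<Gamma> ?cg \<otimes>\<^sub>2\<^bsub>T\<^esub> \<one>\<^bsub>T\<^esub> (Sh \<Sigma>2 (Fd \<odot> (Q \<odot> F)))) ;;\<^bsub>T\<^esub> \<rho> (Fd \<triangleright> L) (Fd \<odot> (Q \<odot> F))
      = \<rho> M (Fd \<odot> (Q \<odot> F)) ;;\<^bsub>T\<^esub> Sh2 \<Sigma>1 (?cg \<odot>\<^sub>2 \<one> (Fd \<odot> (Q \<odot> F)))"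
    using simps cg L \<rho>_natural_left[of ?cg "Fd \<odot> (Q \<odot> F)" "trg B F" "Fd \<triangleright> L"] by simp
  also have "(\<rho> M (Fd \<odot> (Q \<odot> F)) ;;\<^bsub>T\<^esub> Sh2 \<Sigma>1 (?cg \<odot>\<^sub>2 \<one> (Fd \<odot> (Q \<odot> F)))) ;;\<^bsub>T\<^esub> (?ev ;;\<^bsub>T\<^esub> r)
      = \<rho> M (Fd \<odot> (Q \<odot> F)) ;;\<^bsub>T\<^esub> (Sh2 \<Sigma>1 ((?cg \<odot>\<^sub>2 \<one> (Fd \<odot> (Q \<odot> F))) ;;
        ((\<aa> (Fd \<triangleright> L) Fd (Q \<odot> F))\<^sup>-\<^sup>1 ;; (evR B Fd L \<odot>\<^sub>2 \<one> (Q \<odot> F)))) ;;\<^bsub>T\<^esub> r)"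
    using simps cg L r by (simp add: Sh1.Sh2_comp T.comp_assoc)
  also have "(?cg \<odot>\<^sub>2 \<one> (Fd \<odot> (Q \<odot> F))) ;; ((\<aa> (Fd \<triangleright> L) Fd (Q \<odot> F))\<^sup>-\<^sup>1 ;; (evR B Fd L \<odot>\<^sub>2 \<one> (Q \<odot> F)))
      = (\<aa> M Fd (Q \<odot> F))\<^sup>-\<^sup>1 ;; ((u ;; \<gamma>) \<odot>\<^sub>2 \<one> (Q \<odot> F))"
  proof -
    have "(?cg \<odot>\<^sub>2 \<one> Fd) ;; evR B Fd L = u ;; \<gamma>"
      unfolding u_def c_def[symmetric]
      using simps c L by (simp add: whisker_right evR_natural comp_assoc)
    then show ?thesis
      using simps cg L by (simp add: slide_Assoc_inv(1,4) whisker_right[symmetric])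
  qed
  finally show ?thesis unfolding r_def .
qed

end

section \<open>Multiplicativity of cotraces and traces under a pairing\<close>

theorem theorem6p3:
  fixes B :: "('o, 'c, 'd, 'z) closed_bicategory_scheme" (structure)
    and T :: "('t, 'u, 'w) monoidal_category_scheme" (structure)
    and \<Sigma>1 \<Sigma>2 :: "('c, 'd, 't, 'u) shadow"
    and \<Gamma> :: "('c, 'd, 't, 'u) coshadow"
    and \<rho> :: "'c \<Rightarrow> 'c \<Rightarrow> 'u"
    and R S V :: 'o
    and F Fd G Gd Q N P M Z :: 'c
    and \<eta>F \<epsilon>F \<eta>G \<epsilon>G \<xi> \<gamma> \<zeta> \<delta> :: 'd
  assumes "monoidal_category T"
    and "closed_bicategory B"
    and "shadow B T \<Sigma>1"
    and "shadow B T \<Sigma>2"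
    and "coshadow B T \<Gamma>"
    and "pairing B T \<Gamma> \<Sigma>2 \<Sigma>1 \<rho>"
    and "F \<in> cells B R S"
    and "G \<in> cells B S V"
    and "dual_pair B F Fd \<eta>F \<epsilon>F"
    and "dual_pair B G Gd \<eta>G \<epsilon>G"
    and "Q \<in> cells B R R"
    and "N \<in> cells B R R"
    and "P \<in> cells B S S"
    and "M \<in> cells B S S"
    and "Z \<in> cells B V V"
    and "\<xi> \<in> hom B (Q \<odot> F) (F \<odot> P)"
    and "\<gamma> \<in> hom B (F \<triangleright> M) (N \<triangleleft> F)"
    and "\<zeta> \<in> hom B ((N \<odot> Q) \<odot> (F \<odot> G)) ((F \<odot> G) \<odot> Z)"
    and "\<delta> \<in> hom B ((M \<odot> P) \<odot> G) (G \<odot> Z)"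
    \<comment> \<open>both sides run from \<open>(F \<odot> (F \<triangleright> M)) \<odot> (Q \<odot> (F \<odot> G))\<close> to \<open>(F \<odot> G) \<odot> Z\<close>\<close>
    and "((\<one> F \<odot>\<^sub>2 \<gamma>) \<odot>\<^sub>2 \<one> (Q \<odot> (F \<odot> G)))
          ;; (evL B F N \<odot>\<^sub>2 \<one> (Q \<odot> (F \<odot> G)))
          ;; (\<aa> N Q (F \<odot> G))\<^sup>-\<^sup>1
          ;; \<zeta>
        = (\<one> (F \<odot> (F \<triangleright> M)) \<odot>\<^sub>2 ((\<aa> Q F G)\<^sup>-\<^sup>1 ;; (\<xi> \<odot>\<^sub>2 \<one> G) ;; \<aa> F P G))
          ;; \<aa> F (F \<triangleright> M) (F \<odot> (P \<odot> G))
          ;; (\<one> F \<odot>\<^sub>2 ((\<aa> (F \<triangleright> M) F (P \<odot> G))\<^sup>-\<^sup>1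
                ;; (evR B F M \<odot>\<^sub>2 \<one> (P \<odot> G))
                ;; (\<aa> M P G)\<^sup>-\<^sup>1
                ;; \<delta>))
          ;; (\<aa> F G Z)\<^sup>-\<^sup>1"
  shows "(cotrace B T \<Gamma> F Fd \<eta>F \<epsilon>F M N \<gamma> \<otimes>\<^sub>2\<^bsub>T\<^esub> \<one>\<^bsub>T\<^esub> (Sh \<Sigma>2 Q))
          ;;\<^bsub>T\<^esub> \<rho> N Q
          ;;\<^bsub>T\<^esub> trace B T \<Sigma>1 (F \<odot> G) (Gd \<odot> Fd)
                (comp_unit B F Fd \<eta>F G Gd \<eta>G) (comp_counit B F Fd \<epsilon>F G Gd \<epsilon>G) (N \<odot> Q) Z \<zeta>
        = (\<one>\<^bsub>T\<^esub> (Csh \<Gamma> M) \<otimes>\<^sub>2\<^bsub>T\<^esub> trace B T \<Sigma>2 F Fd \<eta>F \<epsilon>F Q P \<xi>)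
          ;;\<^bsub>T\<^esub> \<rho> M P
          ;;\<^bsub>T\<^esub> trace B T \<Sigma>1 G Gd \<eta>G \<epsilon>G (M \<odot> P) Z \<delta>"
proof -
  interpret pairing B T \<Gamma> \<Sigma>2 \<Sigma>1 \<rho> by fact
  interpret F: dual_pair B F Fd \<eta>F \<epsilon>F by fact
  interpret G: dual_pair B G Gd \<eta>G \<epsilon>G by fact
  have F: "F \<in> Obj B" "src B F = R" "trg B F = S" and G: "G \<in> Obj B" "src B G = S" "trg B G = V"
    and Q: "Q \<in> Obj B" "src B Q = R" "trg B Q = R" and N: "N \<in> Obj B" "src B N = R" "trg B N = R"
    and P: "P \<in> Obj B" "src B P = S" "trg B P = S" and M: "M \<in> Obj B" "src B M = S" "trg B M = S"
    and Z: "Z \<in> Obj B" "src B Z = V" "trg B Z = V"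
    using assms by (simp_all add: cells_simps)
  note typing = F G Q N P M Z
  have \<xi>: "\<xi> \<in> Arr B" "Dom B \<xi> = Q \<odot> F" "Cod B \<xi> = F \<odot> P"
    and \<gamma>: "\<gamma> \<in> Arr B" "Dom B \<gamma> = F \<triangleright> M" "Cod B \<gamma> = N \<triangleleft> F"
    and \<zeta>: "\<zeta> \<in> Arr B" "Dom B \<zeta> = (N \<odot> Q) \<odot> (F \<odot> G)" "Cod B \<zeta> = (F \<odot> G) \<odot> Z"
    and \<delta>: "\<delta> \<in> Arr B" "Dom B \<delta> = (M \<odot> P) \<odot> G" "Cod B \<delta> = G \<odot> Z"
    using assms by (simp_all add: hom_iff)
  note duals = F.is_coev F.is_ev G.is_coev G.is_ev
    coev_simps(1-4)[OF F.is_coev] coev_simps(1-4)[OF G.is_coev]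
  define c where "c = rbar B M ;; (\<epsilon>F \<triangleright>\<^sub>2 \<one> M) ;; tR B Fd F M"
  define u where "u = (c \<odot>\<^sub>2 \<one> Fd) ;; evR B Fd (F \<triangleright> M)"
  define L where "L = N \<triangleleft> F"
  have L: "L \<in> Obj B" "src B L = S" "trg B L = R"
    using typing by (simp_all add: L_def)
  have c: "c \<in> Arr B" "Dom B c = M" "Cod B c = Fd \<triangleright> (F \<triangleright> M)"
    using cotrace_entry(1)[OF F.is_ev, of M] typing by (simp_all add: c_def hom_iff)
  have u: "u \<in> Arr B" "Dom B u = M \<odot> Fd" "Cod B u = F \<triangleright> M"
    using typing duals c by (simp_all add: u_def)
  have uw: "(u \<odot>\<^sub>2 \<one> F) ;; evR B F M = \<aa> M Fd F ;; ((\<one> M \<odot>\<^sub>2 \<epsilon>F) ;; \<rr> M)"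
    using cotrace_entry(2)[OF F.is_ev, of M] typing by (simp add: u_def c_def)
  let ?trFG = "trace B T \<Sigma>1 (F \<odot> G) (Gd \<odot> Fd)
    (comp_unit B F Fd \<eta>F G Gd \<eta>G) (comp_counit B F Fd \<epsilon>F G Gd \<epsilon>G) (N \<odot> Q) Z \<zeta>"
  let ?trG = "trace B T \<Sigma>1 G Gd \<eta>G \<epsilon>G (M \<odot> P) Z \<delta>"
  let ?d = "Sh2 \<Sigma>2 (dunit F Fd \<eta>F Q) ;;\<^bsub>T\<^esub> Sh\<theta> \<Sigma>2 (Q \<odot> F) Fd"
  let ?e = "(\<one> Fd \<odot>\<^sub>2 \<xi>) ;; dcounit F Fd \<epsilon>F P"
  have FG: "coev (F \<odot> G) (Gd \<odot> Fd) (comp_unit B F Fd \<eta>F G Gd \<eta>G)"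
    "ev (F \<odot> G) (Gd \<odot> Fd) (comp_counit B F Fd \<epsilon>F G Gd \<epsilon>G)"
    using typing duals by (simp_all add: coev_comp ev_comp)
  have trFG: "?trFG \<in> Arr T" "Dom T ?trFG = Sh \<Sigma>1 (N \<odot> Q)"
    and trG: "?trG \<in> Arr T" "Dom T ?trG = Sh \<Sigma>1 (M \<odot> P)"
    using typing duals FG \<zeta> \<delta> by (simp_all add: Sh1.trace_simps)
  have "(cotrace B T \<Gamma> F Fd \<eta>F \<epsilon>F M N \<gamma> \<otimes>\<^sub>2\<^bsub>T\<^esub> \<one>\<^bsub>T\<^esub> (Sh \<Sigma>2 Q)) ;;\<^bsub>T\<^esub> \<rho> N Q ;;\<^bsub>T\<^esub> ?trFG
      = (\<one>\<^bsub>T\<^esub> (Csh \<Gamma> M) \<otimes>\<^sub>2\<^bsub>T\<^esub> ?d) ;;\<^bsub>T\<^esub> (\<rho> M (Fd \<odot> (Q \<odot> F)) ;;\<^bsub>T\<^esub>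
      (Sh2 \<Sigma>1 ((\<aa> M Fd (Q \<odot> F))\<^sup>-\<^sup>1 ;; ((u ;; \<gamma>) \<odot>\<^sub>2 \<one> (Q \<odot> F))) ;;\<^bsub>T\<^esub> (Sh2 \<Sigma>1 ((\<aa> L Q F)\<^sup>-\<^sup>1) ;;\<^bsub>T\<^esub>
      (Sh\<theta> \<Sigma>1 (L \<odot> Q) F ;;\<^bsub>T\<^esub> Sh2 \<Sigma>1 ((\<aa> F L Q)\<^sup>-\<^sup>1 ;; (evL B F N \<odot>\<^sub>2 \<one> Q)))))) ;;\<^bsub>T\<^esub> ?trFG"
    unfolding u_def c_def L_def using cotrace_pairing[OF assms(9), of M N Q \<gamma>] typing \<gamma> by simp
  also have "\<dots> = (\<one>\<^bsub>T\<^esub> (Csh \<Gamma> M) \<otimes>\<^sub>2\<^bsub>T\<^esub> ?d) ;;\<^bsub>T\<^esub> (\<rho> M (Fd \<odot> (Q \<odot> F)) ;;\<^bsub>T\<^esub>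
      (Sh2 \<Sigma>1 ((\<aa> M Fd (Q \<odot> F))\<^sup>-\<^sup>1 ;; ((u ;; \<gamma>) \<odot>\<^sub>2 \<one> (Q \<odot> F))) ;;\<^bsub>T\<^esub> (Sh2 \<Sigma>1 ((\<aa> L Q F)\<^sup>-\<^sup>1) ;;\<^bsub>T\<^esub>
      (Sh\<theta> \<Sigma>1 (L \<odot> Q) F ;;\<^bsub>T\<^esub> (Sh2 \<Sigma>1 ((\<aa> F L Q)\<^sup>-\<^sup>1 ;; (evL B F N \<odot>\<^sub>2 \<one> Q)) ;;\<^bsub>T\<^esub> ?trFG)))))"
    using typing duals L u \<gamma>(1,2) \<gamma>(3)[folded L_def] trFG L_def[symmetric] by (simp add: T.comp_assoc)
  also have "Sh2 \<Sigma>1 ((\<aa> M Fd (Q \<odot> F))\<^sup>-\<^sup>1 ;; ((u ;; \<gamma>) \<odot>\<^sub>2 \<one> (Q \<odot> F))) ;;\<^bsub>T\<^esub> (Sh2 \<Sigma>1 ((\<aa> L Q F)\<^sup>-\<^sup>1) ;;\<^bsub>T\<^esub>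
      (Sh\<theta> \<Sigma>1 (L \<odot> Q) F ;;\<^bsub>T\<^esub> (Sh2 \<Sigma>1 ((\<aa> F L Q)\<^sup>-\<^sup>1 ;; (evL B F N \<odot>\<^sub>2 \<one> Q)) ;;\<^bsub>T\<^esub> ?trFG)))
      = Sh2 \<Sigma>1 (\<one> M \<odot>\<^sub>2 ?e) ;;\<^bsub>T\<^esub> ?trG"
    by (rule Sh1.trace_exchange[OF assms(9,10), where J = "F \<triangleright> M" and w = "evR B F M"])
      (use typing \<xi> \<gamma> \<zeta> \<delta> u uw assms(20) in \<open>simp_all add: L_def\<close>)
  also have "(\<one>\<^bsub>T\<^esub> (Csh \<Gamma> M) \<otimes>\<^sub>2\<^bsub>T\<^esub> ?d) ;;\<^bsub>T\<^esub> (\<rho> M (Fd \<odot> (Q \<odot> F)) ;;\<^bsub>T\<^esub> (Sh2 \<Sigma>1 (\<one> M \<odot>\<^sub>2 ?e) ;;\<^bsub>T\<^esub> ?trG))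
      = (\<one>\<^bsub>T\<^esub> (Csh \<Gamma> M) \<otimes>\<^sub>2\<^bsub>T\<^esub> ?d) ;;\<^bsub>T\<^esub> ((\<rho> M (Fd \<odot> (Q \<odot> F)) ;;\<^bsub>T\<^esub> Sh2 \<Sigma>1 (\<one> M \<odot>\<^sub>2 ?e)) ;;\<^bsub>T\<^esub> ?trG)"
    using typing duals \<xi> trG by (simp add: T.comp_assoc)
  also have "\<rho> M (Fd \<odot> (Q \<odot> F)) ;;\<^bsub>T\<^esub> Sh2 \<Sigma>1 (\<one> M \<odot>\<^sub>2 ?e) = (\<one>\<^bsub>T\<^esub> (Csh \<Gamma> M) \<otimes>\<^sub>2\<^bsub>T\<^esub> Sh2 \<Sigma>2 ?e) ;;\<^bsub>T\<^esub> \<rho> M P"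
    using typing duals \<xi> \<rho>_natural_right[of M ?e S P] by simp
  also have "(\<one>\<^bsub>T\<^esub> (Csh \<Gamma> M) \<otimes>\<^sub>2\<^bsub>T\<^esub> ?d) ;;\<^bsub>T\<^esub> (((\<one>\<^bsub>T\<^esub> (Csh \<Gamma> M) \<otimes>\<^sub>2\<^bsub>T\<^esub> Sh2 \<Sigma>2 ?e) ;;\<^bsub>T\<^esub> \<rho> M P) ;;\<^bsub>T\<^esub> ?trG)
      = (\<one>\<^bsub>T\<^esub> (Csh \<Gamma> M) \<otimes>\<^sub>2\<^bsub>T\<^esub> (?d ;;\<^bsub>T\<^esub> Sh2 \<Sigma>2 ?e)) ;;\<^bsub>T\<^esub> \<rho> M P ;;\<^bsub>T\<^esub> ?trG"
    using typing duals \<xi> trG by (simp add: T.Tens2_comp_chain T.comp_assoc)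
  \<comment> \<open>\<open>\<xi>\<close> was applied after the rotation; by naturality of \<open>\<theta>\<close> it may come first, as in the trace.\<close>
  also have "?d ;;\<^bsub>T\<^esub> Sh2 \<Sigma>2 ?e = trace B T \<Sigma>2 F Fd \<eta>F \<epsilon>F Q P \<xi>"
  proof -
    have "trace B T \<Sigma>2 F Fd \<eta>F \<epsilon>F Q P \<xi>
        = Sh2 \<Sigma>2 (dunit F Fd \<eta>F Q) ;;\<^bsub>T\<^esub> (Sh2 \<Sigma>2 (\<xi> \<odot>\<^sub>2 \<one> Fd) ;;\<^bsub>T\<^esub> (Sh\<theta> \<Sigma>2 (F \<odot> P) Fd ;;\<^bsub>T\<^esub> Sh2 \<Sigma>2 (dcounit F Fd \<epsilon>F P)))"
      using typing duals \<xi> by (simp add: Sh2.trace_eq Sh2.Sh2_comp T.comp_assoc)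
    also have "\<dots> = ?d ;;\<^bsub>T\<^esub> Sh2 \<Sigma>2 ?e"
      using typing duals \<xi> by (simp add: Sh2.Sh\<theta>_natural_chain Sh2.Sh2_comp T.comp_assoc)
    finally show ?thesis by simp
  qed
  finally show ?thesis .
qed

end
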